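(* Let $W$ be a standard Brownian motion and let $S(t)=\sup_{0\le s\le t}W(s)$, $0\le t\le 1$. Let $\psi:[0,1]\to\mathbb{R}$ be positive and twice continuously differentiable on $[0,1]$, and let $\vartheta=\int_0^1\sqrt{\psi(t)}\,dt$. Then, as $\varepsilon\to0+$, $$ \mathsf{P}\{\|S - W\|_\psi\leq\varepsilon\}\sim \frac{4\,\psi^{1/8}(0)}{\sqrt\pi\,\vartheta\,\psi^{1/8}(1)}\, \varepsilon\, \exp\left(-\frac{\vartheta^2}{8}\varepsilon^{-2}\right). $$
   Context: For a process $X(t)$, $0\le t\le 1$, and a non-negative weight $\psi$ on $[0,1]$, $\|X\|_\psi=\left(\int_0^1X^2(t)\psi(t)\,dt\right)^{1/2}$. The notation $f(\varepsilon)\sim g(\varepsilon)$ means $f(\varepsilon)/g(\varepsilon)\to1$. $\psi^{a}(t)$ means $(\psi(t))^{a}$. *)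

theory Defs
  imports "HOL-Probability.Probability" "HOL-Library.Landau_Symbols"
begin

text \<open>
  The path \<open>t \<mapsto> W t \<omega>\<close> is continuous for every \<open>\<omega>\<close>, not merely for almost every one. Path
  functionals such as running suprema are then measurable without assuming that \<open>M\<close> is complete.
\<close>

definition standard_brownian_motion_on ::
    "real set \<Rightarrow> 'a measure \<Rightarrow> (real \<Rightarrow> 'a \<Rightarrow> real) \<Rightarrow> bool" where
  "standard_brownian_motion_on I M W \<longleftrightarrow>
     prob_space M \<and>
     (\<forall>t\<in>I. W t \<in> borel_measurable M) \<and>
     (AE \<omega> in M. W 0 \<omega> = 0) \<and>
     (\<forall>(n::nat) (t :: nat \<Rightarrow> real). (\<forall>i\<le>n. t i \<in> I) \<longrightarrow> (\<forall>i<n. t i < t (Suc i)) \<longrightarrow>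
        prob_space.indep_vars M (\<lambda>_. borel) (\<lambda>i \<omega>. W (t (Suc i)) \<omega> - W (t i) \<omega>) {..<n}) \<and>
     (\<forall>s\<in>I. \<forall>t\<in>I. s < t \<longrightarrow>
        distributed M lborel (\<lambda>\<omega>. W t \<omega> - W s \<omega>) (normal_density 0 (sqrt (t - s)))) \<and>
     (\<forall>\<omega>\<in>space M. continuous_on I (\<lambda>t. W t \<omega>))"

definition running_sup :: "(real \<Rightarrow> 'a \<Rightarrow> real) \<Rightarrow> real \<Rightarrow> 'a \<Rightarrow> real" where
  "running_sup X t \<omega> = (SUP s\<in>{0..t}. X s \<omega>)"

definition weighted_L2_norm :: "(real \<Rightarrow> real) \<Rightarrow> (real \<Rightarrow> real) \<Rightarrow> real" where
  "weighted_L2_norm \<psi> x = sqrt (LBINT t:{0..1}. (x t)\<^sup>2 * \<psi> t)"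

text \<open>Derivatives are taken within \<open>S\<close>, hence are one-sided at the endpoints of an interval.\<close>

definition twice_continuously_differentiable_on :: "real set \<Rightarrow> (real \<Rightarrow> real) \<Rightarrow> bool" where
  "twice_continuously_differentiable_on S f \<longleftrightarrow>
     (\<exists>f' f''. (\<forall>t\<in>S. (f has_real_derivative f' t) (at t within S)) \<and>
               (\<forall>t\<in>S. (f' has_real_derivative f'' t) (at t within S)) \<and>
               continuous_on S f'')"

end

theory Submission
  imports Defs "HOL-Real_Asymp.Real_Asymp"
begin

text \<open>
  Sample \<open>W\<close> on the grid of mesh \<open>1/n\<close>. The reflected walk \<open>Z\<^sub>k\<^sub>+\<^sub>1 = \<bar>Z\<^sub>k - \<xi>\<^sub>k\<bar>\<close> driven by the
  increments \<open>\<xi>\<^sub>k\<close> has the law of a sampled \<open>\<bar>W\<bar>\<close>, and by a discrete Skorokhod argument it stays within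
  \<open>max\<^sub>k \<bar>\<xi>\<^sub>k\<bar>\<close> of \<open>S - W\<close>; this replaces Levy's theorem. For every positive sequence \<open>v\<close>, iterated Gaussian
  integration evaluates in closed form the Laplace functional of \<open>Z\<close> with potential \<open>v''/v\<close> (second
  differences). A discrete Liouville substitution \<open>v \<mapsto> \<psi>\<^sup>1\<^sup>/\<^sup>4 v\<close>, which is again exact, turns the
  weight \<open>\<psi>\<close> into the constant weight on a walk with horizon \<open>\<theta>\<close>, at the price of a density that is
  \<open>1 + o(1)\<close> on the small ball up to a terminal factor; the prefactor is \<open>(\<psi>(0)/\<psi>(1))\<^sup>1\<^sup>/\<^sup>8\<close>. Equality of
  Laplace transforms at the integers gives equality of laws by Weierstrass approximation. For the
  constant weight the Laplace transform tends to \<open>(cosh (\<theta> \<surd>(2s)))\<^sup>-\<^sup>1\<^sup>/\<^sup>2\<close>, which expands into Laplace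
  transforms of the one-sided stable laws \<open>(2k + 1/2)\<^sup>2 \<theta>\<^sup>2 / N\<^sup>2\<close>, \<open>N\<close> standard normal; the term \<open>k = 0\<close>
  dominates and Mills' ratio yields the constant.
\<close>

section \<open>The Laplace functional of a reflected Gaussian walk\<close>

text \<open>The probabilities are exponentially small, so every error must be small relative to
  exp(-\<theta>^2/(8x)), x = \<epsilon>^2. Hence the order of limits: the mesh tends to 0 at fixed
  x, by exact identities or errors of order \<sigma>^2, and only then x tends to 0. Why the power
  1/4: a weight a^4 on the plain walk becomes a weight a^2 on the new one, whose step variance is
  \<sigma>^2 a a', so the new weight is the element of its own clock. The terminal factor exp(c/2
  Y^2) of the density is unbounded on the ball. A second Laplace identity bounds exp(l/8 Y^2) there,
  with l = \<theta>/(2x), the minimiser of l^2 x/2 - l \<theta>/2. As x tends to 0, c/2 is a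
  vanishing fraction of l/8, and convexity of exp leaves a correction of order x
  exp(-\<theta>^2/(8x)), against a main term of order sqrt(x) exp(-\<theta>^2/(8x)). The stable
  expansion has coefficients of size k^(-1/2), so it is not absolutely summable as a signed measure.
  Laws are therefore compared after multiplication by exp(-A), which damps the series; test
  functions vanishing for large A can be divided by this factor again.\<close>

lemma nn_integral_normal_density:
  "\<sigma> > 0 \<Longrightarrow> (\<integral>\<^sup>+x. ennreal (normal_density \<mu> \<sigma> x) \<partial>lborel) = 1"
  by (subst nn_integral_eq_integral) auto

text \<open>Completing the square in x. The map from c to c / (1 - \<sigma>^2 r^2 c) is a one-step
  Riccati recursion, linearised later by writing c through quotients of a sequence v.\<close>

lemma nn_integral_gaussian_square:
  fixes c r z \<sigma> :: real
  assumes "\<sigma> > 0" "1 - \<sigma>\<^sup>2 * r\<^sup>2 * c > 0"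
  shows "(\<integral>\<^sup>+x. ennreal (normal_density 0 \<sigma> x) * ennreal (exp (c * (z - r * x)\<^sup>2 / 2)) \<partial>lborel)
       = ennreal (exp (c / (1 - \<sigma>\<^sup>2 * r\<^sup>2 * c) * z\<^sup>2 / 2) / sqrt (1 - \<sigma>\<^sup>2 * r\<^sup>2 * c))"
proof -
  define D where "D = 1 - \<sigma>\<^sup>2 * r\<^sup>2 * c"
  \<comment> \<open>Mean of the Gaussian that remains after completing the square; its standard
    deviation is \<sigma> / sqrt D.\<close>
  define \<mu> where "\<mu> = - (c * r * z * \<sigma>\<^sup>2) / D"
  define K where "K = exp (c / D * z\<^sup>2 / 2) / sqrt D"
  have D: "D > 0" using assms by (simp add: D_def)
  have \<sigma>: "\<sigma> \<noteq> 0" using assms by simp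
  have *: "normal_density 0 \<sigma> x * exp (c * (z - r * x)\<^sup>2 / 2) = K * normal_density \<mu> (\<sigma> / sqrt D) x" for x
  proof -
    have "- x\<^sup>2 / (2 * \<sigma>\<^sup>2) + c * (z - r * x)\<^sup>2 / 2 = c / D * z\<^sup>2 / 2 - D * (x - \<mu>)\<^sup>2 / (2 * \<sigma>\<^sup>2)"
    proof -
      have "D * \<mu> = - (c * r * z * \<sigma>\<^sup>2)" using D by (simp add: \<mu>_def)
      then have 1: "D * (x - \<mu>)\<^sup>2 = D * x\<^sup>2 + 2 * (c * r * z * \<sigma>\<^sup>2) * x + (c * r * z * \<sigma>\<^sup>2)\<^sup>2 / D"
        using D by (simp add: \<mu>_def field_simps power2_eq_square)
      have 2: "c / D * z\<^sup>2 / 2 - (c * r * z * \<sigma>\<^sup>2)\<^sup>2 / D / (2 * \<sigma>\<^sup>2) = c * z\<^sup>2 * (1 - \<sigma>\<^sup>2 * r\<^sup>2 * c) / (2 * D)"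
        using D \<sigma> by (simp add: field_simps power2_eq_square)
      have 3: "\<dots> = c * z\<^sup>2 / 2" using D by (simp add: D_def[symmetric])
      have 4: "D * x\<^sup>2 / (2 * \<sigma>\<^sup>2) = x\<^sup>2 / (2 * \<sigma>\<^sup>2) - r\<^sup>2 * c * x\<^sup>2 / 2"
        using \<sigma> by (simp add: D_def field_simps)
      have 5: "2 * (c * r * z * \<sigma>\<^sup>2) * x / (2 * \<sigma>\<^sup>2) = c * r * z * x" using \<sigma> by (simp add: field_simps)
      have "c / D * z\<^sup>2 / 2 - D * (x - \<mu>)\<^sup>2 / (2 * \<sigma>\<^sup>2)
        = (c / D * z\<^sup>2 / 2 - (c * r * z * \<sigma>\<^sup>2)\<^sup>2 / D / (2 * \<sigma>\<^sup>2)) - D * x\<^sup>2 / (2 * \<sigma>\<^sup>2) - 2 * (c * r * z * \<sigma>\<^sup>2) * x / (2 * \<sigma>\<^sup>2)"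
        unfolding 1 by (simp add: add_divide_distrib)
      also have "\<dots> = c * z\<^sup>2 / 2 - (x\<^sup>2 / (2 * \<sigma>\<^sup>2) - r\<^sup>2 * c * x\<^sup>2 / 2) - c * r * z * x"
        unfolding 2 3 4 5 ..
      also have "\<dots> = - x\<^sup>2 / (2 * \<sigma>\<^sup>2) + c * (z - r * x)\<^sup>2 / 2"
        by (simp add: field_simps power2_eq_square)
      finally show ?thesis by simp
    qed
    moreover have "sqrt (2 * pi * (\<sigma> / sqrt D)\<^sup>2) * sqrt D = sqrt (2 * pi * \<sigma>\<^sup>2)"
      using D by (simp add: real_sqrt_mult[symmetric] power_divide)
    ultimately show ?thesis
      using D \<sigma> by (simp add: normal_density_def K_def exp_add[symmetric] mult_exp_exp power_divide field_simps)
  qed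
  have "(\<integral>\<^sup>+x. ennreal (normal_density 0 \<sigma> x) * ennreal (exp (c * (z - r * x)\<^sup>2 / 2)) \<partial>lborel)
      = (\<integral>\<^sup>+x. ennreal K * ennreal (normal_density \<mu> (\<sigma> / sqrt D) x) \<partial>lborel)"
    using D by (simp add: ennreal_mult[symmetric] * K_def)
  also have "\<dots> = ennreal K"
    using D assms by (subst nn_integral_cmult) (auto simp: nn_integral_normal_density)
  finally show ?thesis by (simp add: K_def D_def)
qed

text \<open>The Laplace identities see only squares of the walk, where the absolute value
  disappears; it is the reflection at 0 that ties the walk with \<open>r = (\<lambda>_. 1)\<close>
  to the path S - W. The scales \<open>r\<close> allow a deterministic time change.\<close>

primrec reflected_walk :: "(nat \<Rightarrow> real) \<Rightarrow> (nat \<Rightarrow> real) \<Rightarrow> nat \<Rightarrow> real" where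
  "reflected_walk r x 0 = 0"
| "reflected_walk r x (Suc k) = \<bar>reflected_walk r x k - r k * x k\<bar>"

lemma reflected_walk_cong:
  "(\<And>i. i < k \<Longrightarrow> x i = y i) \<Longrightarrow> reflected_walk r x k = reflected_walk r y k"
  by (induction k) auto

lemma measurable_reflected_walk [measurable (raw)]:
  assumes "\<And>i. i < k \<Longrightarrow> (\<lambda>\<omega>. x i \<omega>) \<in> borel_measurable M"
  shows "(\<lambda>\<omega>. reflected_walk r (\<lambda>i. x i \<omega>) k) \<in> borel_measurable M"
  using assms by (induction k) auto

lemma measurable_reflected_walk_PiM:
  "k \<le> j \<Longrightarrow> (\<lambda>x. reflected_walk r x k) \<in> borel_measurable (PiM {..<j} (\<lambda>_. borel))"
  using measurable_reflected_walk[of k "\<lambda>i x. x i" "PiM {..<j} (\<lambda>_. borel)" r]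
  by auto

text \<open>Integrates out the newest increment: it is independent of the vector of earlier ones, so
  the joint law is a product and the inner integral is the Gaussian one with the walk value frozen.
  \<open>F\<close> carries whatever has been accumulated before.\<close>

lemma (in prob_space) nn_integral_step:
  fixes \<zeta> :: "nat \<Rightarrow> 'a \<Rightarrow> real"
  assumes ind: "indep_vars (\<lambda>_. borel) \<zeta> {..<n}" and j: "j < n"
    and dist: "distributed M lborel (\<zeta> j) (normal_density 0 \<sigma>)" and \<sigma>: "\<sigma> > 0"
    and F: "F \<in> borel_measurable (PiM {..<j} (\<lambda>_. borel))"
    and Z: "Z \<in> borel_measurable (PiM {..<j} (\<lambda>_. borel))"
    and c: "1 - \<sigma>\<^sup>2 * r\<^sup>2 * c > 0"
  shows "(\<integral>\<^sup>+\<omega>. F (\<lambda>i\<in>{..<j}. \<zeta> i \<omega>) * ennreal (exp (c * (Z (\<lambda>i\<in>{..<j}. \<zeta> i \<omega>) - r * \<zeta> j \<omega>)\<^sup>2 / 2)) \<partial>M)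
       = (\<integral>\<^sup>+\<omega>. F (\<lambda>i\<in>{..<j}. \<zeta> i \<omega>) * ennreal (exp (c / (1 - \<sigma>\<^sup>2 * r\<^sup>2 * c) * (Z (\<lambda>i\<in>{..<j}. \<zeta> i \<omega>))\<^sup>2 / 2)
            / sqrt (1 - \<sigma>\<^sup>2 * r\<^sup>2 * c)) \<partial>M)"
proof -
  define P where "P = PiM {..<j} (\<lambda>_. borel :: real measure)"
  define p where "p = (\<lambda>\<omega>. \<lambda>i\<in>{..<j}. \<zeta> i \<omega>)"
  define Q where "Q = PiM {j} (\<lambda>_. borel :: real measure)"
  define q where "q = (\<lambda>\<omega>. \<lambda>i\<in>{j}. \<zeta> i \<omega>)"
  note [measurable] = F[folded P_def] Z[folded P_def]
  have \<zeta>: "\<zeta> i \<in> borel_measurable M" if "i < n" for i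
    using ind that by (auto simp: indep_vars_def)
  have [measurable]: "\<zeta> j \<in> borel_measurable M" using \<zeta> j by auto
  have p [measurable]: "p \<in> measurable M P"
    unfolding p_def P_def using \<zeta> j by (auto intro!: measurable_restrict)
  have [measurable]: "q \<in> measurable M Q"
    unfolding q_def Q_def using \<zeta> j by (auto intro!: measurable_restrict)
  have q_app: "q \<omega> j = \<zeta> j \<omega>" for \<omega> by (simp add: q_def)
  have [measurable]: "(\<lambda>x. x j) \<in> borel_measurable Q"
    unfolding Q_def by simp
  have "indep_var (PiM {..<j} (\<lambda>_. borel)) (\<lambda>\<omega>. \<lambda>i\<in>{..<j}. \<zeta> i \<omega>) (PiM {j} (\<lambda>_. borel)) (\<lambda>\<omega>. \<lambda>i\<in>{j}. \<zeta> i \<omega>)"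
    by (rule indep_var_restrict[OF ind]) (use j in auto)
  then have eq: "distr M P p \<Otimes>\<^sub>M distr M Q q = distr M (P \<Otimes>\<^sub>M Q) (\<lambda>\<omega>. (p \<omega>, q \<omega>))"
    by (simp add: indep_var_distribution_eq P_def p_def Q_def q_def)
  have dj: "distr M borel (\<zeta> j) = density lborel (\<lambda>x. ennreal (normal_density 0 \<sigma> x))"
    using dist by (simp add: distributed_def cong: distr_cong)
  have Qint: "(\<integral>\<^sup>+y. g (y j) \<partial>distr M Q q) = (\<integral>\<^sup>+x. ennreal (normal_density 0 \<sigma> x) * g x \<partial>lborel)"
    if [measurable]: "g \<in> borel_measurable borel" for g :: "real \<Rightarrow> ennreal"
  proof -
    have "(\<integral>\<^sup>+y. g (y j) \<partial>distr M Q q) = (\<integral>\<^sup>+\<omega>. g (\<zeta> j \<omega>) \<partial>M)"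
      by (subst nn_integral_distr) (auto intro!: nn_integral_cong simp: q_app)
    also have "\<dots> = (\<integral>\<^sup>+x. g x \<partial>distr M borel (\<zeta> j))"
      by (subst nn_integral_distr) auto
    also have "\<dots> = (\<integral>\<^sup>+x. ennreal (normal_density 0 \<sigma> x) * g x \<partial>lborel)"
      unfolding dj by (subst nn_integral_density) auto
    finally show ?thesis .
  qed
  interpret Q: prob_space "distr M Q q" by (rule prob_space_distr) simp
  have "(\<integral>\<^sup>+\<omega>. F (p \<omega>) * ennreal (exp (c * (Z (p \<omega>) - r * \<zeta> j \<omega>)\<^sup>2 / 2)) \<partial>M)
     = (\<integral>\<^sup>+w. F (fst w) * ennreal (exp (c * (Z (fst w) - r * snd w j)\<^sup>2 / 2)) \<partial>distr M (P \<Otimes>\<^sub>M Q) (\<lambda>\<omega>. (p \<omega>, q \<omega>)))"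
    by (subst nn_integral_distr) (auto intro!: nn_integral_cong simp: q_app)
  also have "\<dots> = (\<integral>\<^sup>+y. \<integral>\<^sup>+x. F y * ennreal (exp (c * (Z y - r * x j)\<^sup>2 / 2)) \<partial>distr M Q q \<partial>distr M P p)"
    unfolding eq[symmetric] by (subst Q.nn_integral_fst[symmetric]) auto
  also have "\<dots> = (\<integral>\<^sup>+y. F y * ennreal (exp (c / (1 - \<sigma>\<^sup>2 * r\<^sup>2 * c) * (Z y)\<^sup>2 / 2) / sqrt (1 - \<sigma>\<^sup>2 * r\<^sup>2 * c)) \<partial>distr M P p)"
    using \<sigma> c by (subst nn_integral_cmult, simp, subst Qint, simp, subst nn_integral_gaussian_square) auto
  also have "\<dots> = (\<integral>\<^sup>+\<omega>. F (p \<omega>) * ennreal (exp (c / (1 - \<sigma>\<^sup>2 * r\<^sup>2 * c) * (Z (p \<omega>))\<^sup>2 / 2) / sqrt (1 - \<sigma>\<^sup>2 * r\<^sup>2 * c)) \<partial>M)"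
    by (subst nn_integral_distr) auto
  finally show ?thesis by (simp add: p_def)
qed

text \<open>The sequence \<open>v\<close> is free and \<open>d\<close> is its difference quotient, so no difference equation has to be solved here.\<close>

lemma (in prob_space) laplace_reflected_walk:
  fixes \<zeta> :: "nat \<Rightarrow> 'a \<Rightarrow> real" and v r :: "nat \<Rightarrow> real" and \<sigma> :: real
  defines "d \<equiv> \<lambda>k. (v (Suc k) - v k) / (\<sigma>\<^sup>2 * (r k)\<^sup>2)"
  assumes ind: "indep_vars (\<lambda>_. borel) \<zeta> {..<n}"
    and dist: "\<And>k. k < n \<Longrightarrow> distributed M lborel (\<zeta> k) (normal_density 0 \<sigma>)" and \<sigma>: "\<sigma> > 0"
    and r: "\<And>k. k < n \<Longrightarrow> r k > 0" and v: "\<And>k. k \<le> n \<Longrightarrow> v k > 0"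
    and j: "j < n"
  shows "(\<integral>\<^sup>+\<omega>. ennreal (exp ((d j / v (Suc j) * (reflected_walk r (\<lambda>i. \<zeta> i \<omega>) (Suc j))\<^sup>2
            - (\<Sum>k<j. (d (Suc k) - d k) / v (Suc k) * (reflected_walk r (\<lambda>i. \<zeta> i \<omega>) (Suc k))\<^sup>2)) / 2)) \<partial>M)
       = ennreal (sqrt (v (Suc j) / v 0))"
  using j
proof (induction j)
  case 0
  have 1: "1 - \<sigma>\<^sup>2 * (r 0)\<^sup>2 * (d 0 / v (Suc 0)) = v 0 / v (Suc 0)"
    using \<sigma> r[of 0] v[of "Suc 0"] 0 by (simp add: d_def field_simps)
  have 2: "v 0 / v (Suc 0) > 0" using v 0 by auto
  have "(\<integral>\<^sup>+\<omega>. 1 * ennreal (exp (d 0 / v (Suc 0) * (0 - r 0 * \<zeta> 0 \<omega>)\<^sup>2 / 2)) \<partial>M)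
    = (\<integral>\<^sup>+\<omega>. 1 * ennreal (exp (d 0 / v (Suc 0) / (1 - \<sigma>\<^sup>2 * (r 0)\<^sup>2 * (d 0 / v (Suc 0))) * 0\<^sup>2 / 2)
            / sqrt (1 - \<sigma>\<^sup>2 * (r 0)\<^sup>2 * (d 0 / v (Suc 0)))) \<partial>M)"
    using nn_integral_step[OF ind _ dist \<sigma>, of 0 "\<lambda>_. 1" "\<lambda>_. 0" "r 0" "d 0 / v (Suc 0)"] 0 1 2 by simp
  also have "\<dots> = ennreal (1 / sqrt (v 0 / v (Suc 0)))"
    unfolding 1 by (simp add: emeasure_space_1)
  also have "1 / sqrt (v 0 / v (Suc 0)) = sqrt (v (Suc 0) / v 0)"
    by (simp add: real_sqrt_divide)
  finally show ?case by simp
next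
  case (Suc j)
  define Z where "Z = (\<lambda>k \<omega>. reflected_walk r (\<lambda>i. \<zeta> i \<omega>) k)"
  define m where "m = Suc j"
  define p where "p = (\<lambda>\<omega>. \<lambda>i\<in>{..<m}. \<zeta> i \<omega>)"
  define c where "c = d m / v (Suc m)"
  have m: "m < n" using Suc by (simp add: m_def)
  have pos: "v m > 0" "v (Suc m) > 0" "r m > 0" using m v[of m] v[of "Suc m"] r[of m] by auto
  \<comment> \<open>With c a difference quotient of v over v, the Riccati denominator is a quotient
    of neighbouring values, and the square roots produced by the successive integrations
    telescope.\<close>
  have 1: "1 - \<sigma>\<^sup>2 * (r m)\<^sup>2 * c = v m / v (Suc m)"
    using \<sigma> pos by (simp add: d_def c_def field_simps)
  have 2: "v m / v (Suc m) > 0" using pos by auto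
  have Zp: "reflected_walk r (p \<omega>) k = Z k \<omega>" if "k \<le> m" for k \<omega>
    unfolding Z_def p_def using that by (intro reflected_walk_cong) auto
  define F where "F = (\<lambda>x. ennreal (exp (- (\<Sum>k<m. (d (Suc k) - d k) / v (Suc k) * (reflected_walk r x (Suc k))\<^sup>2) / 2)))"
  have [measurable]: "F \<in> borel_measurable (PiM {..<m} (\<lambda>_. borel))"
    unfolding F_def using measurable_reflected_walk_PiM[of _ m r]
    by (intro measurable_compose[OF _ measurable_ennreal] borel_measurable_exp borel_measurable_divide
        borel_measurable_uminus borel_measurable_sum borel_measurable_times borel_measurable_power) (auto simp del: reflected_walk.simps)
  have "(\<integral>\<^sup>+\<omega>. ennreal (exp ((d (Suc j) / v (Suc (Suc j)) * (Z (Suc (Suc j)) \<omega>)\<^sup>2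
            - (\<Sum>k<Suc j. (d (Suc k) - d k) / v (Suc k) * (Z (Suc k) \<omega>)\<^sup>2)) / 2)) \<partial>M)
     = (\<integral>\<^sup>+\<omega>. F (p \<omega>) * ennreal (exp (c * (reflected_walk r (p \<omega>) m - r m * \<zeta> m \<omega>)\<^sup>2 / 2)) \<partial>M)"
    by (intro nn_integral_cong)
       (simp add: F_def Zp m_def[symmetric] c_def ennreal_mult[symmetric] exp_add[symmetric] mult_exp_exp Z_def diff_divide_distrib
          del: sum.lessThan_Suc reflected_walk.simps(2), simp add: m_def)
  also have "\<dots> = (\<integral>\<^sup>+\<omega>. F (p \<omega>) * ennreal (exp (c / (1 - \<sigma>\<^sup>2 * (r m)\<^sup>2 * c) * (reflected_walk r (p \<omega>) m)\<^sup>2 / 2)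
            / sqrt (1 - \<sigma>\<^sup>2 * (r m)\<^sup>2 * c)) \<partial>M)"
    unfolding p_def
    by (rule nn_integral_step[OF ind m dist[OF m] \<sigma>]) (use 1 2 measurable_reflected_walk_PiM[of m m r] in auto)
  also have "\<dots> = (\<integral>\<^sup>+\<omega>. ennreal (sqrt (v (Suc m) / v m)) * ennreal (exp ((d j / v (Suc j) * (Z (Suc j) \<omega>)\<^sup>2
            - (\<Sum>k<j. (d (Suc k) - d k) / v (Suc k) * (Z (Suc k) \<omega>)\<^sup>2)) / 2)) \<partial>M)"
  proof (intro nn_integral_cong)
    fix \<omega>
    have e: "c / (v m / v (Suc m)) = d m / v m" using pos by (simp add: c_def)
    \<comment> \<open>Integrating out a step leaves the coefficient d m / v m. The potential at m
      takes away (d m - d j) / v m, and what remains is the terminal coefficient of the induction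
      hypothesis.\<close>
    have "- (\<Sum>k<m. (d (Suc k) - d k) / v (Suc k) * (Z (Suc k) \<omega>)\<^sup>2) / 2 + d m / v m * (Z m \<omega>)\<^sup>2 / 2
      = (d j / v (Suc j) * (Z (Suc j) \<omega>)\<^sup>2 - (\<Sum>k<j. (d (Suc k) - d k) / v (Suc k) * (Z (Suc k) \<omega>)\<^sup>2)) / 2"
      by (simp add: m_def diff_divide_distrib algebra_simps)
    then show "F (p \<omega>) * ennreal (exp (c / (1 - \<sigma>\<^sup>2 * (r m)\<^sup>2 * c) * (reflected_walk r (p \<omega>) m)\<^sup>2 / 2)
            / sqrt (1 - \<sigma>\<^sup>2 * (r m)\<^sup>2 * c)) = ennreal (sqrt (v (Suc m) / v m)) * ennreal (exp ((d j / v (Suc j) * (Z (Suc j) \<omega>)\<^sup>2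
            - (\<Sum>k<j. (d (Suc k) - d k) / v (Suc k) * (Z (Suc k) \<omega>)\<^sup>2)) / 2))"
      unfolding 1 e using pos
      by (simp add: F_def Zp ennreal_mult[symmetric] mult_exp_exp real_sqrt_divide Suc_le_eq del: sum.lessThan_Suc reflected_walk.simps(2))
  qed
  also have "\<dots> = ennreal (sqrt (v (Suc m) / v m)) * (\<integral>\<^sup>+\<omega>. ennreal (exp ((d j / v (Suc j) * (Z (Suc j) \<omega>)\<^sup>2
            - (\<Sum>k<j. (d (Suc k) - d k) / v (Suc k) * (Z (Suc k) \<omega>)\<^sup>2)) / 2)) \<partial>M)"
  proof (rule nn_integral_cmult)
    have "\<zeta> i \<in> borel_measurable M" if "i < n" for i
      using ind that by (auto simp: indep_vars_def)
    then have Z': "Z k \<in> borel_measurable M" if "k \<le> n" for k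
      unfolding Z_def using that by (intro measurable_reflected_walk) auto
    show "(\<lambda>\<omega>. ennreal (exp ((d j / v (Suc j) * (Z (Suc j) \<omega>)\<^sup>2
            - (\<Sum>k<j. (d (Suc k) - d k) / v (Suc k) * (Z (Suc k) \<omega>)\<^sup>2)) / 2))) \<in> borel_measurable M"
      using Suc.prems by (intro measurable_compose[OF _ measurable_ennreal] measurable_compose[OF _ borel_measurable_exp] borel_measurable_divide
        borel_measurable_diff borel_measurable_sum borel_measurable_times borel_measurable_power Z' borel_measurable_const) auto
  qed
  also have "\<dots> = ennreal (sqrt (v (Suc m) / v m)) * ennreal (sqrt (v (Suc j) / v 0))"
    using Suc.IH Suc.prems by (simp add: Z_def del: sum.lessThan_Suc reflected_walk.simps)
  also have "\<dots> = ennreal (sqrt (v (Suc m) / v 0))"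
    using pos by (simp add: ennreal_mult'[symmetric] real_sqrt_mult[symmetric] m_def[symmetric])
  finally show ?case by (simp add: Z_def m_def del: sum.lessThan_Suc reflected_walk.simps)
qed

text \<open>The recursion is run backwards from the flat end values 1, 1: with a nonnegative
  potential the sequence can only grow towards index 0, so it stays positive. Equal end values make
  the terminal term of the Laplace identity vanish.\<close>

lemma discrete_sturm_liouville:
  fixes c :: "nat \<Rightarrow> real"
  assumes "\<And>k. c k \<ge> 0"
  obtains v :: "nat \<Rightarrow> real" where "\<And>k. k \<le> Suc j \<Longrightarrow> v k > 0" "v (Suc j) = 1" "v j = 1"
    "\<And>k. k < j \<Longrightarrow> v (Suc (Suc k)) - 2 * v (Suc k) + v k = c (Suc k) * v (Suc k)"
proof -
  \<comment> \<open>For m <= j, \<open>w m\<close> is the pair (v (Suc j - m), v (j - m)).\<close>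
  define w where "w = rec_nat (1::real, 1::real) (\<lambda>m p. (snd p, (2 + c (j - m)) * snd p - fst p))"
  have w0: "w 0 = (1, 1)" and wS: "w (Suc m) = (snd (w m), (2 + c (j - m)) * snd (w m) - fst (w m))" for m
    by (simp_all add: w_def)
  have pos: "1 \<le> fst (w m) \<and> fst (w m) \<le> snd (w m)" for m
  proof (induction m)
    case (Suc m)
    then have "0 \<le> c (j - m) * snd (w m)" using assms by (intro mult_nonneg_nonneg) auto
    with Suc show ?case by (auto simp: wS algebra_simps)
  qed (simp add: w0)
  define v where "v = (\<lambda>k. fst (w (Suc j - k)))"
  show ?thesis
  proof (rule that[of v])
    show "v k > 0" for k using pos[of "Suc j - k"] by (simp add: v_def)
    show "v (Suc j) = 1" "v j = 1" by (simp_all add: v_def w0 wS Suc_diff_le)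
    fix k assume k: "k < j"
    define m where "m = j - Suc k"
    have "Suc j - k = Suc (Suc m)" "Suc j - Suc k = Suc m" "Suc j - Suc (Suc k) = m" "j - m = Suc k"
      using k by (auto simp: m_def)
    then show "v (Suc (Suc k)) - 2 * v (Suc k) + v k = c (Suc k) * v (Suc k)"
      by (simp add: v_def wS algebra_simps)
  qed
qed

text \<open>With step variances proportional to \<open>a\<^sub>k a\<^sub>k\<^sub>+\<^sub>1\<close> the cross terms of \<open>a v\<close> and \<open>v\<close> agree, so the substitution is exact.\<close>

lemma (in prob_space) discrete_liouville_girsanov:
  fixes \<zeta> :: "nat \<Rightarrow> 'a \<Rightarrow> real" and a :: "nat \<Rightarrow> real" and \<sigma> s :: real and j :: nat
  defines "b \<equiv> \<lambda>k. 1 / a k"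
  defines "Z \<equiv> \<lambda>k \<omega>. reflected_walk (\<lambda>_. 1) (\<lambda>i. \<zeta> i \<omega>) k"
  defines "Y \<equiv> \<lambda>k \<omega>. reflected_walk (\<lambda>k. sqrt (a k * a (Suc k))) (\<lambda>i. \<zeta> i \<omega>) k"
  assumes ind: "indep_vars (\<lambda>_. borel) \<zeta> {..<Suc j}"
    and dist: "\<And>k. k < Suc j \<Longrightarrow> distributed M lborel (\<zeta> k) (normal_density 0 \<sigma>)" and \<sigma>: "\<sigma> > 0"
    and a: "\<And>k. k \<le> Suc j \<Longrightarrow> a k > 0" and s: "s \<ge> 0"
  shows "(\<integral>\<^sup>+\<omega>. ennreal (exp (((\<Sum>k<j. b (Suc k) * (b (Suc (Suc k)) - 2 * b (Suc k) + b k) / \<sigma>\<^sup>2 * (Y (Suc k) \<omega>)\<^sup>2)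
              - b (Suc j) * (b (Suc j) - b j) / \<sigma>\<^sup>2 * (Y (Suc j) \<omega>)\<^sup>2) / 2
              - s * (\<sigma>\<^sup>2 * (\<Sum>k<j. (a (Suc k))\<^sup>2 * (Y (Suc k) \<omega>)\<^sup>2)))) \<partial>M)
       = ennreal (sqrt (a (Suc j) / a 0)) *
         (\<integral>\<^sup>+\<omega>. ennreal (exp (- s * (\<sigma>\<^sup>2 * (\<Sum>k<j. (a (Suc k)) ^ 4 * (Z (Suc k) \<omega>)\<^sup>2)))) \<partial>M)"
proof -
  \<comment> \<open>One \<sigma>^2 is lost to the step variance and the 2 to the halving in the
    exponent, which leaves s \<sigma>^2 a^4 as the weight.\<close>
  define c where "c = (\<lambda>k. 2 * s * \<sigma>^4 * (a k)^4)"
  have "c k \<ge> 0" for k using s by (simp add: c_def)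
  then obtain v where v: "\<And>k. k \<le> Suc j \<Longrightarrow> v k > 0" and v1: "v (Suc j) = 1" "v j = 1"
    and vr: "\<And>k. k < j \<Longrightarrow> v (Suc (Suc k)) - 2 * v (Suc k) + v k = c (Suc k) * v (Suc k)"
    by (rule discrete_sturm_liouville[of c j]) auto
  have Zint: "(\<integral>\<^sup>+\<omega>. ennreal (exp (- s * (\<sigma>\<^sup>2 * (\<Sum>k<j. (a (Suc k)) ^ 4 * (Z (Suc k) \<omega>)\<^sup>2)))) \<partial>M)
      = ennreal (sqrt (v (Suc j) / v 0))"
  proof -
    have e: "((v (Suc (Suc k)) - v (Suc k)) / (\<sigma>\<^sup>2 * 1\<^sup>2) - (v (Suc k) - v k) / (\<sigma>\<^sup>2 * 1\<^sup>2)) / v (Suc k)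
       = 2 * s * \<sigma>\<^sup>2 * (a (Suc k))^4" if "k < j" for k
    proof -
      have "(v (Suc (Suc k)) - v (Suc k)) / (\<sigma>\<^sup>2 * 1\<^sup>2) - (v (Suc k) - v k) / (\<sigma>\<^sup>2 * 1\<^sup>2)
          = c (Suc k) * v (Suc k) / \<sigma>\<^sup>2"
        unfolding vr[OF that, symmetric] using \<sigma> by (simp add: field_simps)
      also have "\<dots> / v (Suc k) = 2 * s * \<sigma>\<^sup>2 * (a (Suc k))^4"
        using \<sigma> v[of "Suc k"] that by (simp add: c_def field_simps power4_eq_xxxx power2_eq_square)
      finally show ?thesis .
    qed
    have "(\<integral>\<^sup>+\<omega>. ennreal (exp (- s * (\<sigma>\<^sup>2 * (\<Sum>k<j. (a (Suc k)) ^ 4 * (Z (Suc k) \<omega>)\<^sup>2)))) \<partial>M)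
      = (\<integral>\<^sup>+\<omega>. ennreal (exp (((v (Suc j) - v j) / (\<sigma>\<^sup>2 * 1\<^sup>2) / v (Suc j) * (Z (Suc j) \<omega>)\<^sup>2
            - (\<Sum>k<j. ((v (Suc (Suc k)) - v (Suc k)) / (\<sigma>\<^sup>2 * 1\<^sup>2) - (v (Suc k) - v k) / (\<sigma>\<^sup>2 * 1\<^sup>2)) / v (Suc k) * (Z (Suc k) \<omega>)\<^sup>2)) / 2)) \<partial>M)"
    proof (intro nn_integral_cong)
      fix \<omega>
      have "(\<Sum>k<j. ((v (Suc (Suc k)) - v (Suc k)) / (\<sigma>\<^sup>2 * 1\<^sup>2) - (v (Suc k) - v k) / (\<sigma>\<^sup>2 * 1\<^sup>2)) / v (Suc k) * (Z (Suc k) \<omega>)\<^sup>2)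
        = (\<Sum>k<j. 2 * s * \<sigma>\<^sup>2 * (a (Suc k))^4 * (Z (Suc k) \<omega>)\<^sup>2)"
        by (intro sum.cong refl, subst e) auto
      also have "\<dots> = 2 * (s * (\<sigma>\<^sup>2 * (\<Sum>k<j. (a (Suc k))^4 * (Z (Suc k) \<omega>)\<^sup>2)))"
        by (simp add: sum_distrib_left mult_ac)
      finally show "ennreal (exp (- s * (\<sigma>\<^sup>2 * (\<Sum>k<j. (a (Suc k)) ^ 4 * (Z (Suc k) \<omega>)\<^sup>2))))
        = ennreal (exp (((v (Suc j) - v j) / (\<sigma>\<^sup>2 * 1\<^sup>2) / v (Suc j) * (Z (Suc j) \<omega>)\<^sup>2
            - (\<Sum>k<j. ((v (Suc (Suc k)) - v (Suc k)) / (\<sigma>\<^sup>2 * 1\<^sup>2) - (v (Suc k) - v k) / (\<sigma>\<^sup>2 * 1\<^sup>2)) / v (Suc k) * (Z (Suc k) \<omega>)\<^sup>2)) / 2))"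
        by (simp add: v1)
    qed
    also have "\<dots> = ennreal (sqrt (v (Suc j) / v 0))"
      unfolding Z_def by (rule laplace_reflected_walk[OF ind dist \<sigma>]) (use v in auto)
    finally show ?thesis .
  qed
  define r where "r = (\<lambda>k. sqrt (a k * a (Suc k)))"
  \<comment> \<open>The transformed test sequence: \<open>u\<close> does for the walk with step
    variances \<sigma>^2 a_k a_(k+1) what \<open>v\<close> does for the plain walk.\<close>
  define u where "u = (\<lambda>k. a k * v k)"
  define d where "d = (\<lambda>k. (u (Suc k) - u k) / (\<sigma>\<^sup>2 * (r k)\<^sup>2))"
  have r2: "(r k)\<^sup>2 = a k * a (Suc k)" if "k \<le> j" for k
    using a[of k] a[of "Suc k"] that by (auto simp: r_def)
  \<comment> \<open>A discrete Wronskian of v and b. Its increment is b v'' - v b'' in second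
    differences, and these two parts become the weight and the log density.\<close>
  have d: "d k = (v (Suc k) * b k - v k * b (Suc k)) / \<sigma>\<^sup>2" if "k \<le> j" for k
    using a[of k] a[of "Suc k"] that \<sigma> by (simp add: d_def u_def r2 b_def field_simps)
  have b: "b k > 0" if "k \<le> Suc j" for k using a that by (simp add: b_def)
  have ub: "u k = v k / b k" for k by (simp add: u_def b_def)
  \<comment> \<open>Since v ends flat, only the variation of b is left at the terminal time.\<close>
  have last: "d j / u (Suc j) = - (b (Suc j) * (b (Suc j) - b j) / \<sigma>\<^sup>2)"
    using \<sigma> b[of "Suc j"] by (simp add: d v1 ub field_simps)
  have e: "(d (Suc k) - d k) / u (Suc k) = 2 * s * \<sigma>\<^sup>2 * (a (Suc k))\<^sup>2
      - b (Suc k) * (b (Suc (Suc k)) - 2 * b (Suc k) + b k) / \<sigma>\<^sup>2" if k: "k < j" for k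
  proof -
    have pos: "v (Suc k) > 0" "a (Suc k) > 0" "b (Suc k) > 0" using v a b k by auto
    have "d (Suc k) - d k = (b (Suc k) * (v (Suc (Suc k)) - 2 * v (Suc k) + v k)
        - v (Suc k) * (b (Suc (Suc k)) - 2 * b (Suc k) + b k)) / \<sigma>\<^sup>2"
      using k by (simp add: d diff_divide_distrib[symmetric]) (simp add: algebra_simps)
    also have "\<dots> / u (Suc k) = (b (Suc k))\<^sup>2 * c (Suc k) / \<sigma>\<^sup>2 - b (Suc k) * (b (Suc (Suc k)) - 2 * b (Suc k) + b k) / \<sigma>\<^sup>2"
      unfolding vr[OF k] ub using pos \<sigma> by (simp add: field_simps power2_eq_square)
    also have "(b (Suc k))\<^sup>2 * c (Suc k) / \<sigma>\<^sup>2 = 2 * s * \<sigma>\<^sup>2 * (a (Suc k))\<^sup>2"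
      using pos \<sigma> by (simp add: c_def b_def field_simps power4_eq_xxxx power2_eq_square)
    finally show ?thesis .
  qed
  have "(\<integral>\<^sup>+\<omega>. ennreal (exp (((\<Sum>k<j. b (Suc k) * (b (Suc (Suc k)) - 2 * b (Suc k) + b k) / \<sigma>\<^sup>2 * (Y (Suc k) \<omega>)\<^sup>2)
              - b (Suc j) * (b (Suc j) - b j) / \<sigma>\<^sup>2 * (Y (Suc j) \<omega>)\<^sup>2) / 2
              - s * (\<sigma>\<^sup>2 * (\<Sum>k<j. (a (Suc k))\<^sup>2 * (Y (Suc k) \<omega>)\<^sup>2)))) \<partial>M)
     = (\<integral>\<^sup>+\<omega>. ennreal (exp ((d j / u (Suc j) * (Y (Suc j) \<omega>)\<^sup>2
            - (\<Sum>k<j. (d (Suc k) - d k) / u (Suc k) * (Y (Suc k) \<omega>)\<^sup>2)) / 2)) \<partial>M)"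
  proof (intro nn_integral_cong)
    fix \<omega>
    have "(\<Sum>k<j. (d (Suc k) - d k) / u (Suc k) * (Y (Suc k) \<omega>)\<^sup>2)
      = 2 * s * (\<sigma>\<^sup>2 * (\<Sum>k<j. (a (Suc k))\<^sup>2 * (Y (Suc k) \<omega>)\<^sup>2))
        - (\<Sum>k<j. b (Suc k) * (b (Suc (Suc k)) - 2 * b (Suc k) + b k) / \<sigma>\<^sup>2 * (Y (Suc k) \<omega>)\<^sup>2)"
      by (simp add: e sum_distrib_left sum_subtractf[symmetric] left_diff_distrib mult.assoc)
    then show "ennreal (exp (((\<Sum>k<j. b (Suc k) * (b (Suc (Suc k)) - 2 * b (Suc k) + b k) / \<sigma>\<^sup>2 * (Y (Suc k) \<omega>)\<^sup>2)
              - b (Suc j) * (b (Suc j) - b j) / \<sigma>\<^sup>2 * (Y (Suc j) \<omega>)\<^sup>2) / 2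
              - s * (\<sigma>\<^sup>2 * (\<Sum>k<j. (a (Suc k))\<^sup>2 * (Y (Suc k) \<omega>)\<^sup>2))))
      = ennreal (exp ((d j / u (Suc j) * (Y (Suc j) \<omega>)\<^sup>2
            - (\<Sum>k<j. (d (Suc k) - d k) / u (Suc k) * (Y (Suc k) \<omega>)\<^sup>2)) / 2))"
      unfolding last by (simp add: field_simps)
  qed
  also have "\<dots> = ennreal (sqrt (u (Suc j) / u 0))"
    unfolding Y_def d_def r_def
    by (rule laplace_reflected_walk[OF ind dist \<sigma>]) (use v a in \<open>auto simp: u_def\<close>)
  also have "\<dots> = ennreal (sqrt (a (Suc j) / a 0)) * ennreal (sqrt (v (Suc j) / v 0))"
    using a[of 0] a[of "Suc j"] v[of 0] by (simp add: u_def v1 ennreal_mult'[symmetric] real_sqrt_mult[symmetric])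
  finally show ?thesis unfolding Zint .
qed

section \<open>Laws determined by integer Laplace transforms\<close>

text \<open>Uniform polynomial approximation on [0,1] passes from moments to continuous functions as
  soon as the weights are bounded in L1. Weights may change sign, because the limit density used
  later is an alternating series.\<close>

lemma tendsto_integral_of_moments:
  fixes M :: "nat \<Rightarrow> 'a measure" and N :: "'b measure" and U H :: "nat \<Rightarrow> 'a \<Rightarrow> real" and V G :: "'b \<Rightarrow> real"
    and g :: "real \<Rightarrow> real"
  assumes H: "\<And>n. integrable (M n) (H n)" "\<And>n. (\<integral>\<omega>. \<bar>H n \<omega>\<bar> \<partial>M n) \<le> C"
    and U: "\<And>n. U n \<in> borel_measurable (M n)" "\<And>n \<omega>. U n \<omega> \<in> {0..1}"
    and G: "integrable N G" and V: "V \<in> borel_measurable N" "\<And>\<omega>. V \<omega> \<in> {0..1}"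
    and lim: "\<And>m. (\<lambda>n. \<integral>\<omega>. U n \<omega> ^ m * H n \<omega> \<partial>M n) \<longlonglongrightarrow> (\<integral>\<omega>. V \<omega> ^ m * G \<omega> \<partial>N)"
    and g: "continuous_on UNIV g"
  shows "(\<lambda>n. \<integral>\<omega>. g (U n \<omega>) * H n \<omega> \<partial>M n) \<longlonglongrightarrow> (\<integral>\<omega>. g (V \<omega>) * G \<omega> \<partial>N)"
proof (rule metric_LIMSEQ_I)
  fix e :: real assume e: "e > 0"
  define C' where "C' = max C (\<integral>\<omega>. \<bar>G \<omega>\<bar> \<partial>N) + 1"
  have "0 \<le> (\<integral>\<omega>. \<bar>G \<omega>\<bar> \<partial>N)" by simp
  then have C': "C' > 0" unfolding C'_def by linarith
  define \<delta> where "\<delta> = e / (3 * C')"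
  have \<delta>: "\<delta> > 0" using e C' by (simp add: \<delta>_def)
  obtain q where q: "real_polynomial_function q" "\<And>x. x \<in> {0..1} \<Longrightarrow> \<bar>g x - q x\<bar> < \<delta>"
    by (rule Stone_Weierstrass_real_polynomial_function[OF compact_Icc continuous_on_subset[OF g] \<delta>]) auto
  then obtain c d where qs: "q = (\<lambda>x. \<Sum>i\<le>d. c i * x ^ i)"
    unfolding real_polynomial_function_iff_sum by blast
  have q_cont: "continuous_on UNIV q" unfolding qs by (intro continuous_intros)
  \<comment> \<open>Stated over a fresh measure type, since it is applied both to each
    \<open>M n\<close> and to \<open>N\<close>.\<close>
  have approx: "\<bar>(\<integral>\<omega>. g (X \<omega>) * K \<omega> \<partial>P) - (\<Sum>i\<le>d. c i * (\<integral>\<omega>. X \<omega> ^ i * K \<omega> \<partial>P))\<bar> \<le> e / 3"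
    if K: "integrable P K" and Kc: "(\<integral>\<omega>. \<bar>K \<omega>\<bar> \<partial>P) \<le> C'"
      and X: "X \<in> borel_measurable P" "\<And>\<omega>. X \<omega> \<in> {0..1}" for P :: "'c measure" and X K
  proof -
    have int: "integrable P (\<lambda>\<omega>. f (X \<omega>) * K \<omega>)" if f: "continuous_on UNIV f" for f :: "real \<Rightarrow> real"
    proof -
      obtain B where B: "\<And>x. x \<in> {0..1} \<Longrightarrow> \<bar>f x\<bar> \<le> B"
        using compact_imp_bounded[OF compact_continuous_image[OF continuous_on_subset[OF f subset_UNIV] compact_Icc[of 0 1]]]
        unfolding bounded_iff real_norm_def by blast
      have [measurable]: "f \<in> borel_measurable borel" using f by (rule borel_measurable_continuous_onI)
      have [measurable]: "X \<in> borel_measurable P" "K \<in> borel_measurable P" using X K by auto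
      have "\<bar>f (X \<omega>)\<bar> * \<bar>K \<omega>\<bar> \<le> B * \<bar>K \<omega>\<bar>" for \<omega>
        by (intro mult_right_mono B X) auto
      then have "norm (f (X \<omega>) * K \<omega>) \<le> norm (B * \<bar>K \<omega>\<bar>)" for \<omega>
        unfolding real_norm_def abs_mult by (rule order_trans) (simp add: mult_right_mono)
      then show ?thesis
        by (intro Bochner_Integration.integrable_bound[OF integrable_mult_right[OF integrable_abs[OF K], of B]] AE_I2) auto
    qed
    have "(\<Sum>i\<le>d. c i * (\<integral>\<omega>. X \<omega> ^ i * K \<omega> \<partial>P)) = (\<integral>\<omega>. q (X \<omega>) * K \<omega> \<partial>P)"
      using int[of "\<lambda>x. x ^ i" for i] unfolding qs
      by (simp add: sum_distrib_right mult.assoc continuous_intros)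
    then have "\<bar>(\<integral>\<omega>. g (X \<omega>) * K \<omega> \<partial>P) - (\<Sum>i\<le>d. c i * (\<integral>\<omega>. X \<omega> ^ i * K \<omega> \<partial>P))\<bar>
       = \<bar>\<integral>\<omega>. (g (X \<omega>) - q (X \<omega>)) * K \<omega> \<partial>P\<bar>"
      using int[OF g] int[OF q_cont] by (simp add: left_diff_distrib)
    also have "\<dots> \<le> (\<integral>\<omega>. \<bar>(g (X \<omega>) - q (X \<omega>)) * K \<omega>\<bar> \<partial>P)"
      by (rule integral_abs_bound)
    also have "\<dots> \<le> (\<integral>\<omega>. \<delta> * \<bar>K \<omega>\<bar> \<partial>P)"
    proof (rule integral_mono)
      have "integrable P (\<lambda>\<omega>. (g (X \<omega>) - q (X \<omega>)) * K \<omega>)"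
        by (rule int[of "\<lambda>x. g x - q x"]) (intro continuous_on_diff g q_cont)
      then show "integrable P (\<lambda>\<omega>. \<bar>(g (X \<omega>) - q (X \<omega>)) * K \<omega>\<bar>)" by (rule integrable_abs)
      show "integrable P (\<lambda>\<omega>. \<delta> * \<bar>K \<omega>\<bar>)" using K by simp
      show "\<bar>(g (X \<omega>) - q (X \<omega>)) * K \<omega>\<bar> \<le> \<delta> * \<bar>K \<omega>\<bar>" for \<omega>
        unfolding abs_mult by (rule mult_right_mono[OF less_imp_le[OF q(2)[OF X(2)]]]) simp
    qed
    also have "\<dots> \<le> \<delta> * C'" using Kc \<delta> by (simp add: mult_left_mono)
    also have "\<dots> = e / 3" using C' by (simp add: \<delta>_def)
    finally show ?thesis .
  qed
  have "(\<lambda>n. \<Sum>i\<le>d. c i * (\<integral>\<omega>. U n \<omega> ^ i * H n \<omega> \<partial>M n)) \<longlonglongrightarrow> (\<Sum>i\<le>d. c i * (\<integral>\<omega>. V \<omega> ^ i * G \<omega> \<partial>N))"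
    by (intro tendsto_intros lim)
  then obtain n0 where n0: "\<And>n. n \<ge> n0 \<Longrightarrow>
     dist (\<Sum>i\<le>d. c i * (\<integral>\<omega>. U n \<omega> ^ i * H n \<omega> \<partial>M n)) (\<Sum>i\<le>d. c i * (\<integral>\<omega>. V \<omega> ^ i * G \<omega> \<partial>N)) < e / 3"
    using metric_LIMSEQ_D[of _ _ "e / 3"] e by fastforce
  show "\<exists>no. \<forall>n\<ge>no. dist (\<integral>\<omega>. g (U n \<omega>) * H n \<omega> \<partial>M n) (\<integral>\<omega>. g (V \<omega>) * G \<omega> \<partial>N) < e"
  proof (intro exI[of _ n0] allI impI)
    fix n assume n: "n \<ge> n0"
    have "(\<integral>\<omega>. \<bar>H n \<omega>\<bar> \<partial>M n) \<le> C'"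
      using H(2)[of n] unfolding C'_def by linarith
    then have 1: "\<bar>(\<integral>\<omega>. g (U n \<omega>) * H n \<omega> \<partial>M n) - (\<Sum>i\<le>d. c i * (\<integral>\<omega>. U n \<omega> ^ i * H n \<omega> \<partial>M n))\<bar> \<le> e / 3"
      by (rule approx[OF H(1) _ U])
    have "(\<integral>\<omega>. \<bar>G \<omega>\<bar> \<partial>N) \<le> C'"
      unfolding C'_def by linarith
    then have 2: "\<bar>(\<integral>\<omega>. g (V \<omega>) * G \<omega> \<partial>N) - (\<Sum>i\<le>d. c i * (\<integral>\<omega>. V \<omega> ^ i * G \<omega> \<partial>N))\<bar> \<le> e / 3"
      by (rule approx[OF G _ V])
    show "dist (\<integral>\<omega>. g (U n \<omega>) * H n \<omega> \<partial>M n) (\<integral>\<omega>. g (V \<omega>) * G \<omega> \<partial>N) < e"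
      using 1 2 n0[OF n] unfolding dist_real_def by linarith
  qed
qed

text \<open>The variable exp(-A) under the density exp D and the variable exp(-X) under the constant
  weight K have the same moments. Thus the tilted law of A is K times the law of X, even if exp D is
  unbounded.\<close>

lemma (in prob_space) transfer_exp_functional:
  fixes A X D :: "'a \<Rightarrow> real" and g :: "real \<Rightarrow> real"
  assumes [measurable]: "A \<in> borel_measurable M" "X \<in> borel_measurable M" "D \<in> borel_measurable M"
    and A: "\<And>\<omega>. A \<omega> \<ge> 0" and X: "\<And>\<omega>. X \<omega> \<ge> 0" and K: "K \<ge> 0"
    and eq: "\<And>m::nat. (\<integral>\<^sup>+\<omega>. ennreal (exp (D \<omega> - real m * A \<omega>)) \<partial>M)
      = ennreal K * (\<integral>\<^sup>+\<omega>. ennreal (exp (- real m * X \<omega>)) \<partial>M)"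
    and g: "continuous_on UNIV g"
  shows "integrable M (\<lambda>\<omega>. exp (D \<omega>))"
    and "(\<integral>\<omega>. g (exp (- A \<omega>)) * exp (D \<omega>) \<partial>M) = K * (\<integral>\<omega>. g (exp (- X \<omega>)) \<partial>M)"
proof -
  have "(\<integral>\<^sup>+\<omega>. ennreal (exp (D \<omega>)) \<partial>M) = ennreal K"
    using eq[of 0] by (simp add: emeasure_space_1)
  then show int: "integrable M (\<lambda>\<omega>. exp (D \<omega>))"
    by (intro integrableI_nonneg) auto
  have mom: "(\<integral>\<omega>. exp (- A \<omega>) ^ m * exp (D \<omega>) \<partial>M) = (\<integral>\<omega>. exp (- X \<omega>) ^ m * K \<partial>M)" for m :: nat
  proof -
    have "(\<integral>\<omega>. exp (- A \<omega>) ^ m * exp (D \<omega>) \<partial>M) = enn2real (\<integral>\<^sup>+\<omega>. ennreal (exp (D \<omega> - real m * A \<omega>)) \<partial>M)"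
      by (subst integral_eq_nn_integral) (auto simp: exp_of_nat_mult[symmetric] mult_exp_exp)
    also have "\<dots> = K * enn2real (\<integral>\<^sup>+\<omega>. ennreal (exp (- real m * X \<omega>)) \<partial>M)"
      unfolding eq using K by (simp add: enn2real_mult)
    also have "enn2real (\<integral>\<^sup>+\<omega>. ennreal (exp (- real m * X \<omega>)) \<partial>M) = (\<integral>\<omega>. exp (- X \<omega>) ^ m \<partial>M)"
      by (subst integral_eq_nn_integral) (auto simp: exp_of_nat_mult[symmetric])
    finally show ?thesis by simp
  qed
  \<comment> \<open>Constant sequences turn the convergence statement into an equality.\<close>
  have "(\<lambda>n::nat. \<integral>\<omega>. g (exp (- A \<omega>)) * exp (D \<omega>) \<partial>M) \<longlonglongrightarrow> (\<integral>\<omega>. g (exp (- X \<omega>)) * K \<partial>M)"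
    by (rule tendsto_integral_of_moments[where C = "\<integral>\<omega>. exp (D \<omega>) \<partial>M"])
       (use int A X g mom in auto)
  then have "(\<integral>\<omega>. g (exp (- A \<omega>)) * exp (D \<omega>) \<partial>M) = (\<integral>\<omega>. g (exp (- X \<omega>)) * K \<partial>M)"
    by (simp add: LIMSEQ_const_iff)
  then show "(\<integral>\<omega>. g (exp (- A \<omega>)) * exp (D \<omega>) \<partial>M) = K * (\<integral>\<omega>. g (exp (- X \<omega>)) \<partial>M)"
    by simp
qed

section \<open>The one-sided stable law of index one half\<close>

lemma DERIV_cdf_std_normal:
  "(cdf (density lborel std_normal_density) has_real_derivative std_normal_density x) (at x)"
proof -
  define N where "N = density lborel (\<lambda>x. ennreal (std_normal_density x))"
  interpret real_distribution N
    unfolding N_def by (rule real_dist_normal_dist)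
  have cont: "continuous_on S std_normal_density" for S
    unfolding std_normal_density_def by (intro continuous_intros) auto
  have diff: "cdf N y = cdf N u + integral {u..y} std_normal_density" if "u \<le> y" for u y
  proof -
    have int: "set_integrable lborel {u..y} std_normal_density"
      by (rule borel_integrable_atLeastAtMost') (rule cont)
    have "cdf N y - cdf N u = measure N {u<..y}"
      using that by (cases "u = y") (auto simp: cdf_diff_eq)
    also have "\<dots> = (\<integral>x. std_normal_density x * indicator {u<..y} x \<partial>lborel)"
      unfolding N_def measure_def
      by (subst emeasure_density) (auto simp: integral_eq_nn_integral intro!: arg_cong[where f=enn2real] nn_integral_cong split: split_indicator)
    also have "\<dots> = (LBINT x:{u..y}. std_normal_density x)"
      unfolding set_lebesgue_integral_def
      by (intro integral_cong_AE) (auto intro!: AE_I[where N="{u}"] split: split_indicator)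
    also have "\<dots> = integral {u..y} std_normal_density"
      by (rule set_borel_integral_eq_integral[OF int])
    finally show ?thesis by simp
  qed
  have "((\<lambda>y. integral {x - 1..y} std_normal_density) has_real_derivative std_normal_density x) (at x within {x-1..x+1})"
    by (rule integral_has_real_derivative[OF cont]) auto
  then have "((\<lambda>y. cdf N (x - 1) + integral {x - 1..y} std_normal_density) has_real_derivative std_normal_density x) (at x)"
    by (subst (asm) at_within_interior) (auto intro!: derivative_eq_intros)
  then have "(cdf N has_real_derivative std_normal_density x) (at x)"
    by (rule DERIV_cong_ev[THEN iffD1, rotated -1])
       (auto intro!: eventually_mono[OF eventually_gt_at_top] simp: diff[of "x - 1", symmetric] eventually_nhds intro!: exI[of _ "{x-1<..}"])
  then show ?thesis by (simp add: N_def)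
qed

text \<open>The Laplace transform of b^2/N^2 at 1/2. An antiderivative is explicit: the squares of z
  - b/z and z + b/z are z^2 + b^2/z^2 shifted by -2b and 2b, and the factors exp(-b) and exp b
  cancel the shifts; the chain-rule factors 1 + b/z^2 and 1 - b/z^2 add up to 2.\<close>

lemma nn_integral_levy_laplace:
  fixes b :: real
  assumes b: "b > 0"
  shows "(\<integral>\<^sup>+z. ennreal (2 * std_normal_density z * exp (- b\<^sup>2 / (2 * z\<^sup>2)) * indicator {0<..} z) \<partial>lborel) = ennreal (exp (- b))"
proof -
  define N where "N = density lborel (\<lambda>x. ennreal (std_normal_density x))"
  interpret real_distribution N
    unfolding N_def by (rule real_dist_normal_dist)
  define F where "F = (\<lambda>z. exp (- b) * cdf N (z - b / z) + exp b * (cdf N (z + b / z) - 1))"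
  define f where "f = (\<lambda>z. 2 * std_normal_density z * exp (- b\<^sup>2 / (2 * z\<^sup>2)))"
  have top: "(cdf N \<longlongrightarrow> 1) at_top" and bot: "(cdf N \<longlongrightarrow> 0) at_bot"
    by (rule cdf_lim_at_top_prob, rule cdf_lim_at_bot)
  have deriv: "(F has_real_derivative f z) (at z)" if z: "z > 0" for z
  proof -
    have D: "(cdf N has_real_derivative std_normal_density x) (at x)" for x
      using DERIV_cdf_std_normal by (simp add: N_def)
    have "(F has_real_derivative (exp (- b) * (std_normal_density (z - b / z) * (1 + b / z\<^sup>2))
        + exp b * (std_normal_density (z + b / z) * (1 - b / z\<^sup>2)))) (at z)"
      unfolding F_def
      by (rule derivative_eq_intros DERIV_chain2[OF D] refl | use z in \<open>simp add: power2_eq_square\<close>)+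
    moreover have "exp (- b) * std_normal_density (z - b / z) = std_normal_density z * exp (- b\<^sup>2 / (2 * z\<^sup>2))"
      using z by (simp add: std_normal_density_def mult_exp_exp) (simp add: field_simps power2_eq_square)
    moreover have "exp b * std_normal_density (z + b / z) = std_normal_density z * exp (- b\<^sup>2 / (2 * z\<^sup>2))"
      using z by (simp add: std_normal_density_def mult_exp_exp) (simp add: field_simps power2_eq_square)
    ultimately show ?thesis
      unfolding mult.assoc[symmetric] f_def by (simp add: algebra_simps)
  qed
  have 1: "filterlim (\<lambda>z. z - b / z) at_top at_top" "filterlim (\<lambda>z. z + b / z) at_top at_top"
    by real_asymp+
  have 2: "filterlim (\<lambda>z. z - b / z) at_bot (at_right 0)" "filterlim (\<lambda>z. z + b / z) at_top (at_right 0)"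
    using b by real_asymp+
  have lim_inf: "(F \<longlongrightarrow> exp (- b) * 1 + exp b * (1 - 1)) at_top"
    unfolding F_def by (intro tendsto_intros filterlim_compose[OF top 1(1)] filterlim_compose[OF top 1(2)])
  have lim_0: "(F \<longlongrightarrow> exp (- b) * 0 + exp b * (1 - 1)) (at_right 0)"
    unfolding F_def by (intro tendsto_intros filterlim_compose[OF bot 2(1)] filterlim_compose[OF top 2(2)])
  have cont: "isCont f z" if "z > 0" for z
    using that unfolding f_def std_normal_density_def by (intro continuous_intros) auto
  have f_nonneg: "f z \<ge> 0" for z by (simp add: f_def)
  have A: "((F \<circ> real_of_ereal) \<longlongrightarrow> 0) (at_right 0)"
    using lim_0 by (simp add: ereal_tendsto_simps zero_ereal_def)
  have B: "((F \<circ> real_of_ereal) \<longlongrightarrow> exp (- b)) (at_left \<infinity>)"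
    using lim_inf by (simp add: ereal_tendsto_simps)
  have FTC: "set_integrable lborel (einterval 0 \<infinity>) f" "(LBINT x=0..\<infinity>. f x) = exp (- b) - 0"
    by (rule interval_integral_FTC_nonneg[where F = F]; (rule A B)?; use deriv cont f_nonneg in simp)+
  then have "integrable lborel (\<lambda>z. indicator {0<..} z * f z)" "(\<integral>z. indicator {0<..} z * f z \<partial>lborel) = exp (- b)"
    by (simp_all add: set_integrable_def interval_lebesgue_integral_def set_lebesgue_integral_def zero_ereal_def)
  moreover have "AE z in lborel. 0 \<le> indicator {0<..} z * f z"
    by (auto simp: f_def)
  ultimately have "(\<integral>\<^sup>+z. ennreal (indicator {0<..} z * f z) \<partial>lborel) = ennreal (exp (- b))"
    by (simp add: nn_integral_eq_integral)
  then show ?thesis by (simp add: f_def mult_ac)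
qed

section \<open>The walk with constant weight\<close>

lemma abs_cosh_sinh_taylor:
  fixes y :: real
  assumes "\<bar>y\<bar> \<le> 1"
  shows "\<bar>cosh y - 1 - y\<^sup>2 / 2\<bar> \<le> \<bar>y\<bar> ^ 3 / 2" "\<bar>sinh y - y\<bar> \<le> \<bar>y\<bar> ^ 3 / 2"
proof -
  have E: "\<bar>exp x - 1 - x - x\<^sup>2 / 2\<bar> \<le> \<bar>x\<bar> ^ 3 / 2" if "\<bar>x\<bar> \<le> 1" for x :: real
  proof -
    obtain t where t: "\<bar>t\<bar> \<le> \<bar>x\<bar>" "exp x = (\<Sum>m<3. x ^ m / fact m) + exp t / fact 3 * x ^ 3"
      using Maclaurin_exp_le[of x 3] by blast
    \<comment> \<open>The bound 3 divided by the factorial 3! gives the constant 1/2.\<close>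
    have "exp t \<le> exp 1" using t that by simp
    also have "\<dots> \<le> 3" by (rule exp_le)
    finally have "exp t * \<bar>x\<bar> ^ 3 \<le> 3 * \<bar>x\<bar> ^ 3" by (intro mult_right_mono) auto
    moreover have "exp x - 1 - x - x\<^sup>2 / 2 = exp t * x ^ 3 / 6"
      unfolding t(2) by (simp add: eval_nat_numeral)
    ultimately have "\<bar>exp x - 1 - x - x\<^sup>2 / 2\<bar> = exp t * \<bar>x\<bar> ^ 3 / 6"
      by (simp only: abs_mult abs_divide power_abs) simp
    with \<open>exp t * \<bar>x\<bar> ^ 3 \<le> 3 * \<bar>x\<bar> ^ 3\<close> show ?thesis by linarith
  qed
  have 1: "\<bar>exp y - 1 - y - y\<^sup>2 / 2\<bar> \<le> \<bar>y\<bar> ^ 3 / 2" by (rule E[OF assms])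
  have 2: "\<bar>exp (- y) - 1 + y - y\<^sup>2 / 2\<bar> \<le> \<bar>y\<bar> ^ 3 / 2" using E[of "- y"] assms by simp
  show "\<bar>cosh y - 1 - y\<^sup>2 / 2\<bar> \<le> \<bar>y\<bar> ^ 3 / 2" using 1 2 unfolding cosh_field_def by (simp add: abs_le_iff field_simps)
  show "\<bar>sinh y - y\<bar> \<le> \<bar>y\<bar> ^ 3 / 2" using 1 2 unfolding sinh_field_def by (simp add: abs_le_iff field_simps)
qed

text \<open>Here v is a positive solution of v'' = l^2 v sampled with unequal steps; later times
  mean smaller y. The potentially dangerous odd part is q / v y times sinh(l s)/s - sinh(l s')/s':
  the leading terms l cancel, and |q| <= v y controls the rest uniformly in y.\<close>

lemma divided_second_difference_bound:
  fixes l s s' \<alpha> \<beta> y :: real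
  defines "v \<equiv> \<lambda>z. \<alpha> * exp z + \<beta> * exp (- z)"
  assumes pos: "l > 0" "s > 0" "s' > 0" "l * s \<le> 1" "l * s' \<le> 1" and ab: "\<alpha> \<ge> 0" "\<beta> \<ge> 0" "\<alpha> + \<beta> > 0"
  shows "\<bar>((v (y - l * s) - v y) / s - (v y - v (y + l * s')) / s') / v y - l\<^sup>2 * (s + s') / 2\<bar> \<le> l ^ 3 * (s\<^sup>2 + s'\<^sup>2)"
proof -
  define q where "q = \<alpha> * exp y - \<beta> * exp (- y)"
  have v: "v y > 0"
    using ab by (cases "\<alpha> = 0") (auto simp: v_def add_pos_nonneg)
  have q: "\<bar>q\<bar> \<le> v y" using ab by (auto simp: q_def v_def abs_le_iff)
  have cs: "\<bar>(cosh (l * u) - 1) / u - l\<^sup>2 * u / 2\<bar> \<le> l ^ 3 * u\<^sup>2 / 2" "\<bar>sinh (l * u) / u - l\<bar> \<le> l ^ 3 * u\<^sup>2 / 2"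
    if u: "u > 0" "l * u \<le> 1" for u
  proof -
    have lu: "\<bar>l * u\<bar> \<le> 1" using u pos by simp
    have "(cosh (l * u) - 1) / u - l\<^sup>2 * u / 2 = (cosh (l * u) - 1 - (l * u)\<^sup>2 / 2) / u"
      using u by (simp add: field_simps power2_eq_square)
    moreover have "\<bar>(cosh (l * u) - 1 - (l * u)\<^sup>2 / 2) / u\<bar> \<le> \<bar>l * u\<bar> ^ 3 / 2 / u"
      using divide_right_mono[OF abs_cosh_sinh_taylor(1)[OF lu], of u] u by (simp add: abs_divide)
    moreover have "\<bar>l * u\<bar> ^ 3 / 2 / u = l ^ 3 * u\<^sup>2 / 2"
      using u pos by (simp add: power_mult_distrib power2_eq_square power3_eq_cube)
    ultimately show "\<bar>(cosh (l * u) - 1) / u - l\<^sup>2 * u / 2\<bar> \<le> l ^ 3 * u\<^sup>2 / 2" by (simp only:)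
    have "sinh (l * u) / u - l = (sinh (l * u) - l * u) / u" using u by (simp add: field_simps)
    moreover have "\<bar>(sinh (l * u) - l * u) / u\<bar> \<le> \<bar>l * u\<bar> ^ 3 / 2 / u"
      using divide_right_mono[OF abs_cosh_sinh_taylor(2)[OF lu], of u] u by (simp add: abs_divide)
    ultimately show "\<bar>sinh (l * u) / u - l\<bar> \<le> l ^ 3 * u\<^sup>2 / 2"
      using \<open>\<bar>l * u\<bar> ^ 3 / 2 / u = l ^ 3 * u\<^sup>2 / 2\<close> by (simp only:)
  qed
  have v1: "v (y - z) = v y * cosh z - q * sinh z" for z
    by (simp add: v_def q_def cosh_field_def sinh_field_def exp_diff exp_minus exp_add field_simps)
  have v2: "v (y + z) = v y * cosh z + q * sinh z" for z using v1[of "- z"] by simp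
  have "((v (y - l * s) - v y) / s - (v y - v (y + l * s')) / s') / v y - l\<^sup>2 * (s + s') / 2
     = ((cosh (l * s) - 1) / s - l\<^sup>2 * s / 2) + ((cosh (l * s') - 1) / s' - l\<^sup>2 * s' / 2)
       - q / v y * ((sinh (l * s) / s - l) - (sinh (l * s') / s' - l))"
    unfolding v1 v2 using v pos by (simp add: field_simps)
  also have "\<bar>\<dots>\<bar> \<le> (l ^ 3 * s\<^sup>2 / 2 + l ^ 3 * s'\<^sup>2 / 2) + 1 * (l ^ 3 * s\<^sup>2 / 2 + l ^ 3 * s'\<^sup>2 / 2)"
  proof -
    have "\<bar>q / v y\<bar> \<le> 1" using q v by (simp add: abs_divide)
    then have "\<bar>q / v y\<bar> * \<bar>(sinh (l * s) / s - l) - (sinh (l * s') / s' - l)\<bar> \<le> 1 * (l ^ 3 * s\<^sup>2 / 2 + l ^ 3 * s'\<^sup>2 / 2)"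
    proof (intro mult_mono)
      show "\<bar>(sinh (l * s) / s - l) - (sinh (l * s') / s' - l)\<bar> \<le> l ^ 3 * s\<^sup>2 / 2 + l ^ 3 * s'\<^sup>2 / 2"
        using cs(2)[of s] cs(2)[of s'] pos by linarith
    qed auto
    then have "\<bar>q / v y * ((sinh (l * s) / s - l) - (sinh (l * s') / s' - l))\<bar> \<le> 1 * (l ^ 3 * s\<^sup>2 / 2 + l ^ 3 * s'\<^sup>2 / 2)"
      by (simp only: abs_mult)
    then show ?thesis using cs(1)[of s] cs(1)[of s'] pos by linarith
  qed
  finally show ?thesis by (simp add: algebra_simps)
qed

text \<open>
  The flat walk \<open>Y\<close> has step variances \<open>s\<^sub>k = \<sigma>\<^sup>2 a\<^sub>k a\<^sub>k\<^sub>+\<^sub>1\<close>, so it samples a reflected Brownian motion at the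
  times \<open>\<tau>\<^sub>k\<close>, and \<open>A\<close> approximates the integral of its square. For an exponential \<open>v\<close> the exact
  Laplace identity holds for \<open>A\<close> up to a relative error \<open>B \<sigma>\<^sup>2\<close> in the exponent.
\<close>

locale flat_walk = prob_space M for M :: "'a measure" +
  fixes \<zeta> :: "nat \<Rightarrow> 'a \<Rightarrow> real" and a :: "nat \<Rightarrow> real" and \<sigma> lo hi L :: real and j :: nat
  assumes ind: "indep_vars (\<lambda>_. borel) \<zeta> {..<Suc j}"
    and dist: "\<And>k. k < Suc j \<Longrightarrow> distributed M lborel (\<zeta> k) (normal_density 0 \<sigma>)" and \<sigma>: "\<sigma> > 0"
    and lo: "lo > 0" and L: "L \<ge> 0" and a_bounds: "\<And>k. k \<le> Suc j \<Longrightarrow> lo \<le> a k \<and> a k \<le> hi"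
    and a_lipschitz: "\<And>k. k \<le> j \<Longrightarrow> \<bar>a (Suc k) - a k\<bar> \<le> L * \<sigma>\<^sup>2"
begin

definition Y :: "nat \<Rightarrow> 'a \<Rightarrow> real" where
  "Y k \<omega> = reflected_walk (\<lambda>k. sqrt (a k * a (Suc k))) (\<lambda>i. \<zeta> i \<omega>) k"

definition A :: "'a \<Rightarrow> real" where
  "A \<omega> = \<sigma>\<^sup>2 * (\<Sum>k<j. (a (Suc k))\<^sup>2 * (Y (Suc k) \<omega>)\<^sup>2)"

definition \<tau> :: "nat \<Rightarrow> real" where
  "\<tau> k = (\<Sum>i<k. \<sigma>\<^sup>2 * (a i * a (Suc i)))"

text \<open>The first summand is the Taylor remainder for unequal steps, the second the price of
  replacing products of neighbours by squares of a. Division by lo^2 expresses both relative to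
  \<sigma>^2 a^2, so that they sum to a multiple of A.\<close>

definition B :: "real \<Rightarrow> real" where
  "B l = (2 * l ^ 3 * hi ^ 4 + l\<^sup>2 * hi * L) / lo\<^sup>2"

lemma a_pos: "k \<le> Suc j \<Longrightarrow> a k > 0"
  using a_bounds[of k] lo by linarith

lemma hi_pos: "hi > 0"
  using a_bounds[of 0] lo by linarith

lemma measurable_Y [measurable]: "k \<le> Suc j \<Longrightarrow> Y k \<in> borel_measurable M"
  unfolding Y_def using ind by (intro measurable_reflected_walk) (auto simp: indep_vars_def)

lemma measurable_A [measurable]: "A \<in> borel_measurable M"
  unfolding A_def by (intro borel_measurable_times borel_measurable_sum borel_measurable_power borel_measurable_const measurable_Y) auto

lemma A_nonneg: "A \<omega> \<ge> 0"
  unfolding A_def by (intro mult_nonneg_nonneg sum_nonneg) auto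

lemma step_le: "k \<le> j \<Longrightarrow> \<sigma>\<^sup>2 * (a k * a (Suc k)) \<le> \<sigma>\<^sup>2 * hi\<^sup>2"
proof -
  assume "k \<le> j"
  then have "a k * a (Suc k) \<le> hi * hi"
    using a_bounds[of k] a_bounds[of "Suc k"] lo hi_pos by (intro mult_mono) auto
  then show ?thesis by (simp add: power2_eq_square mult_left_mono)
qed

lemma B_nonneg: "l > 0 \<Longrightarrow> B l \<ge> 0"
  unfolding B_def using hi_pos L by (auto intro!: divide_nonneg_nonneg add_nonneg_nonneg mult_nonneg_nonneg)

text \<open>One family of test sequences serves twice: a symmetric choice of \<alpha> and \<beta>
  yields the Laplace transform of A, an asymmetric one a positive terminal coefficient. The second
  condition on l keeps each step within the range of the Taylor bounds.\<close>

context
  fixes l \<alpha> \<beta> c :: real and v d :: "nat \<Rightarrow> real"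
  defines "v \<equiv> \<lambda>k. \<alpha> * exp (l * (c - \<tau> k)) + \<beta> * exp (- (l * (c - \<tau> k)))"
    and "d \<equiv> \<lambda>k. (v (Suc k) - v k) / (\<sigma>\<^sup>2 * (a k * a (Suc k)))"
  assumes l: "l > 0" "l * (\<sigma>\<^sup>2 * hi\<^sup>2) \<le> 1" and \<alpha>\<beta>: "\<alpha> \<ge> 0" "\<beta> \<ge> 0" "\<alpha> + \<beta> > 0"
begin

lemma v_pos: "v k > 0"
  unfolding v_def using \<alpha>\<beta> by (cases "\<alpha> = 0") (auto simp: add_pos_nonneg)

lemma potential_bound:
  assumes k: "k < j"
  shows "\<bar>(d (Suc k) - d k) / v (Suc k) - l\<^sup>2 * (\<sigma>\<^sup>2 * (a (Suc k))\<^sup>2)\<bar> \<le> B l * \<sigma>\<^sup>2 * (\<sigma>\<^sup>2 * (a (Suc k))\<^sup>2)"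
proof -
  define s where "s = \<sigma>\<^sup>2 * (a (Suc k) * a (Suc (Suc k)))"
  define s' where "s' = \<sigma>\<^sup>2 * (a k * a (Suc k))"
  define y where "y = l * (c - \<tau> (Suc k))"
  have pos: "a k > 0" "a (Suc k) > 0" "a (Suc (Suc k)) > 0" using a_pos k by auto
  have s: "s > 0" "s' > 0" using pos \<sigma> by (auto simp: s_def s'_def)
  have sle: "s \<le> \<sigma>\<^sup>2 * hi\<^sup>2" "s' \<le> \<sigma>\<^sup>2 * hi\<^sup>2"
    unfolding s_def s'_def using k by (auto intro!: step_le)
  have ls: "l * s \<le> 1" "l * s' \<le> 1"
    using sle l(2) mult_left_mono[OF sle(1), of l] mult_left_mono[OF sle(2), of l] l(1) by linarith+
  have vy: "v (Suc (Suc k)) = \<alpha> * exp (y - l * s) + \<beta> * exp (- (y - l * s))"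
    "v (Suc k) = \<alpha> * exp y + \<beta> * exp (- y)" "v k = \<alpha> * exp (y + l * s') + \<beta> * exp (- (y + l * s'))"
    by (simp_all add: v_def y_def \<tau>_def s_def s'_def algebra_simps)
  have 1: "\<bar>(d (Suc k) - d k) / v (Suc k) - l\<^sup>2 * (s + s') / 2\<bar> \<le> l ^ 3 * (s\<^sup>2 + s'\<^sup>2)"
    using divided_second_difference_bound[OF l(1) s ls \<alpha>\<beta>, of y]
    unfolding d_def s_def[symmetric] s'_def[symmetric] vy .
  have "l ^ 3 * (s\<^sup>2 + s'\<^sup>2) \<le> l ^ 3 * ((\<sigma>\<^sup>2 * hi\<^sup>2)\<^sup>2 + (\<sigma>\<^sup>2 * hi\<^sup>2)\<^sup>2)"
    using s sle l by (intro mult_left_mono add_mono power_mono) auto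
  also have "\<dots> = (\<sigma>\<^sup>2)\<^sup>2 * (2 * l ^ 3 * hi ^ 4)"
    by (simp add: power_mult_distrib power2_eq_square power4_eq_xxxx)
  finally have 2: "l ^ 3 * (s\<^sup>2 + s'\<^sup>2) \<le> (\<sigma>\<^sup>2)\<^sup>2 * (2 * l ^ 3 * hi ^ 4)" .
  \<comment> \<open>The mean of the two adjacent step variances misses \<sigma>^2 a^2 by a second
    difference of a, estimated by two Lipschitz increments.\<close>
  have "l\<^sup>2 * (s + s') / 2 - l\<^sup>2 * (\<sigma>\<^sup>2 * (a (Suc k))\<^sup>2)
    = l\<^sup>2 * \<sigma>\<^sup>2 * a (Suc k) * ((a (Suc (Suc k)) - a (Suc k)) - (a (Suc k) - a k)) / 2"
    by (simp add: s_def s'_def field_simps power2_eq_square)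
  also have "\<bar>\<dots>\<bar> \<le> l\<^sup>2 * \<sigma>\<^sup>2 * hi * (2 * (L * \<sigma>\<^sup>2)) / 2"
  proof -
    have "\<bar>(a (Suc (Suc k)) - a (Suc k)) - (a (Suc k) - a k)\<bar> \<le> 2 * (L * \<sigma>\<^sup>2)"
      using a_lipschitz[of "Suc k"] a_lipschitz[of k] k by linarith
    then have "\<bar>a (Suc k)\<bar> * \<bar>(a (Suc (Suc k)) - a (Suc k)) - (a (Suc k) - a k)\<bar> \<le> hi * (2 * (L * \<sigma>\<^sup>2))"
      using a_bounds[of "Suc k"] pos k by (intro mult_mono) auto
    from mult_left_mono[OF this, of "l\<^sup>2 * \<sigma>\<^sup>2"] show ?thesis
      by (simp add: abs_mult mult_ac)
  qed
  also have "\<dots> = (\<sigma>\<^sup>2)\<^sup>2 * (l\<^sup>2 * hi * L)" by (simp add: power2_eq_square)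
  finally have 3: "\<bar>l\<^sup>2 * (s + s') / 2 - l\<^sup>2 * (\<sigma>\<^sup>2 * (a (Suc k))\<^sup>2)\<bar> \<le> (\<sigma>\<^sup>2)\<^sup>2 * (l\<^sup>2 * hi * L)" .
  have "\<bar>(d (Suc k) - d k) / v (Suc k) - l\<^sup>2 * (\<sigma>\<^sup>2 * (a (Suc k))\<^sup>2)\<bar>
     \<le> (\<sigma>\<^sup>2)\<^sup>2 * (2 * l ^ 3 * hi ^ 4) + (\<sigma>\<^sup>2)\<^sup>2 * (l\<^sup>2 * hi * L)"
    using 1 2 3 by linarith
  also have "\<dots> = (\<sigma>\<^sup>2)\<^sup>2 * (B l * lo\<^sup>2)"
    using lo by (simp add: B_def distrib_left)
  also have "\<dots> \<le> (\<sigma>\<^sup>2)\<^sup>2 * (B l * (a (Suc k))\<^sup>2)"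
    using B_nonneg[OF l(1)] lo a_bounds[of "Suc k"] k by (intro mult_left_mono power_mono) auto
  also have "\<dots> = B l * \<sigma>\<^sup>2 * (\<sigma>\<^sup>2 * (a (Suc k))\<^sup>2)" by (simp add: power2_eq_square)
  finally show ?thesis .
qed

lemma potential_sum_bounds:
  "\<bar>(\<Sum>k<j. (d (Suc k) - d k) / v (Suc k) * (Y (Suc k) \<omega>)\<^sup>2) - l\<^sup>2 * A \<omega>\<bar> \<le> B l * \<sigma>\<^sup>2 * A \<omega>"
proof -
  define p where "p = (\<lambda>k. (d (Suc k) - d k) / v (Suc k))"
  define g where "g = (\<lambda>k. \<sigma>\<^sup>2 * (a (Suc k))\<^sup>2)"
  define y where "y = (\<lambda>k. (Y (Suc k) \<omega>)\<^sup>2)"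
  have A: "A \<omega> = (\<Sum>k<j. g k * y k)"
    unfolding A_def sum_distrib_left g_def y_def by (simp only: mult.assoc)
  have "\<bar>(p k - l\<^sup>2 * g k) * y k\<bar> \<le> B l * \<sigma>\<^sup>2 * (g k * y k)" if "k < j" for k
  proof -
    have y: "y k \<ge> 0" by (simp add: y_def)
    have "\<bar>p k - l\<^sup>2 * g k\<bar> \<le> B l * \<sigma>\<^sup>2 * g k"
      using potential_bound[OF that] unfolding p_def g_def .
    from mult_right_mono[OF this y] y show ?thesis by (simp add: abs_mult mult.assoc)
  qed
  then have "\<bar>\<Sum>k<j. (p k - l\<^sup>2 * g k) * y k\<bar> \<le> (\<Sum>k<j. B l * \<sigma>\<^sup>2 * (g k * y k))"
    by (intro order_trans[OF sum_abs] sum_mono) simp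
  also have "\<dots> = B l * \<sigma>\<^sup>2 * A \<omega>" unfolding A sum_distrib_left ..
  also have "(\<Sum>k<j. (p k - l\<^sup>2 * g k) * y k) = (\<Sum>k<j. p k * y k) - l\<^sup>2 * A \<omega>"
    unfolding A sum_distrib_left sum_subtractf[symmetric] by (simp only: left_diff_distrib mult.assoc)
  finally show ?thesis unfolding p_def y_def .
qed

text \<open>The exact identity has a potential only close to that of l^2 A. As squares of Y are
  nonnegative, enlarging or reducing l^2 by B l \<sigma>^2 turns it into two inequalities.\<close>

lemma flat_laplace_bounds:
  shows "(\<integral>\<^sup>+\<omega>. ennreal (exp ((d j / v (Suc j) * (Y (Suc j) \<omega>)\<^sup>2 - (l\<^sup>2 + B l * \<sigma>\<^sup>2) * A \<omega>) / 2)) \<partial>M) \<le> ennreal (sqrt (v (Suc j) / v 0))"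
    and "ennreal (sqrt (v (Suc j) / v 0)) \<le> (\<integral>\<^sup>+\<omega>. ennreal (exp ((d j / v (Suc j) * (Y (Suc j) \<omega>)\<^sup>2 - (l\<^sup>2 - B l * \<sigma>\<^sup>2) * A \<omega>) / 2)) \<partial>M)"
proof -
  define r where "r = (\<lambda>k. sqrt (a k * a (Suc k)))"
  have r2: "\<sigma>\<^sup>2 * (r k)\<^sup>2 = \<sigma>\<^sup>2 * (a k * a (Suc k))" if "k < Suc j" for k
    using a_pos[of k] a_pos[of "Suc k"] that by (auto simp: r_def)
  define d' where "d' = (\<lambda>k. (v (Suc k) - v k) / (\<sigma>\<^sup>2 * (r k)\<^sup>2))"
  have d': "d' k = d k" if "k < Suc j" for k using r2[OF that] by (simp add: d'_def d_def)
  have eq: "(\<integral>\<^sup>+\<omega>. ennreal (exp ((d j / v (Suc j) * (Y (Suc j) \<omega>)\<^sup>2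
            - (\<Sum>k<j. (d (Suc k) - d k) / v (Suc k) * (Y (Suc k) \<omega>)\<^sup>2)) / 2)) \<partial>M) = ennreal (sqrt (v (Suc j) / v 0))"
  proof -
    have "(\<integral>\<^sup>+\<omega>. ennreal (exp ((d' j / v (Suc j) * (Y (Suc j) \<omega>)\<^sup>2
            - (\<Sum>k<j. (d' (Suc k) - d' k) / v (Suc k) * (Y (Suc k) \<omega>)\<^sup>2)) / 2)) \<partial>M) = ennreal (sqrt (v (Suc j) / v 0))"
      unfolding Y_def d'_def r_def[symmetric]
      by (rule laplace_reflected_walk[OF ind dist \<sigma>]) (use v_pos a_pos in \<open>auto simp: r_def\<close>)
    moreover have "(\<Sum>k<j. (d' (Suc k) - d' k) / v (Suc k) * (Y (Suc k) \<omega>)\<^sup>2)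
        = (\<Sum>k<j. (d (Suc k) - d k) / v (Suc k) * (Y (Suc k) \<omega>)\<^sup>2)" for \<omega>
      by (intro sum.cong) (auto simp: d')
    ultimately show ?thesis by (simp only: d' lessI)
  qed
  have pt: "l\<^sup>2 * A \<omega> - B l * \<sigma>\<^sup>2 * A \<omega> \<le> (\<Sum>k<j. (d (Suc k) - d k) / v (Suc k) * (Y (Suc k) \<omega>)\<^sup>2)"
    "(\<Sum>k<j. (d (Suc k) - d k) / v (Suc k) * (Y (Suc k) \<omega>)\<^sup>2) \<le> l\<^sup>2 * A \<omega> + B l * \<sigma>\<^sup>2 * A \<omega>" for \<omega>
    using potential_sum_bounds[of \<omega>] by linarith+
  have aux: "ennreal (exp ((u - y) / 2)) \<le> ennreal (exp ((u - x) / 2))" if "x \<le> y" for u x y :: real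
    using that by (intro ennreal_leI) simp
  show "(\<integral>\<^sup>+\<omega>. ennreal (exp ((d j / v (Suc j) * (Y (Suc j) \<omega>)\<^sup>2 - (l\<^sup>2 + B l * \<sigma>\<^sup>2) * A \<omega>) / 2)) \<partial>M) \<le> ennreal (sqrt (v (Suc j) / v 0))"
    unfolding eq[symmetric] distrib_right by (intro nn_integral_mono aux pt)
  show "ennreal (sqrt (v (Suc j) / v 0)) \<le> (\<integral>\<^sup>+\<omega>. ennreal (exp ((d j / v (Suc j) * (Y (Suc j) \<omega>)\<^sup>2 - (l\<^sup>2 - B l * \<sigma>\<^sup>2) * A \<omega>) / 2)) \<partial>M)"
    unfolding eq[symmetric] by (intro nn_integral_mono aux) (simp only: pt left_diff_distrib)
qed

end

lemma exp_neg_A_integrable: "t \<ge> 0 \<Longrightarrow> integrable M (\<lambda>\<omega>. exp (- (t * A \<omega>)))"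
  using A_nonneg by (intro integrable_const_bound[where B = 1]) auto

lemma nn_integral_exp_neg_A:
  "t \<ge> 0 \<Longrightarrow> (\<integral>\<^sup>+\<omega>. ennreal (exp (- (t * A \<omega>))) \<partial>M) = ennreal (expectation (\<lambda>\<omega>. exp (- (t * A \<omega>))))"
  by (intro nn_integral_eq_integral exp_neg_A_integrable) auto

text \<open>Centring \<open>v\<close> at the midpoint of the last step makes the terminal factor vanish exactly.\<close>

lemma laplace_A_estimate:
  fixes l :: real
  assumes l: "l > 0" "l * (\<sigma>\<^sup>2 * hi\<^sup>2) \<le> 1" "B l * \<sigma>\<^sup>2 < l\<^sup>2"
  defines "s \<equiv> \<sigma>\<^sup>2 * (a j * a (Suc j))"
  shows "\<bar>expectation (\<lambda>\<omega>. exp (- (l\<^sup>2 / 2 * A \<omega>))) - sqrt (cosh (l * s / 2) / cosh (l * (\<tau> (Suc j) - s / 2)))\<bar>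
     \<le> B l * \<sigma>\<^sup>2 / (l\<^sup>2 - B l * \<sigma>\<^sup>2)"
proof -
  define \<delta> where "\<delta> = B l * \<sigma>\<^sup>2"
  have \<delta>: "0 \<le> \<delta>" "\<delta> < l\<^sup>2" using B_nonneg[OF l(1)] l(3) by (auto simp: \<delta>_def)
  define c where "c = \<tau> (Suc j) - s / 2"
  define v where "v = (\<lambda>k. 1 / 2 * exp (l * (c - \<tau> k)) + 1 / 2 * exp (- (l * (c - \<tau> k))))"
  have v: "v k = cosh (l * (c - \<tau> k))" for k by (simp add: v_def cosh_field_def)
  have \<tau>0: "\<tau> 0 = 0" and \<tau>S: "\<tau> (Suc j) = \<tau> j + s" by (simp_all add: \<tau>_def s_def)
  have vn: "v (Suc j) = cosh (l * s / 2)" "v j = cosh (l * s / 2)" "v 0 = cosh (l * (\<tau> (Suc j) - s / 2))"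
    unfolding v c_def \<tau>0 using \<tau>S cosh_minus[of "l * s / 2"] by (auto simp: algebra_simps)
  have vk: "1 / 2 * exp (l * (c - \<tau> k)) + 1 / 2 * exp (- (l * (c - \<tau> k))) = v k" for k
    by (simp add: v_def)
  note bd = flat_laplace_bounds[OF l(1,2), of "1 / 2" "1 / 2" c, unfolded vk \<delta>_def[symmetric]]
  define R where "R = sqrt (v (Suc j) / v 0)"
  have Rv: "R = sqrt (cosh (l * s / 2) / cosh (l * (\<tau> (Suc j) - s / 2)))" unfolding R_def vn ..
  have R0: "R \<ge> 0" unfolding Rv by (simp add: cosh_real_nonneg)
  have v0: "(v (Suc j) - v j) / (\<sigma>\<^sup>2 * (a j * a (Suc j))) / v (Suc j) = 0" by (simp add: vn)
  define E where "E = (\<lambda>t. expectation (\<lambda>\<omega>. exp (- (t * A \<omega>))))"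
  have e: "exp ((0 * y - u * A \<omega>) / 2) = exp (- (u / 2 * A \<omega>))" for u y \<omega> by simp
  have b1: "E ((l\<^sup>2 + \<delta>) / 2) \<le> R"
  proof -
    have "ennreal (E ((l\<^sup>2 + \<delta>) / 2)) \<le> ennreal R"
      using bd(1)[unfolded v0] \<delta> e[of "l\<^sup>2 + \<delta>"] unfolding E_def R_def
      by (subst nn_integral_exp_neg_A[symmetric]) auto
    then show ?thesis using R0 by simp
  qed
  have b2: "R \<le> E ((l\<^sup>2 - \<delta>) / 2)"
  proof -
    have "ennreal R \<le> ennreal (E ((l\<^sup>2 - \<delta>) / 2))"
      using bd(2)[unfolded v0] \<delta> e[of "l\<^sup>2 - \<delta>"] unfolding E_def R_def
      by (subst nn_integral_exp_neg_A[symmetric]) auto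
    then show ?thesis unfolding E_def by (subst (asm) ennreal_le_iff) (auto intro!: integral_nonneg_AE)
  qed
  \<comment> \<open>Continuity of the Laplace transform without any moment of A: u A exp(-u A) <=
    1.\<close>
  have E_diff: "\<bar>E t - E u\<bar> \<le> (t - u) / u" if "0 < u" "u \<le> t" for t u
  proof -
    have "exp (- (u * A \<omega>)) - exp (- (t * A \<omega>)) \<le> (t - u) / u" for \<omega>
    proof -
      have "exp (- (t * A \<omega>)) = exp (- (u * A \<omega>)) * exp (- ((t - u) * A \<omega>))"
        by (simp add: mult_exp_exp algebra_simps)
      moreover have "exp (- ((t - u) * A \<omega>)) \<ge> 1 - (t - u) * A \<omega>"
        using exp_ge_add_one_self[of "- ((t - u) * A \<omega>)"] by simp
      ultimately have "exp (- (u * A \<omega>)) * (1 - (t - u) * A \<omega>) \<le> exp (- (t * A \<omega>))"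
        by (simp add: mult_left_mono)
      then have "exp (- (u * A \<omega>)) - exp (- (t * A \<omega>)) \<le> (t - u) * (A \<omega> * exp (- (u * A \<omega>)))"
        by (simp add: algebra_simps)
      also have "A \<omega> * exp (- (u * A \<omega>)) \<le> 1 / u"
      proof -
        have "u * A \<omega> \<le> exp (u * A \<omega>)" using exp_ge_add_one_self[of "u * A \<omega>"] by linarith
        then have "u * A \<omega> * exp (- (u * A \<omega>)) \<le> exp (u * A \<omega>) * exp (- (u * A \<omega>))" by (intro mult_right_mono) auto
        also have "\<dots> = 1" by (simp add: mult_exp_exp)
        finally show ?thesis using that by (simp add: field_simps)
      qed
      then have "(t - u) * (A \<omega> * exp (- (u * A \<omega>))) \<le> (t - u) * (1 / u)"
        using that by (intro mult_left_mono) auto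
      finally show ?thesis by simp
    qed
    then have "expectation (\<lambda>\<omega>. exp (- (u * A \<omega>)) - exp (- (t * A \<omega>))) \<le> expectation (\<lambda>_. (t - u) / u)"
      using that by (intro integral_mono Bochner_Integration.integrable_diff exp_neg_A_integrable) auto
    moreover have "expectation (\<lambda>\<omega>. exp (- (u * A \<omega>)) - exp (- (t * A \<omega>))) = E u - E t"
      unfolding E_def using that by (intro Bochner_Integration.integral_diff exp_neg_A_integrable) auto
    moreover have "E t \<le> E u"
      unfolding E_def using that A_nonneg by (intro integral_mono exp_neg_A_integrable) (auto intro!: mult_right_mono)
    ultimately show ?thesis by (simp add: prob_space)
  qed
  have pos: "0 < l\<^sup>2 - \<delta>" using \<delta> by simp
  have "\<bar>E (l\<^sup>2 / 2) - R\<bar> \<le> \<delta> / (l\<^sup>2 - \<delta>)"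
  proof -
    have "\<bar>E (l\<^sup>2 / 2) - E ((l\<^sup>2 - \<delta>) / 2)\<bar> \<le> (l\<^sup>2 / 2 - (l\<^sup>2 - \<delta>) / 2) / ((l\<^sup>2 - \<delta>) / 2)"
      using \<delta> by (intro E_diff) auto
    also have "\<dots> = \<delta> / (l\<^sup>2 - \<delta>)" using pos by (simp add: field_simps)
    finally have 1: "\<bar>E (l\<^sup>2 / 2) - E ((l\<^sup>2 - \<delta>) / 2)\<bar> \<le> \<delta> / (l\<^sup>2 - \<delta>)" .
    have "\<bar>E ((l\<^sup>2 + \<delta>) / 2) - E (l\<^sup>2 / 2)\<bar> \<le> ((l\<^sup>2 + \<delta>) / 2 - l\<^sup>2 / 2) / (l\<^sup>2 / 2)"
      using \<delta> l by (intro E_diff) auto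
    also have "\<dots> = \<delta> / l\<^sup>2" using l by (simp add: field_simps)
    also have "\<dots> \<le> \<delta> / (l\<^sup>2 - \<delta>)" using \<delta> pos by (intro divide_left_mono mult_pos_pos) auto
    finally have 2: "\<bar>E ((l\<^sup>2 + \<delta>) / 2) - E (l\<^sup>2 / 2)\<bar> \<le> \<delta> / (l\<^sup>2 - \<delta>)" .
    show ?thesis using 1 2 b1 b2 by linarith
  qed
  then show ?thesis unfolding E_def Rv \<delta>_def .
qed

text \<open>An exponential Chebyshev bound that also carries a terminal weight: with k = l^2 + B l
  \<sigma>^2 the indicator is at most exp(k (x - A)/2), and a test sequence that increases at the
  end supplies the square of the terminal value.\<close>

lemma terminal_moment_estimate:
  fixes l x :: real
  assumes l: "l > 0" "l * (\<sigma>\<^sup>2 * hi\<^sup>2) \<le> 1 / 4"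
  shows "(\<integral>\<^sup>+\<omega>. ennreal (exp (l / 8 * (Y (Suc j) \<omega>)\<^sup>2) * indicator {..x} (A \<omega>)) \<partial>M)
     \<le> ennreal (exp ((l\<^sup>2 + B l * \<sigma>\<^sup>2) * x / 2) * (2 * exp (- (l * \<tau> (Suc j) / 2))))"
proof -
  define s where "s = \<sigma>\<^sup>2 * (a j * a (Suc j))"
  define T where "T = \<tau> (Suc j)"
  \<comment> \<open>The weights add up to 1, so v ends at 1; the decaying one exceeds the other by
    1/2, so the slope in time at the end is about l/2. The discrete slope is still at least l/4, and
    halving in the exponent gives l/8. The weight 1/4 gives v 0 >= exp(l T)/4, hence the factor 2 in
    the bound.\<close>
  define v where "v = (\<lambda>k. 1 / 4 * exp (l * (T - \<tau> k)) + 3 / 4 * exp (- (l * (T - \<tau> k))))"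
  have l1: "l * (\<sigma>\<^sup>2 * hi\<^sup>2) \<le> 1" using l by linarith
  have vk: "1 / 4 * exp (l * (T - \<tau> k)) + 3 / 4 * exp (- (l * (T - \<tau> k))) = v k" for k
    by (simp add: v_def)
  note bd = flat_laplace_bounds(1)[OF l(1) l1, of "1 / 4" "3 / 4" T, unfolded vk s_def[symmetric]]
  have \<tau>0: "\<tau> 0 = 0" and \<tau>S: "T = \<tau> j + s" by (simp_all add: \<tau>_def s_def T_def)
  have s: "s > 0" using a_pos[of j] a_pos[of "Suc j"] \<sigma> by (simp add: s_def)
  have y: "0 < l * s" using l s by simp
  have "l * s \<le> l * (\<sigma>\<^sup>2 * hi\<^sup>2)" unfolding s_def by (rule mult_left_mono[OF step_le]) (use l in auto)
  then have "l * s \<le> 1 / 4" using l by linarith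
  have vn: "v (Suc j) = 1" by (simp add: v_def T_def)
  have vj: "v j = cosh (l * s) - sinh (l * s) / 2"
    by (simp add: v_def \<tau>S cosh_field_def sinh_field_def field_simps)
  have d: "l / 4 \<le> (v (Suc j) - v j) / s / v (Suc j)"
  proof -
    define y where "y = l * s"
    have y: "0 < y" "y \<le> 1 / 4" using \<open>0 < l * s\<close> \<open>l * s \<le> 1 / 4\<close> by (auto simp: y_def)
    have c: "cosh y \<le> 1 + y\<^sup>2 / 2 + y ^ 3 / 2" "sinh y \<ge> y - y ^ 3 / 2"
    proof -
      have "\<bar>y\<bar> \<le> 1" "\<bar>y\<bar> = y" using y by auto
      then show "cosh y \<le> 1 + y\<^sup>2 / 2 + y ^ 3 / 2" "sinh y \<ge> y - y ^ 3 / 2"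
        using abs_cosh_sinh_taylor[OF \<open>\<bar>y\<bar> \<le> 1\<close>, unfolded \<open>\<bar>y\<bar> = y\<close>] by linarith+
    qed
    have y3: "y ^ 3 \<le> y\<^sup>2 / 4"
      using y mult_right_mono[of y "1 / 4" "y\<^sup>2"] by (simp add: power3_eq_cube power2_eq_square)
    have y2: "y\<^sup>2 \<le> y / 4"
      using y mult_right_mono[of y "1 / 4" y] by (simp add: power2_eq_square)
    have "y / 4 \<le> 1 - (cosh y - sinh y / 2)"
      using c y2 y3 y by linarith
    then have "l * s / 4 / s \<le> (1 - (cosh (l * s) - sinh (l * s) / 2)) / s"
      unfolding y_def using s by (intro divide_right_mono) auto
    then show ?thesis using s by (simp add: vn vj)
  qed
  have "(\<integral>\<^sup>+\<omega>. ennreal (exp (l / 8 * (Y (Suc j) \<omega>)\<^sup>2) * indicator {..x} (A \<omega>)) \<partial>M)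
     \<le> (\<integral>\<^sup>+\<omega>. ennreal (exp ((l\<^sup>2 + B l * \<sigma>\<^sup>2) * x / 2)) * ennreal (exp (((v (Suc j) - v j) / s / v (Suc j) * (Y (Suc j) \<omega>)\<^sup>2 - (l\<^sup>2 + B l * \<sigma>\<^sup>2) * A \<omega>) / 2)) \<partial>M)"
  proof (intro nn_integral_mono)
    fix \<omega>
    show "ennreal (exp (l / 8 * (Y (Suc j) \<omega>)\<^sup>2) * indicator {..x} (A \<omega>)) \<le> ennreal (exp ((l\<^sup>2 + B l * \<sigma>\<^sup>2) * x / 2)) * ennreal (exp (((v (Suc j) - v j) / s / v (Suc j) * (Y (Suc j) \<omega>)\<^sup>2 - (l\<^sup>2 + B l * \<sigma>\<^sup>2) * A \<omega>) / 2))"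
    proof (cases "A \<omega> \<le> x")
      case True
      have aux: "p / 2 \<le> r' / 2 + (q - r) / 2" if "p \<le> q" "r \<le> r'" for p q r r' :: real
        using that by (simp add: field_simps)
      have "l / 4 * (Y (Suc j) \<omega>)\<^sup>2 \<le> (v (Suc j) - v j) / s / v (Suc j) * (Y (Suc j) \<omega>)\<^sup>2"
        by (rule mult_right_mono[OF d]) simp
      moreover have "(l\<^sup>2 + B l * \<sigma>\<^sup>2) * A \<omega> \<le> (l\<^sup>2 + B l * \<sigma>\<^sup>2) * x"
        using True B_nonneg[OF l(1)] by (intro mult_left_mono) auto
      ultimately have *: "l / 4 * (Y (Suc j) \<omega>)\<^sup>2 / 2 \<le> (l\<^sup>2 + B l * \<sigma>\<^sup>2) * x / 2 + ((v (Suc j) - v j) / s / v (Suc j) * (Y (Suc j) \<omega>)\<^sup>2 - (l\<^sup>2 + B l * \<sigma>\<^sup>2) * A \<omega>) / 2"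
        by (rule aux)
      have "l / 8 * (Y (Suc j) \<omega>)\<^sup>2 = l / 4 * (Y (Suc j) \<omega>)\<^sup>2 / 2" by simp
      then show ?thesis using True * by (simp only: ennreal_mult[symmetric] mult_exp_exp exp_ge_zero) (simp add: ennreal_leI)
    qed simp
  qed
  also have "\<dots> = ennreal (exp ((l\<^sup>2 + B l * \<sigma>\<^sup>2) * x / 2)) * (\<integral>\<^sup>+\<omega>. ennreal (exp (((v (Suc j) - v j) / s / v (Suc j) * (Y (Suc j) \<omega>)\<^sup>2 - (l\<^sup>2 + B l * \<sigma>\<^sup>2) * A \<omega>) / 2)) \<partial>M)"
    by (rule nn_integral_cmult) simp
  also have "\<dots> \<le> ennreal (exp ((l\<^sup>2 + B l * \<sigma>\<^sup>2) * x / 2)) * ennreal (sqrt (v (Suc j) / v 0))"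
    using bd by (intro mult_left_mono) auto
  also have "\<dots> \<le> ennreal (exp ((l\<^sup>2 + B l * \<sigma>\<^sup>2) * x / 2)) * ennreal (2 * exp (- (l * T / 2)))"
  proof (intro mult_left_mono ennreal_leI)
    have "v 0 \<ge> exp (l * T) / 4" unfolding v_def \<tau>0 by simp
    moreover from this have "v 0 > 0" by (rule less_le_trans[rotated]) simp
    ultimately have "v (Suc j) / v 0 \<le> 1 / (exp (l * T) / 4)" unfolding vn by (intro divide_left_mono) auto
    also have "\<dots> = (2 * exp (- (l * T / 2)))\<^sup>2"
      by (simp add: power_mult_distrib exp_of_nat_mult[symmetric] exp_minus field_simps)
    finally show "sqrt (v (Suc j) / v 0) \<le> 2 * exp (- (l * T / 2))"
      by (intro real_le_lsqrt) auto
  qed auto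
  finally show ?thesis by (simp add: ennreal_mult T_def)
qed

end

section \<open>The reflected path as a limit of reflected walks\<close>

lemma reflected_walk_nonneg: "reflected_walk r x k \<ge> 0"
  by (cases k) auto

text \<open>The compensator \<open>Z + w\<close> is nondecreasing and increases only in steps that end within \<open>\<delta>\<close> of \<open>0\<close>.\<close>

lemma reflected_walk_skorokhod:
  fixes x :: "nat \<Rightarrow> real"
  defines "w \<equiv> \<lambda>k. \<Sum>i<k. x i"
  assumes "\<And>i. i < n \<Longrightarrow> \<bar>x i\<bar> \<le> \<delta>" "\<delta> \<ge> 0" "k \<le> n"
  shows "(\<forall>j\<le>k. w j \<le> reflected_walk (\<lambda>_. 1) x k + w k) \<and>
    (\<exists>j\<le>k. reflected_walk (\<lambda>_. 1) x k + w k \<le> w j + \<delta>)"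
  using \<open>k \<le> n\<close>
proof (induction k)
  case 0
  show ?case using assms by (simp add: w_def)
next
  case (Suc k)
  define Z where "Z = reflected_walk (\<lambda>_. 1) x"
  have IH: "\<forall>j\<le>k. w j \<le> Z k + w k" "\<exists>j\<le>k. Z k + w k \<le> w j + \<delta>"
    using Suc by (auto simp: Z_def)
  have ZS: "Z (Suc k) = \<bar>Z k - x k\<bar>" and wS: "w (Suc k) = w k + x k" by (simp_all add: Z_def w_def)
  have Z0: "Z k \<ge> 0" by (simp add: Z_def reflected_walk_nonneg)
  have xk: "\<bar>x k\<bar> \<le> \<delta>" using assms Suc by auto
  have "w j \<le> Z (Suc k) + w (Suc k)" if "j \<le> Suc k" for j
  proof (cases "j = Suc k")
    case True then show ?thesis by (simp add: ZS)
  next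
    case False
    then have "w j \<le> Z k + w k" using IH that by auto
    then show ?thesis unfolding ZS wS by linarith
  qed
  moreover have "\<exists>j\<le>Suc k. Z (Suc k) + w (Suc k) \<le> w j + \<delta>"
  proof (cases "x k \<le> Z k")
    case True
    then show ?thesis using IH(2) unfolding ZS wS by (auto intro: le_SucI)
  next
    case False
    then show ?thesis using xk Z0 by (intro exI[of _ "Suc k"]) (auto simp: ZS)
  qed
  ultimately show ?case by (simp add: Z_def)
qed

lemma
  fixes W :: "real \<Rightarrow> 'a \<Rightarrow> real"
  assumes W: "continuous_on {0..1} (\<lambda>t. W t \<omega>)"
  shows running_sup_upper: "0 \<le> s \<Longrightarrow> s \<le> t \<Longrightarrow> t \<le> 1 \<Longrightarrow> W s \<omega> \<le> running_sup W t \<omega>"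
    and running_sup_least: "0 \<le> t \<Longrightarrow> (\<And>s. 0 \<le> s \<Longrightarrow> s \<le> t \<Longrightarrow> W s \<omega> \<le> c) \<Longrightarrow> running_sup W t \<omega> \<le> c"
proof -
  have bdd: "bdd_above ((\<lambda>s. W s \<omega>) ` {0..t})" if "t \<le> 1"
    using that compact_continuous_image[OF continuous_on_subset[OF W] compact_Icc[of 0 t]]
    by (auto intro!: bounded_imp_bdd_above compact_imp_bounded)
  show "0 \<le> s \<Longrightarrow> s \<le> t \<Longrightarrow> t \<le> 1 \<Longrightarrow> W s \<omega> \<le> running_sup W t \<omega>"
    unfolding running_sup_def by (intro cSUP_upper bdd) auto
  show "0 \<le> t \<Longrightarrow> (\<And>s. 0 \<le> s \<Longrightarrow> s \<le> t \<Longrightarrow> W s \<omega> \<le> c) \<Longrightarrow> running_sup W t \<omega> \<le> c"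
    unfolding running_sup_def by (intro cSUP_least) auto
qed

lemma continuous_on_running_sup:
  fixes W :: "real \<Rightarrow> 'a \<Rightarrow> real"
  assumes W: "continuous_on {0..1} (\<lambda>t. W t \<omega>)"
  shows "continuous_on {0..1} (\<lambda>t. running_sup W t \<omega>)"
proof (rule uniformly_continuous_imp_continuous)
  have unif: "uniformly_continuous_on {0..1} (\<lambda>t. W t \<omega>)"
    by (rule compact_uniformly_continuous[OF W compact_Icc])
  show "uniformly_continuous_on {0..1} (\<lambda>t. running_sup W t \<omega>)"
    unfolding uniformly_continuous_on_def
  proof (intro allI impI)
    fix e :: real assume "e > 0"
    then obtain d where d: "d > 0" "\<And>s t. s \<in> {0..1} \<Longrightarrow> t \<in> {0..1} \<Longrightarrow> dist t s < d \<Longrightarrow> dist (W t \<omega>) (W s \<omega>) < e / 2"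
      using unif unfolding uniformly_continuous_on_def by (meson half_gt_zero)
    have mono: "running_sup W s \<omega> \<le> running_sup W t \<omega> \<and> running_sup W t \<omega> \<le> running_sup W s \<omega> + e / 2"
      if st: "0 \<le> s" "s \<le> t" "t \<le> 1" "t - s < d" for s t
    proof
      show "running_sup W s \<omega> \<le> running_sup W t \<omega>"
        using st by (intro running_sup_least[where W = W and \<omega> = \<omega>, OF W] running_sup_upper[where W = W and \<omega> = \<omega>, OF W]) auto
      show "running_sup W t \<omega> \<le> running_sup W s \<omega> + e / 2"
      proof (intro running_sup_least[where W = W and \<omega> = \<omega>, OF W])
        fix u assume u: "0 \<le> u" "u \<le> t"
        show "W u \<omega> \<le> running_sup W s \<omega> + e / 2"
        proof (cases "u \<le> s")
          case True
          then show ?thesis using running_sup_upper[where W = W and \<omega> = \<omega>, OF W, of u s] u st \<open>e > 0\<close> by auto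
        next
          case False
          then have "dist (W u \<omega>) (W s \<omega>) < e / 2" using u st by (intro d) (auto simp: dist_real_def)
          then show ?thesis using running_sup_upper[where W = W and \<omega> = \<omega>, OF W, of s s] st
            unfolding dist_real_def by linarith
        qed
      qed (use st in auto)
    qed
    show "\<exists>d>0. \<forall>x\<in>{0..1}. \<forall>x'\<in>{0..1}. dist x' x < d \<longrightarrow> dist (running_sup W x' \<omega>) (running_sup W x \<omega>) < e"
    proof (intro exI[of _ d] conjI ballI impI d(1))
      fix x x' :: real assume *: "x \<in> {0..1}" "x' \<in> {0..1}" "dist x' x < d"
      show "dist (running_sup W x' \<omega>) (running_sup W x \<omega>) < e"
        using mono[of x x'] mono[of x' x] * \<open>e > 0\<close>
        by (cases "x \<le> x'") (auto simp: dist_real_def)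
    qed
  qed
qed

section \<open>Riemann sums and pathwise convergence of the weighted walk functional\<close>

lemma riemann_sum_bound:
  fixes f :: "real \<Rightarrow> real"
  assumes f: "continuous_on {0..1} f" and n: "n > 0"
    and e: "\<And>s t. s \<in> {0..1} \<Longrightarrow> t \<in> {0..1} \<Longrightarrow> \<bar>s - t\<bar> \<le> 1 / real n \<Longrightarrow> \<bar>f s - f t\<bar> \<le> e"
  shows "\<bar>(\<Sum>k<n. f (real k / real n)) / real n - integral {0..1} f\<bar> \<le> e"
proof -
  have int: "f integrable_on {a..b}" if "0 \<le> a" "b \<le> 1" for a b
    using that by (intro integrable_continuous_interval continuous_on_subset[OF f]) auto
  have "\<bar>(\<Sum>k<m. f (real k / real n)) / real n - integral {0..real m / real n} f\<bar> \<le> e * (real m / real n)"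
    if "m \<le> n" for m
    using that
  proof (induction m)
    case (Suc m)
    let ?a = "real m / real n" and ?b = "real (Suc m) / real n"
    have ab: "0 \<le> ?a" "?a \<le> ?b" "?b \<le> 1" "?b - ?a = 1 / real n"
      using Suc n by (auto simp: field_simps)
    have sub: "{?a..?b} \<subseteq> {0..1}" using ab(1,3) by (metis atLeastatMost_subset_iff)
    have "integral {?a..?b} (\<lambda>t. f ?a - f t) = f ?a / real n - integral {?a..?b} f"
      using ab int[of ?a ?b] by (subst Henstock_Kurzweil_Integration.integral_diff) auto
    moreover have "norm (integral {?a..?b} (\<lambda>t. f ?a - f t)) \<le> e * (?b - ?a)"
    proof (intro integral_bound continuous_intros continuous_on_subset[OF f] sub)
      fix t assume t: "t \<in> {?a..?b}"
      show "norm (f ?a - f t) \<le> e"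
        unfolding real_norm_def
      proof (rule e)
        show "?a \<in> {0..1}" using ab(1-3) unfolding atLeastAtMost_iff by linarith
        show "t \<in> {0..1}" using sub t by blast
        show "\<bar>?a - t\<bar> \<le> 1 / real n" using t ab(4) unfolding atLeastAtMost_iff by linarith
      qed
    qed (rule ab(2))
    ultimately have "\<bar>f ?a / real n - integral {?a..?b} f\<bar> \<le> e / real n"
      using ab by simp
    moreover have "integral {0..?b} f = integral {0..?a} f + integral {?a..?b} f"
      using ab int by (intro Henstock_Kurzweil_Integration.integral_combine[symmetric]) auto
    moreover have "e * ?b = e * ?a + e / real n" by (simp add: field_simps add_divide_distrib)
    ultimately show ?case using Suc by (simp add: add_divide_distrib del: of_nat_Suc)
  qed simp
  from this[of n] show ?thesis using n by simp
qed

lemma riemann_sum_tendsto: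
  fixes f :: "real \<Rightarrow> real"
  assumes f: "continuous_on {0..1} f"
  shows "(\<lambda>j. (\<Sum>k<Suc j. f (real k / real (Suc j))) / real (Suc j)) \<longlonglongrightarrow> (LBINT t:{0..1}. f t)"
proof -
  have eq: "(LBINT t:{0..1}. f t) = integral {0..1} f"
    by (rule set_borel_integral_eq_integral) (rule borel_integrable_atLeastAtMost'[OF f])
  have unif: "uniformly_continuous_on {0..1} f"
    by (rule compact_uniformly_continuous[OF f compact_Icc])
  show ?thesis
    unfolding eq
  proof (rule LIMSEQ_I)
    fix e :: real assume "e > 0"
    then obtain d where d: "d > 0" "\<And>s t. s \<in> {0..1} \<Longrightarrow> t \<in> {0..1} \<Longrightarrow> dist t s < d \<Longrightarrow> dist (f t) (f s) < e / 2"
      using unif unfolding uniformly_continuous_on_def by (meson half_gt_zero)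
    obtain n0 :: nat where n0: "real n0 > 1 / d" using reals_Archimedean2 by blast
    show "\<exists>no. \<forall>n\<ge>no. norm ((\<Sum>k<Suc n. f (real k / real (Suc n))) / real (Suc n) - integral {0..1} f) < e"
    proof (intro exI[of _ n0] allI impI)
      fix n assume "n \<ge> n0"
      then have "1 / d < real (Suc n)" using n0 by linarith
      then have h: "1 / real (Suc n) < d" using d(1) by (simp add: field_simps del: of_nat_Suc)
      have "\<bar>(\<Sum>k<Suc n. f (real k / real (Suc n))) / real (Suc n) - integral {0..1} f\<bar> \<le> e / 2"
      proof (rule riemann_sum_bound[OF f])
        fix s t :: real assume "s \<in> {0..1}" "t \<in> {0..1}" "\<bar>s - t\<bar> \<le> 1 / real (Suc n)"
        then show "\<bar>f s - f t\<bar> \<le> e / 2" using d(2)[of t s] h by (auto simp: dist_real_def)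
      qed simp
      then show "norm ((\<Sum>k<Suc n. f (real k / real (Suc n))) / real (Suc n) - integral {0..1} f) < e"
        using \<open>e > 0\<close> by simp
    qed
  qed
qed

definition grid_increment :: "(real \<Rightarrow> 'a \<Rightarrow> real) \<Rightarrow> nat \<Rightarrow> nat \<Rightarrow> 'a \<Rightarrow> real" where
  "grid_increment W n k \<omega> = W (real (Suc k) / real n) \<omega> - W (real k / real n) \<omega>"

text \<open>Up to a common shift by W 0, both Z + w and the running supremum lie between the maximum
  over the grid and that maximum plus \<delta>: the former by the discrete Skorokhod bound, the
  latter by the oscillation of the path between grid points.\<close>

lemma reflected_walk_near_reflected_path:
  fixes W :: "real \<Rightarrow> 'a \<Rightarrow> real"
  assumes W: "continuous_on {0..1} (\<lambda>t. W t \<omega>)" and n: "n > 0" and k: "k \<le> n"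
    and \<delta>: "\<And>s t. s \<in> {0..1} \<Longrightarrow> t \<in> {0..1} \<Longrightarrow> \<bar>s - t\<bar> \<le> 1 / real n \<Longrightarrow> \<bar>W s \<omega> - W t \<omega>\<bar> \<le> \<delta>"
  shows "\<bar>reflected_walk (\<lambda>_. 1) (\<lambda>i. grid_increment W n i \<omega>) k
      - (running_sup W (real k / real n) \<omega> - W (real k / real n) \<omega>)\<bar> \<le> \<delta>"
proof -
  define x where "x = (\<lambda>i. grid_increment W n i \<omega>)"
  define w where "w = (\<lambda>k. \<Sum>i<k. x i)"
  define Z where "Z = reflected_walk (\<lambda>_. 1) x k"
  \<comment> \<open>The value W 0 is subtracted because it vanishes only almost surely; it cancels
    in S - W.\<close>
  have w: "w m = W (real m / real n) \<omega> - W 0 \<omega>" for m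
    by (induction m) (auto simp: w_def x_def grid_increment_def)
  have \<delta>0: "\<delta> \<ge> 0" using \<delta>[of 0 0] by simp
  have grid: "real m / real n \<in> {0..1}" if "m \<le> n" for m using that n by auto
  have xb: "\<bar>x i\<bar> \<le> \<delta>" if "i < n" for i
    unfolding x_def grid_increment_def using that
    by (intro \<delta> grid) (auto simp: diff_divide_distrib[symmetric])
  let ?R = "running_sup W (real k / real n) \<omega>"
  have sk: "(\<forall>j\<le>k. w j \<le> Z + w k) \<and> (\<exists>j\<le>k. Z + w k \<le> w j + \<delta>)"
    unfolding w_def Z_def by (rule reflected_walk_skorokhod[OF xb \<delta>0 k]) auto
  then obtain j where j: "j \<le> k" "Z + w k \<le> w j + \<delta>" by blast
  have "W (real j / real n) \<omega> \<le> ?R"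
    using j grid[OF k] grid[of j] k n
    by (intro running_sup_upper[where W = W and \<omega> = \<omega>, OF W]) (auto simp: divide_right_mono)
  then have 1: "Z \<le> ?R - W (real k / real n) \<omega> + \<delta>" using j(2) by (simp add: w)
  have "?R \<le> Z + W (real k / real n) \<omega> + \<delta>"
  proof (rule running_sup_least[where W = W and \<omega> = \<omega>, OF W])
    fix s assume s: "0 \<le> s" "s \<le> real k / real n"
    define m where "m = nat \<lfloor>s * real n\<rfloor>"
    have "s * real n \<le> real k" using s n by (simp add: field_simps)
    then have mk: "m \<le> k" unfolding m_def by linarith
    have m: "real m \<le> s * real n" "s * real n < real m + 1"
      unfolding m_def using s n by (auto simp: of_nat_nat)
    have "\<bar>s - real m / real n\<bar> \<le> 1 / real n"
    proof -
      have "s - real m / real n = (s * real n - real m) / real n" using n by (simp add: field_simps)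
      then show ?thesis using m n by (simp add: abs_divide divide_right_mono)
    qed
    then have "\<bar>W s \<omega> - W (real m / real n) \<omega>\<bar> \<le> \<delta>"
      using s grid[OF k] grid[of m] mk k by (intro \<delta>) auto
    moreover have "w m \<le> Z + w k" using sk mk by auto
    ultimately show "W s \<omega> \<le> Z + W (real k / real n) \<omega> + \<delta>" by (simp add: w)
  qed simp
  with 1 show ?thesis unfolding Z_def x_def by linarith
qed

lemma weighted_sum_reflected_walk_tendsto:
  fixes W :: "real \<Rightarrow> 'a \<Rightarrow> real" and \<psi> :: "real \<Rightarrow> real"
  assumes W: "continuous_on {0..1} (\<lambda>t. W t \<omega>)" and \<psi>: "continuous_on {0..1} \<psi>"
  shows "(\<lambda>j. (\<Sum>k<j. \<psi> (real (Suc k) / real (Suc j)) *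
      (reflected_walk (\<lambda>_. 1) (\<lambda>i. grid_increment W (Suc j) i \<omega>) (Suc k))\<^sup>2) / real (Suc j))
    \<longlonglongrightarrow> (LBINT t:{0..1}. (running_sup W t \<omega> - W t \<omega>)\<^sup>2 * \<psi> t)"
proof -
  define Y where "Y = (\<lambda>t. running_sup W t \<omega> - W t \<omega>)"
  define Z where "Z = (\<lambda>j. reflected_walk (\<lambda>_. 1) (\<lambda>i. grid_increment W (Suc j) i \<omega>))"
  have Y: "continuous_on {0..1} Y"
    unfolding Y_def by (intro continuous_intros W continuous_on_running_sup)
  have bounded: "\<exists>B>0. \<forall>t\<in>{0..1}. \<bar>g t\<bar> \<le> B" if "continuous_on {0..1} g" for g :: "real \<Rightarrow> real"
    using compact_imp_bounded[OF compact_continuous_image[OF that compact_Icc]]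
    by (auto simp: bounded_pos)
  obtain B where B: "B > 0" "\<And>t. t \<in> {0..1} \<Longrightarrow> \<bar>Y t\<bar> \<le> B" using bounded[OF Y] by auto
  obtain P where P: "P > 0" "\<And>t. t \<in> {0..1} \<Longrightarrow> \<bar>\<psi> t\<bar> \<le> P" using bounded[OF \<psi>] by auto
  have unif: "uniformly_continuous_on {0..1} (\<lambda>t. W t \<omega>)"
    by (rule compact_uniformly_continuous[OF W compact_Icc])
  define I where "I = (LBINT t:{0..1}. (Y t)\<^sup>2 * \<psi> t)"
  define f where "f = (\<lambda>t. (Y t)\<^sup>2 * \<psi> t)"
  have 1: "(\<lambda>j. (\<Sum>k<j. f (real (Suc k) / real (Suc j))) / real (Suc j)) \<longlonglongrightarrow> I"
  proof -
    have "continuous_on {0..1} f" unfolding f_def by (intro continuous_intros Y \<psi>)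
    then have "(\<lambda>j. (\<Sum>k<Suc j. f (real k / real (Suc j))) / real (Suc j)) \<longlonglongrightarrow> I"
      unfolding I_def f_def[symmetric] by (rule riemann_sum_tendsto)
    \<comment> \<open>The walk is summed over the grid points 1 to j, while the Riemann sum also
      contains the point 0.\<close>
    moreover have "(\<lambda>j. f 0 / real (Suc j)) \<longlonglongrightarrow> 0" by real_asymp
    ultimately have "(\<lambda>j. (\<Sum>k<Suc j. f (real k / real (Suc j))) / real (Suc j) - f 0 / real (Suc j)) \<longlonglongrightarrow> I - 0"
      by (rule tendsto_diff)
    then show ?thesis
      by (subst (asm) sum.lessThan_Suc_shift) (simp add: add_divide_distrib del: of_nat_Suc)
  qed
  have 2: "(\<lambda>j. (\<Sum>k<j. \<psi> (real (Suc k) / real (Suc j)) * (Z j (Suc k))\<^sup>2) / real (Suc j)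
      - (\<Sum>k<j. f (real (Suc k) / real (Suc j))) / real (Suc j)) \<longlonglongrightarrow> 0"
  proof (rule LIMSEQ_I)
    fix e :: real assume e: "e > 0"
    define \<delta> where "\<delta> = min 1 (e / (2 * (P * (2 * B + 1))))"
    have \<delta>: "\<delta> > 0" "\<delta> \<le> 1" "P * (\<delta> * (2 * B + 1)) < e"
    proof -
      show "\<delta> > 0" "\<delta> \<le> 1" using e P B by (auto simp: \<delta>_def)
      have "P * (\<delta> * (2 * B + 1)) \<le> P * (e / (2 * (P * (2 * B + 1))) * (2 * B + 1))"
        using P B by (intro mult_left_mono mult_right_mono) (auto simp: \<delta>_def)
      also have "\<dots> = e / 2"
        using P B by (simp add: less_imp_neq[symmetric] add_pos_pos)
      finally show "P * (\<delta> * (2 * B + 1)) < e" using e by simp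
    qed
    obtain d where d: "d > 0" "\<And>s t. s \<in> {0..1} \<Longrightarrow> t \<in> {0..1} \<Longrightarrow> dist t s < d \<Longrightarrow> dist (W t \<omega>) (W s \<omega>) < \<delta>"
      using unif \<delta>(1) unfolding uniformly_continuous_on_def by meson
    obtain n0 :: nat where n0: "real n0 > 1 / d" using reals_Archimedean2 by blast
    show "\<exists>no. \<forall>j\<ge>no. norm ((\<Sum>k<j. \<psi> (real (Suc k) / real (Suc j)) * (Z j (Suc k))\<^sup>2) / real (Suc j)
      - (\<Sum>k<j. f (real (Suc k) / real (Suc j))) / real (Suc j) - 0) < e"
    proof (intro exI[of _ n0] allI impI)
      fix j assume "j \<ge> n0"
      then have "1 / d < real (Suc j)" using n0 by linarith
      then have h: "1 / real (Suc j) < d" using d(1) by (simp add: field_simps del: of_nat_Suc)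
      have summand: "\<bar>\<psi> (real (Suc k) / real (Suc j)) * (Z j (Suc k))\<^sup>2 - f (real (Suc k) / real (Suc j))\<bar> \<le> P * (\<delta> * (2 * B + 1))"
        if k: "k < j" for k
      proof -
        define t where "t = real (Suc k) / real (Suc j)"
        have t: "t \<in> {0..1}" using k by (auto simp: t_def)
        have zy: "\<bar>Z j (Suc k) - Y t\<bar> \<le> \<delta>"
          unfolding Z_def Y_def t_def
        proof (rule reflected_walk_near_reflected_path[where W = W and \<omega> = \<omega>, OF W])
          fix s u :: real assume "s \<in> {0..1}" "u \<in> {0..1}" "\<bar>s - u\<bar> \<le> 1 / real (Suc j)"
          then show "\<bar>W s \<omega> - W u \<omega>\<bar> \<le> \<delta>" using d(2)[of u s] h by (auto simp: dist_real_def)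
        qed (use k in auto)
        have "\<bar>Z j (Suc k) + Y t\<bar> \<le> 2 * B + 1" using zy B(2)[OF t] \<delta>(2) by linarith
        then have "\<bar>Z j (Suc k) - Y t\<bar> * \<bar>Z j (Suc k) + Y t\<bar> \<le> \<delta> * (2 * B + 1)"
          using zy \<delta>(1) by (intro mult_mono) auto
        then have "\<bar>(Z j (Suc k))\<^sup>2 - (Y t)\<^sup>2\<bar> \<le> \<delta> * (2 * B + 1)"
          by (simp add: abs_mult[symmetric] power2_eq_square algebra_simps)
        then have "\<bar>\<psi> t\<bar> * \<bar>(Z j (Suc k))\<^sup>2 - (Y t)\<^sup>2\<bar> \<le> P * (\<delta> * (2 * B + 1))"
          using P(2)[OF t] P(1) by (intro mult_mono) auto
        then show ?thesis unfolding t_def[symmetric] f_def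
          by (simp add: abs_mult[symmetric] right_diff_distrib mult.commute)
      qed
      have "\<bar>(\<Sum>k<j. \<psi> (real (Suc k) / real (Suc j)) * (Z j (Suc k))\<^sup>2) - (\<Sum>k<j. f (real (Suc k) / real (Suc j)))\<bar>
         \<le> (\<Sum>k<j. P * (\<delta> * (2 * B + 1)))"
        unfolding sum_subtractf[symmetric] by (intro order_trans[OF sum_abs] sum_mono summand) auto
      also have "\<dots> \<le> real (Suc j) * (P * (\<delta> * (2 * B + 1)))"
        using P B \<delta> by (simp add: mult_right_mono)
      finally have "\<bar>(\<Sum>k<j. \<psi> (real (Suc k) / real (Suc j)) * (Z j (Suc k))\<^sup>2) / real (Suc j)
        - (\<Sum>k<j. f (real (Suc k) / real (Suc j))) / real (Suc j)\<bar> \<le> P * (\<delta> * (2 * B + 1))"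
        by (simp add: diff_divide_distrib[symmetric] pos_divide_le_eq mult.commute del: of_nat_Suc)
      then show "norm ((\<Sum>k<j. \<psi> (real (Suc k) / real (Suc j)) * (Z j (Suc k))\<^sup>2) / real (Suc j)
        - (\<Sum>k<j. f (real (Suc k) / real (Suc j))) / real (Suc j) - 0) < e"
        using \<delta>(3) by simp
    qed
  qed
  show ?thesis
    using tendsto_add[OF 2 1] by (simp add: I_def Y_def Z_def del: of_nat_Suc reflected_walk.simps)
qed

section \<open>The candidate limit law: one-sided stable laws and the expansion of 1 / sqrt (cosh
  y)\<close>

definition levy_kernel :: "real \<Rightarrow> real \<Rightarrow> real" where
  "levy_kernel b z = 2 * std_normal_density z * exp (- b\<^sup>2 / (2 * z\<^sup>2)) * indicator {0<..} z"

lemma levy_kernel_nonneg: "levy_kernel b z \<ge> 0"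
  by (simp add: levy_kernel_def)

lemma measurable_levy_kernel [measurable]: "levy_kernel b \<in> borel_measurable borel"
  unfolding levy_kernel_def by measurable

text \<open>\<open>levy_kernel 0\<close> is the density of the absolute value of a standard normal
  variable. Tilting it by a multiple of the stable variable b^2/z^2 only changes the parameter, so
  Laplace transforms are total masses of kernels.\<close>

lemma levy_kernel_laplace: "levy_kernel 0 z * exp (- (c * (b\<^sup>2 / z\<^sup>2))) = levy_kernel (sqrt (2 * c) * b) z" if "c \<ge> 0"
  using that by (simp add: levy_kernel_def power_mult_distrib mult_ac)

lemma
  assumes "b > 0"
  shows integrable_levy_kernel: "integrable lborel (levy_kernel b)"
    and integral_levy_kernel: "(\<integral>z. levy_kernel b z \<partial>lborel) = exp (- b)"
proof -
  have eq: "(\<integral>\<^sup>+z. ennreal (levy_kernel b z) \<partial>lborel) = ennreal (exp (- b))"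
    using nn_integral_levy_laplace[OF assms] by (simp add: levy_kernel_def)
  show 1: "integrable lborel (levy_kernel b)"
    by (rule integrableI_nonneg) (auto simp: eq levy_kernel_nonneg)
  show "(\<integral>z. levy_kernel b z \<partial>lborel) = exp (- b)"
    using nn_integral_eq_integral[OF 1] eq by (simp add: levy_kernel_nonneg integral_nonneg_AE)
qed

lemma integrable_levy_kernel_0: "integrable lborel (levy_kernel 0)"
proof (rule Bochner_Integration.integrable_bound)
  show "integrable lborel (\<lambda>z. 2 * std_normal_density z)" by simp
  show "AE z in lborel. norm (levy_kernel 0 z) \<le> norm (2 * std_normal_density z)"
    by (auto simp: levy_kernel_def split: split_indicator)
qed simp

text \<open>Consecutive coefficients have the ratio (-1/2 - k)/(k + 1), of modulus below 1.\<close>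

lemma abs_gbinomial_neg_half_le_1: "\<bar>(- 1 / 2 :: real) gchoose k\<bar> \<le> 1"
proof (induction k)
  case (Suc k)
  have "(- 1 / 2 :: real) gchoose (Suc k) = (- 1 / 2 - real k) / real (Suc k) * ((- 1 / 2) gchoose k)"
    using gbinomial_absorption'[of "Suc k" "- 1 / 2 :: real"] gbinomial_factors[of "- 1 / 2 :: real" k] gbinomial_mult_1[of "- 1 / 2 :: real" k]
    by (simp add: field_simps)
  also have "\<bar>\<dots>\<bar> \<le> 1 * 1"
    unfolding abs_mult using Suc by (intro mult_mono) (auto simp: abs_divide divide_le_eq)
  finally show ?case by simp
qed simp

text \<open>Newton's binomial series in exp(-2y), after writing cosh y = exp y (1 + exp(-2y)) /
  2.\<close>

lemma inverse_sqrt_cosh_series: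
  assumes y: "y > 0"
  shows "(\<lambda>k. sqrt 2 * ((- 1 / 2) gchoose k) * exp (- ((2 * real k + 1 / 2) * y))) sums (1 / sqrt (cosh y))"
proof -
  have "(\<lambda>k. ((- 1 / 2) gchoose k) * exp (- 2 * y) ^ k) sums (1 + exp (- 2 * y)) powr (- 1 / 2)"
    by (rule gen_binomial_real) (use y in auto)
  from sums_mult[OF this, of "sqrt 2 * exp (- y / 2)"]
  have "(\<lambda>k. sqrt 2 * exp (- y / 2) * (((- 1 / 2) gchoose k) * exp (- 2 * y) ^ k)) sums
    (sqrt 2 * exp (- y / 2) * (1 + exp (- 2 * y)) powr (- 1 / 2))" .
  moreover have "sqrt 2 * exp (- y / 2) * (c * exp (- 2 * y) ^ k) = sqrt 2 * c * exp (- ((2 * real k + 1 / 2) * y))" for c :: real and k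
  proof -
    have "exp (- y / 2) * exp (- 2 * y) ^ k = exp (- ((2 * real k + 1 / 2) * y))"
      by (simp add: exp_of_nat_mult[symmetric] mult_exp_exp algebra_simps)
    moreover have "sqrt 2 * exp (- y / 2) * (c * exp (- 2 * y) ^ k) = sqrt 2 * c * (exp (- y / 2) * exp (- 2 * y) ^ k)"
      by (simp only: mult_ac)
    ultimately show ?thesis by (simp only:)
  qed
  moreover have "sqrt 2 * exp (- y / 2) * (1 + exp (- 2 * y)) powr (- 1 / 2) = 1 / sqrt (cosh y)"
  proof -
    have p: "1 + exp (- 2 * y) > 0" by (simp add: add_pos_pos)
    have "(1 + exp (- 2 * y)) powr (- 1 / 2) = 1 / sqrt (1 + exp (- 2 * y))"
    proof -
      have "(- 1 / 2 :: real) = - (1 / 2)" by simp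
      then show ?thesis using powr_minus_divide[of "1 + exp (- 2 * y)" "1 / 2"] powr_half_sqrt[of "1 + exp (- 2 * y)"] p
        by (simp only: less_imp_le)
    qed
    moreover have "exp (- y / 2) = 1 / sqrt (exp y)"
    proof -
      have "sqrt (exp y) = exp (y / 2)"
        by (rule real_sqrt_unique) (simp_all add: power2_eq_square mult_exp_exp)
      moreover have "exp (- y / 2) = 1 / exp (y / 2)"
        using exp_minus[of "y / 2"] by (simp only: minus_divide_left inverse_eq_divide)
      ultimately show ?thesis by (simp only:)
    qed
    moreover have "cosh y = exp y * (1 + exp (- 2 * y)) / 2"
      by (simp add: cosh_field_def distrib_left mult_exp_exp)
    ultimately show ?thesis by (simp only: real_sqrt_mult real_sqrt_divide) simp
  qed
  ultimately show ?thesis by (simp only:)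
qed

lemma measurable_count_space_pair:
  assumes "\<And>k::nat. (\<lambda>z. f (k, z)) \<in> borel_measurable lborel"
  shows "f \<in> borel_measurable (count_space UNIV \<Otimes>\<^sub>M lborel)"
  using assms by (intro measurable_pair_measure_countable1) auto

text \<open>Presents an absolutely convergent series of integrals as a single integral, so that the
  whole expansion can act as one signed density in the moment argument.\<close>

lemma integral_count_space_lborel:
  fixes f :: "nat \<times> real \<Rightarrow> real"
  assumes m: "\<And>k. integrable lborel (\<lambda>z. f (k, z))" and s: "summable (\<lambda>k. \<integral>z. \<bar>f (k, z)\<bar> \<partial>lborel)"
  shows "integrable (count_space UNIV \<Otimes>\<^sub>M lborel) f"
    and "(\<integral>p. f p \<partial>(count_space UNIV \<Otimes>\<^sub>M lborel)) = (\<Sum>k. \<integral>z. f (k, z) \<partial>lborel)"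
proof -
  interpret pair_sigma_finite "count_space (UNIV :: nat set)" "lborel :: real measure"
    by (intro pair_sigma_finite.intro sigma_finite_measure_count_space sigma_finite_lborel)
  have [measurable]: "f \<in> borel_measurable (count_space UNIV \<Otimes>\<^sub>M lborel)"
    using m by (intro measurable_count_space_pair) (auto dest: borel_measurable_integrable)
  have "integrable (count_space UNIV) (\<lambda>k. \<integral>z. \<bar>f (k, z)\<bar> \<partial>lborel)"
    using s by (simp add: integrable_count_space_nat_iff)
  then show int: "integrable (count_space UNIV \<Otimes>\<^sub>M lborel) f"
    using m by (intro Fubini_integrable) (auto simp: AE_count_space)
  have "integrable (count_space UNIV) (\<lambda>k. \<integral>z. f (k, z) \<partial>lborel)"
    using integrable_fst'[OF int] by simp
  then show "(\<integral>p. f p \<partial>(count_space UNIV \<Otimes>\<^sub>M lborel)) = (\<Sum>k. \<integral>z. f (k, z) \<partial>lborel)"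
    using integral_fst'[OF int] by (simp add: integral_count_space_nat)
qed

section \<open>The limit of the constant-weight functional along refining meshes\<close>

locale flat_walk_sequence = prob_space M for M :: "'a measure" +
  fixes \<zeta> :: "nat \<Rightarrow> nat \<Rightarrow> 'a \<Rightarrow> real" and a :: "nat \<Rightarrow> nat \<Rightarrow> real" and \<sigma> :: "nat \<Rightarrow> real" and lo hi L \<theta> :: real
  assumes walk: "\<And>j. flat_walk M (\<zeta> j) (a j) (\<sigma> j) lo hi L j"
    and mesh: "\<sigma> \<longlonglongrightarrow> 0"
    and \<theta>: "\<theta> > 0"
    and horizon: "(\<lambda>j. flat_walk.\<tau> (a j) (\<sigma> j) (Suc j)) \<longlonglongrightarrow> \<theta>"
begin

definition A :: "nat \<Rightarrow> 'a \<Rightarrow> real" where "A j = flat_walk.A (\<zeta> j) (a j) (\<sigma> j) j"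

definition T :: "nat \<times> real \<Rightarrow> real" where
  "T p = ((2 * real (fst p) + 1 / 2) * \<theta>)\<^sup>2 / (snd p)\<^sup>2"

text \<open>The k-th term of the expansion, already damped by exp(-T). Without this factor every
  kernel has mass 1 and the absolute values of the coefficients are not summable; with it the masses
  decay geometrically in k.\<close>

definition H :: "nat \<times> real \<Rightarrow> real" where
  "H p = sqrt 2 * ((- 1 / 2) gchoose (fst p)) * (levy_kernel 0 (snd p) * exp (- T p))"

lemma measurable_A [measurable]: "A j \<in> borel_measurable M"
  unfolding A_def by (rule flat_walk.measurable_A[OF walk])

lemma A_nonneg: "A j \<omega> \<ge> 0"
  unfolding A_def by (rule flat_walk.A_nonneg[OF walk])

lemma mesh_sq: "(\<lambda>j. c * (\<sigma> j)\<^sup>2) \<longlonglongrightarrow> 0"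
  using tendsto_mult[OF tendsto_const[of c] tendsto_power[OF mesh, of 2]] by simp

text \<open>The bounds lo, hi, L are common to all j, so the error is governed by one constant times
  \<sigma>^2; the last step variance tends to 0, so the numerator cosh tends to 1.\<close>

lemma laplace_A_tendsto:
  assumes l: "l > 0"
  shows "(\<lambda>j. expectation (\<lambda>\<omega>. exp (- (l\<^sup>2 / 2 * A j \<omega>)))) \<longlonglongrightarrow> 1 / sqrt (cosh (l * \<theta>))"
proof -
  define B where "B = flat_walk.B lo hi L l"
  define s where "s = (\<lambda>j. (\<sigma> j)\<^sup>2 * (a j j * a j (Suc j)))"
  define R where "R = (\<lambda>j. sqrt (cosh (l * s j / 2) / cosh (l * (flat_walk.\<tau> (a j) (\<sigma> j) (Suc j) - s j / 2))))"
  have s0: "s \<longlonglongrightarrow> 0"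
  proof (rule tendsto_sandwich)
    show "\<forall>\<^sub>F j in sequentially. 0 \<le> s j"
      using flat_walk.a_pos[OF walk] flat_walk.\<sigma>[OF walk] unfolding s_def
      by (intro always_eventually allI mult_nonneg_nonneg) (auto intro!: less_imp_le)
    show "\<forall>\<^sub>F j in sequentially. s j \<le> hi\<^sup>2 * (\<sigma> j)\<^sup>2"
      using flat_walk.step_le[OF walk] unfolding s_def
      by (intro always_eventually allI) (auto simp: mult.commute)
  qed (auto intro!: mesh_sq)
  have "R \<longlonglongrightarrow> sqrt (cosh (l * 0 / 2) / cosh (l * (\<theta> - 0 / 2)))"
    unfolding R_def by (intro tendsto_intros s0 horizon) auto
  then have R: "R \<longlonglongrightarrow> 1 / sqrt (cosh (l * \<theta>))" by (simp add: real_sqrt_divide)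
  have "(\<lambda>j. B * (\<sigma> j)\<^sup>2 / (l\<^sup>2 - B * (\<sigma> j)\<^sup>2)) \<longlonglongrightarrow> 0 / (l\<^sup>2 - 0)"
    using l by (intro tendsto_intros mesh_sq) auto
  then have err: "(\<lambda>j. B * (\<sigma> j)\<^sup>2 / (l\<^sup>2 - B * (\<sigma> j)\<^sup>2)) \<longlonglongrightarrow> 0" by simp
  have e1: "\<forall>\<^sub>F j in sequentially. l * hi\<^sup>2 * (\<sigma> j)\<^sup>2 < 1"
    by (rule order_tendstoD[OF mesh_sq]) simp
  have e2: "\<forall>\<^sub>F j in sequentially. B * (\<sigma> j)\<^sup>2 < l\<^sup>2"
    by (rule order_tendstoD[OF mesh_sq]) (use l in simp)
  have "(\<lambda>j. expectation (\<lambda>\<omega>. exp (- (l\<^sup>2 / 2 * A j \<omega>))) - R j) \<longlonglongrightarrow> 0"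
  proof (rule Lim_null_comparison[OF _ err])
    show "\<forall>\<^sub>F j in sequentially. norm (expectation (\<lambda>\<omega>. exp (- (l\<^sup>2 / 2 * A j \<omega>))) - R j) \<le> B * (\<sigma> j)\<^sup>2 / (l\<^sup>2 - B * (\<sigma> j)\<^sup>2)"
      using e1 e2
    proof eventually_elim
      case (elim j)
      then show ?case
        using flat_walk.laplace_A_estimate[OF walk[of j] l] unfolding A_def R_def B_def s_def
        by (simp add: mult_ac)
    qed
  qed
  from tendsto_add[OF this R] show ?thesis by simp
qed

lemma kernel_summand:
  assumes "m \<ge> 0"
  shows "levy_kernel 0 z * exp (- T (k, z)) * exp (- (m * T (k, z))) = levy_kernel (sqrt (2 * (m + 1)) * ((2 * real k + 1 / 2) * \<theta>)) z"
proof -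
  have "exp (- T (k, z)) * exp (- (m * T (k, z))) = exp (- ((m + 1) * (((2 * real k + 1 / 2) * \<theta>)\<^sup>2 / z\<^sup>2)))"
    by (simp only: mult_exp_exp T_def fst_conv snd_conv distrib_right mult_1 minus_add_distrib add.commute)
  then show ?thesis
    using levy_kernel_laplace[of "m + 1" z "(2 * real k + 1 / 2) * \<theta>"] assms by (simp add: mult.assoc)
qed

text \<open>Term by term the integral is an exponential exp(-(2k + 1/2) y) with y = sqrt(2(m + 1))
  \<theta>, and the series sums to 1 / sqrt (cosh y). The +1 comes from the damping in
  \<open>H\<close> and makes y positive already for m = 0.\<close>

lemma
  assumes m: "m \<ge> 0"
  shows integrable_H_laplace: "integrable (count_space UNIV \<Otimes>\<^sub>M lborel) (\<lambda>p. exp (- (m * T p)) * H p)"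
    and integral_H_laplace: "(\<integral>p. exp (- (m * T p)) * H p \<partial>(count_space UNIV \<Otimes>\<^sub>M lborel)) = 1 / sqrt (cosh (sqrt (2 * (m + 1)) * \<theta>))"
proof -
  define y where "y = sqrt (2 * (m + 1)) * \<theta>"
  have y: "y > 0" using m \<theta> by (simp add: y_def)
  have by_pos: "(2 * real k + 1 / 2) * y > 0" for k using y by (intro mult_pos_pos) auto
  have e: "exp (- (m * T (k, z))) * H (k, z) = sqrt 2 * ((- 1 / 2) gchoose k) * levy_kernel ((2 * real k + 1 / 2) * y) z" for k z
    using kernel_summand[OF m, of z k] by (simp add: H_def y_def mult_ac)
  have int: "integrable lborel (\<lambda>z. exp (- (m * T (k, z))) * H (k, z))" for k
    unfolding e by (intro integrable_mult_right integrable_levy_kernel by_pos)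
  have I: "(\<integral>z. exp (- (m * T (k, z))) * H (k, z) \<partial>lborel) = sqrt 2 * ((- 1 / 2) gchoose k) * exp (- ((2 * real k + 1 / 2) * y))" for k
    unfolding e using integral_levy_kernel[OF by_pos] integrable_levy_kernel[OF by_pos] by simp
  have "(\<integral>z. \<bar>exp (- (m * T (k, z))) * H (k, z)\<bar> \<partial>lborel) = sqrt 2 * \<bar>(- 1 / 2) gchoose k\<bar> * exp (- ((2 * real k + 1 / 2) * y))" for k
    unfolding e abs_mult using integral_levy_kernel[OF by_pos] integrable_levy_kernel[OF by_pos] by (simp add: levy_kernel_nonneg)
  moreover have "summable (\<lambda>k. sqrt 2 * \<bar>(- 1 / 2) gchoose k\<bar> * exp (- ((2 * real k + 1 / 2) * y)))"
  proof (rule summable_comparison_test')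
    show "summable (\<lambda>k. sqrt 2 * exp (- (2 * y)) ^ k)"
      using y by (intro summable_mult summable_geometric) auto
    fix k :: nat
    have "\<bar>(- 1 / 2 :: real) gchoose k\<bar> * exp (- ((2 * real k + 1 / 2) * y)) \<le> 1 * exp (- (2 * y)) ^ k"
      using y abs_gbinomial_neg_half_le_1[of k] by (intro mult_mono) (auto simp: exp_of_nat_mult[symmetric] algebra_simps)
    then show "norm (sqrt 2 * \<bar>(- 1 / 2) gchoose k\<bar> * exp (- ((2 * real k + 1 / 2) * y))) \<le> sqrt 2 * exp (- (2 * y)) ^ k"
      by (simp add: mult.assoc)
  qed
  ultimately have summ: "summable (\<lambda>k. \<integral>z. \<bar>exp (- (m * T (k, z))) * H (k, z)\<bar> \<partial>lborel)" by simp
  show "integrable (count_space UNIV \<Otimes>\<^sub>M lborel) (\<lambda>p. exp (- (m * T p)) * H p)"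
    by (rule integral_count_space_lborel(1)[OF int summ])
  show "(\<integral>p. exp (- (m * T p)) * H p \<partial>(count_space UNIV \<Otimes>\<^sub>M lborel)) = 1 / sqrt (cosh (sqrt (2 * (m + 1)) * \<theta>))"
    using integral_count_space_lborel(2)[OF int summ] sums_unique[OF inverse_sqrt_cosh_series[OF y]]
    by (simp add: I y_def)
qed

lemma measurable_T [measurable]: "T \<in> borel_measurable (count_space UNIV \<Otimes>\<^sub>M lborel)"
  by (rule measurable_count_space_pair) (simp add: T_def)

lemma T_nonneg: "T p \<ge> 0" by (simp add: T_def)

text \<open>The m-th moment of exp(-A) under the weight exp(-A) is the Laplace transform at m + 1,
  that is at l = sqrt(2(m + 1)).\<close>

lemma functional_A_tendsto:
  assumes g: "continuous_on UNIV g"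
  shows "(\<lambda>j. expectation (\<lambda>\<omega>. g (exp (- A j \<omega>)) * exp (- A j \<omega>))) \<longlonglongrightarrow> (\<integral>p. g (exp (- T p)) * H p \<partial>(count_space UNIV \<Otimes>\<^sub>M lborel))"
proof (rule tendsto_integral_of_moments[where C = 1 and U = "\<lambda>j \<omega>. exp (- A j \<omega>)" and H = "\<lambda>j \<omega>. exp (- A j \<omega>)"
      and V = "\<lambda>p. exp (- T p)" and G = H])
  show int: "integrable M (\<lambda>\<omega>. exp (- A j \<omega>))" for j
    using A_nonneg by (intro integrable_const_bound[where B = 1]) auto
  have "expectation (\<lambda>\<omega>. \<bar>exp (- A j \<omega>)\<bar>) \<le> expectation (\<lambda>_. 1)" for j
    using A_nonneg int by (intro integral_mono) auto
  then show "expectation (\<lambda>\<omega>. \<bar>exp (- A j \<omega>)\<bar>) \<le> 1" for j by (simp add: prob_space)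
  show "integrable (count_space UNIV \<Otimes>\<^sub>M lborel) H"
    using integrable_H_laplace[of 0] by simp
  show "(\<lambda>j. expectation (\<lambda>\<omega>. exp (- A j \<omega>) ^ m * exp (- A j \<omega>))) \<longlonglongrightarrow> (\<integral>p. exp (- T p) ^ m * H p \<partial>(count_space UNIV \<Otimes>\<^sub>M lborel))" for m
  proof -
    have "exp (- A j \<omega>) ^ m * exp (- A j \<omega>) = exp (- ((sqrt (2 * (real m + 1)))\<^sup>2 / 2 * A j \<omega>))" for j \<omega>
      by (simp add: exp_of_nat_mult[symmetric] mult_exp_exp algebra_simps)
    moreover have "exp (- T p) ^ m = exp (- (real m * T p))" for p
      by (simp add: exp_of_nat_mult[symmetric])
    ultimately show ?thesis
      using laplace_A_tendsto[of "sqrt (2 * (real m + 1))"] integral_H_laplace[of "real m"] by simp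
  qed
qed (use A_nonneg T_nonneg g in auto)

text \<open>An exponential Chebyshev bound for the k-th stable variable: f is dominated by exp(c (x
  - T)), and the tilted kernel has an explicit mass.\<close>

lemma kernel_truncated_bound:
  fixes f :: "real \<Rightarrow> real"
  assumes f: "\<And>t. t \<ge> 0 \<Longrightarrow> 0 \<le> f t \<and> f t \<le> 1" "\<And>t. t \<ge> x \<Longrightarrow> f t = 0" and x: "x > 0"
    and [measurable]: "f \<in> borel_measurable borel"
  shows "integrable lborel (\<lambda>z. f (T (k, z)) * levy_kernel 0 z)"
    and "(\<integral>z. f (T (k, z)) * levy_kernel 0 z \<partial>lborel) \<le> exp (- (\<theta>\<^sup>2 / (8 * x))) * exp (- (\<theta>\<^sup>2 / x)) ^ k"
proof -
  have [measurable]: "(\<lambda>z. T (k, z)) \<in> borel_measurable lborel" by (simp add: T_def)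
  show int: "integrable lborel (\<lambda>z. f (T (k, z)) * levy_kernel 0 z)"
  proof (rule Bochner_Integration.integrable_bound[OF integrable_levy_kernel_0])
    show "AE z in lborel. norm (f (T (k, z)) * levy_kernel 0 z) \<le> norm (levy_kernel 0 z)"
      using f(1) T_nonneg by (intro AE_I2) (auto simp: abs_mult levy_kernel_nonneg intro!: mult_left_le_one_le)
  qed simp
  \<comment> \<open>The minimiser of c x - sqrt(2c) \<theta>/2, the exponent for k = 0. The same c
    gives the other terms a geometric factor.\<close>
  define c where "c = \<theta>\<^sup>2 / (8 * x\<^sup>2)"
  have c: "c \<ge> 0" by (simp add: c_def)
  have sq: "sqrt (2 * c) = \<theta> / (2 * x)"
    using \<theta> x by (intro real_sqrt_unique) (auto simp: c_def power_divide power_mult_distrib)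
  define b where "b = sqrt (2 * c) * ((2 * real k + 1 / 2) * \<theta>)"
  have b: "b > 0" unfolding b_def sq using \<theta> x by (intro mult_pos_pos divide_pos_pos add_nonneg_pos) auto
  have "(\<integral>z. f (T (k, z)) * levy_kernel 0 z \<partial>lborel) \<le> (\<integral>z. exp (c * x) * levy_kernel b z \<partial>lborel)"
  proof (rule integral_mono[OF int])
    show "integrable lborel (\<lambda>z. exp (c * x) * levy_kernel b z)" using integrable_levy_kernel[OF b] by simp
    fix z
    have "f (T (k, z)) \<le> exp (c * x) * exp (- (c * T (k, z)))"
    proof (cases "T (k, z) \<ge> x")
      case False
      then have "c * T (k, z) \<le> c * x" using c by (intro mult_left_mono) auto
      then have "1 \<le> exp (c * x) * exp (- (c * T (k, z)))" by (simp add: mult_exp_exp)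
      then show ?thesis using f(1)[OF T_nonneg[of "(k, z)"]] by linarith
    qed (simp add: f)
    then have "f (T (k, z)) * levy_kernel 0 z \<le> exp (c * x) * exp (- (c * T (k, z))) * levy_kernel 0 z"
      by (intro mult_right_mono levy_kernel_nonneg)
    also have "\<dots> = exp (c * x) * levy_kernel b z"
      using levy_kernel_laplace[OF c, of z "(2 * real k + 1 / 2) * \<theta>"] by (simp add: T_def b_def mult_ac)
    finally show "f (T (k, z)) * levy_kernel 0 z \<le> exp (c * x) * levy_kernel b z" .
  qed
  also have "\<dots> = exp (c * x) * exp (- b)" using integral_levy_kernel[OF b] by simp
  also have "\<dots> = exp (- (\<theta>\<^sup>2 / (8 * x))) * exp (- (\<theta>\<^sup>2 / x)) ^ k"
  proof -
    have "c * x - b = - (\<theta>\<^sup>2 / (8 * x)) - real k * (\<theta>\<^sup>2 / x)"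
      unfolding b_def sq unfolding c_def using x by (simp add: field_simps power2_eq_square)
    then show ?thesis by (simp add: exp_of_nat_mult[symmetric] mult_exp_exp)
  qed
  finally show "(\<integral>z. f (T (k, z)) * levy_kernel 0 z \<partial>lborel) \<le> exp (- (\<theta>\<^sup>2 / (8 * x))) * exp (- (\<theta>\<^sup>2 / x)) ^ k" .
qed

text \<open>Writing f t as g(exp(-t)) exp(-t) undoes the damping of \<open>H\<close> in each term.
  The term k = 0 is kept as it is; the terms k >= 1 form a geometric tail whose ratio q is
  exponentially small in 1/x.\<close>

lemma truncated_functional_limit:
  fixes f :: "real \<Rightarrow> real"
  assumes f: "\<And>t. t \<ge> 0 \<Longrightarrow> 0 \<le> f t \<and> f t \<le> 1" "\<And>t. t \<ge> x \<Longrightarrow> f t = 0" and x: "x > 0"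
    and fm: "f \<in> borel_measurable borel"
    and fg: "\<And>t. t \<ge> 0 \<Longrightarrow> f t = g (exp (- t)) * exp (- t)" and g: "continuous_on UNIV g"
  defines "q \<equiv> exp (- (\<theta>\<^sup>2 / x))"
  obtains \<Lambda> where "(\<lambda>j. expectation (\<lambda>\<omega>. f (A j \<omega>))) \<longlonglongrightarrow> \<Lambda>"
    "\<bar>\<Lambda> - sqrt 2 * (\<integral>z. f ((\<theta> / 2)\<^sup>2 / z\<^sup>2) * levy_kernel 0 z \<partial>lborel)\<bar> \<le> sqrt 2 * exp (- (\<theta>\<^sup>2 / (8 * x))) * (q / (1 - q))"
proof -
  define h where "h = (\<lambda>k. sqrt 2 * ((- 1 / 2) gchoose k) * (\<integral>z. f (T (k, z)) * levy_kernel 0 z \<partial>lborel))"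
  have e: "g (exp (- T (k, z))) * H (k, z) = sqrt 2 * ((- 1 / 2) gchoose k) * (f (T (k, z)) * levy_kernel 0 z)" for k z
    using fg[OF T_nonneg[of "(k, z)"]] by (simp add: H_def mult_ac)
  have K: "0 \<le> (\<integral>z. f (T (k, z)) * levy_kernel 0 z \<partial>lborel)" for k
    using f(1) T_nonneg levy_kernel_nonneg by (intro integral_nonneg_AE AE_I2) auto
  note kb = kernel_truncated_bound[OF f x fm]
  have q: "0 < q" "q < 1" using \<theta> x by (auto simp: q_def)
  define E where "E = sqrt 2 * exp (- (\<theta>\<^sup>2 / (8 * x)))"
  have absh: "sqrt 2 * \<bar>(- 1 / 2) gchoose k\<bar> * (\<integral>z. f (T (k, z)) * levy_kernel 0 z \<partial>lborel) \<le> E * q ^ k" for k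
  proof -
    have "\<bar>(- 1 / 2 :: real) gchoose k\<bar> * (\<integral>z. f (T (k, z)) * levy_kernel 0 z \<partial>lborel) \<le> 1 * (exp (- (\<theta>\<^sup>2 / (8 * x))) * q ^ k)"
      using kb(2)[of k] K[of k] abs_gbinomial_neg_half_le_1[of k] unfolding q_def by (intro mult_mono) auto
    then show ?thesis unfolding E_def by (simp add: mult.assoc)
  qed
  have geo: "summable (\<lambda>k. E * q ^ k)" using q by (intro summable_mult summable_geometric) auto
  have int: "integrable lborel (\<lambda>z. g (exp (- T (k, z))) * H (k, z))" for k
    unfolding e by (intro integrable_mult_right kb(1))
  have "(\<integral>z. \<bar>g (exp (- T (k, z))) * H (k, z)\<bar> \<partial>lborel) = sqrt 2 * \<bar>(- 1 / 2) gchoose k\<bar> * (\<integral>z. f (T (k, z)) * levy_kernel 0 z \<partial>lborel)" for k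
  proof -
    have "\<bar>g (exp (- T (k, z))) * H (k, z)\<bar> = sqrt 2 * \<bar>(- 1 / 2) gchoose k\<bar> * (f (T (k, z)) * levy_kernel 0 z)" for z
      unfolding e using f(1)[OF T_nonneg[of "(k, z)"]] by (simp add: abs_mult levy_kernel_nonneg)
    then show ?thesis using kb(1) by simp
  qed
  moreover have "summable (\<lambda>k. sqrt 2 * \<bar>(- 1 / 2) gchoose k\<bar> * (\<integral>z. f (T (k, z)) * levy_kernel 0 z \<partial>lborel))"
    using absh K by (intro summable_comparison_test'[OF geo]) (auto simp: abs_mult)
  ultimately have summ: "summable (\<lambda>k. \<integral>z. \<bar>g (exp (- T (k, z))) * H (k, z)\<bar> \<partial>lborel)" by simp
  define \<Lambda> where "\<Lambda> = (\<integral>p. g (exp (- T p)) * H p \<partial>(count_space UNIV \<Otimes>\<^sub>M lborel))"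
  have \<Lambda>: "\<Lambda> = (\<Sum>k. h k)"
    unfolding \<Lambda>_def using integral_count_space_lborel(2)[OF int summ] by (simp add: e h_def)
  have hb: "\<bar>h k\<bar> \<le> E * q ^ k" for k
    using absh[of k] K[of k] unfolding h_def by (simp add: abs_mult)
  have sh: "summable h" by (rule summable_comparison_test'[OF geo]) (use hb in auto)
  have "\<Lambda> - h 0 = (\<Sum>k. h (Suc k))" unfolding \<Lambda> using suminf_split_head[OF sh] by simp
  also have "\<bar>\<dots>\<bar> \<le> (\<Sum>k. E * q ^ Suc k)"
  proof -
    have g2: "summable (\<lambda>k. E * q ^ Suc k)" using geo by (subst summable_Suc_iff)
    have a2: "summable (\<lambda>k. \<bar>h (Suc k)\<bar>)"
      by (rule summable_comparison_test'[OF g2]) (simp only: real_norm_def abs_abs hb)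
    have "\<bar>\<Sum>k. h (Suc k)\<bar> \<le> (\<Sum>k. \<bar>h (Suc k)\<bar>)" by (rule summable_rabs[OF a2])
    also have "\<dots> \<le> (\<Sum>k. E * q ^ Suc k)" by (intro suminf_le hb a2 g2)
    finally show ?thesis .
  qed
  also have "\<dots> = E * (q / (1 - q))"
  proof -
    have "(\<lambda>k. E * q * q ^ k) sums (E * q * (1 / (1 - q)))" using q by (intro sums_mult geometric_sums) auto
    then show ?thesis by (simp add: sums_iff mult.assoc)
  qed
  finally have "\<bar>\<Lambda> - h 0\<bar> \<le> E * (q / (1 - q))" .
  moreover have "h 0 = sqrt 2 * (\<integral>z. f ((\<theta> / 2)\<^sup>2 / z\<^sup>2) * levy_kernel 0 z \<partial>lborel)"
    by (simp add: h_def T_def)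
  moreover have "(\<lambda>j. expectation (\<lambda>\<omega>. f (A j \<omega>))) \<longlonglongrightarrow> \<Lambda>"
    using functional_A_tendsto[OF g] fg[OF A_nonneg] unfolding \<Lambda>_def by simp
  ultimately show ?thesis using that[of \<Lambda>] by (simp add: E_def)
qed

end

section \<open>Truncated functionals and the terminal density\<close>

text \<open>Mills' ratio from exact derivatives. For the lower bound, -2 \<phi>(z) z/(1 + z^2), with
  \<phi> the normal density, has derivative 2 \<phi>(z) (1 - 2/(1 + z^2)^2), which is at most 2
  \<phi>(z); w >= 1 keeps it nonnegative.\<close>

lemma
  fixes w :: real
  shows integrable_levy_kernel_tail: "integrable lborel (\<lambda>z. levy_kernel 0 z * indicator {w..} z)"
    and levy_kernel_tail_upper: "w > 0 \<Longrightarrow> (\<integral>z. levy_kernel 0 z * indicator {w..} z \<partial>lborel) \<le> 2 * std_normal_density w / w"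
    and levy_kernel_tail_lower: "w \<ge> 1 \<Longrightarrow> 2 * std_normal_density w * (w / (1 + w\<^sup>2)) \<le> (\<integral>z. levy_kernel 0 z * indicator {w..} z \<partial>lborel)"
proof -
  show int: "integrable lborel (\<lambda>z. levy_kernel 0 z * indicator {w..} z)"
  proof (rule Bochner_Integration.integrable_bound[OF integrable_levy_kernel_0])
    show "AE z in lborel. norm (levy_kernel 0 z * indicator {w..} z) \<le> norm (levy_kernel 0 z)"
      by (intro AE_I2) (auto split: split_indicator)
  qed simp
  have eq: "ennreal (\<integral>z. levy_kernel 0 z * indicator {w..} z \<partial>lborel) = (\<integral>\<^sup>+z. ennreal (levy_kernel 0 z) * indicator {w..} z \<partial>lborel)"
    using nn_integral_eq_integral[OF int] levy_kernel_nonneg by (simp add: ennreal_mult' ennreal_indicator)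
  have der: "(std_normal_density has_real_derivative - (x * std_normal_density x)) (at x)" for x
    unfolding std_normal_density_def
    by (rule derivative_eq_intros refl | simp)+
  have lim0: "(std_normal_density \<longlongrightarrow> 0) at_top"
    unfolding std_normal_density_def by real_asymp
  have lim1: "((\<lambda>z. std_normal_density z * (z / (1 + z\<^sup>2))) \<longlongrightarrow> 0) at_top"
    unfolding std_normal_density_def by real_asymp
  show "(\<integral>z. levy_kernel 0 z * indicator {w..} z \<partial>lborel) \<le> 2 * std_normal_density w / w" if w: "w > 0"
  proof -
    define F where "F = (\<lambda>z. - 2 * std_normal_density z / w)"
    have "(\<integral>\<^sup>+z. ennreal (levy_kernel 0 z) * indicator {w..} z \<partial>lborel)
       \<le> (\<integral>\<^sup>+z. ennreal (2 * (z * std_normal_density z) / w) * indicator {w..} z \<partial>lborel)"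
    proof (intro nn_integral_mono)
      fix z
      show "ennreal (levy_kernel 0 z) * indicator {w..} z \<le> ennreal (2 * (z * std_normal_density z) / w) * indicator {w..} z"
      proof (cases "w \<le> z")
        case True
        then have "1 * std_normal_density z \<le> z / w * std_normal_density z"
          using w by (intro mult_right_mono) auto
        then show ?thesis using True w by (auto simp: levy_kernel_def intro!: ennreal_leI)
      qed simp
    qed
    also have "\<dots> = ennreal (0 - F w)"
    proof (rule nn_integral_FTC_atLeast)
      fix x assume x: "w \<le> x"
      show "(F has_real_derivative 2 * (x * std_normal_density x) / w) (at x)"
        unfolding F_def by (rule derivative_eq_intros der refl | use w in simp)+
      show "0 \<le> 2 * (x * std_normal_density x) / w" using w x by simp
    next
      have "((\<lambda>z. - 2 * std_normal_density z / w) \<longlongrightarrow> - 2 * 0 / w) at_top" using w by (intro tendsto_intros lim0) auto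
      then show "(F \<longlongrightarrow> 0) at_top" by (simp add: F_def)
    qed simp
    finally show ?thesis unfolding eq[symmetric] using w by (subst (asm) ennreal_le_iff) (auto simp: F_def)
  qed
  show "2 * std_normal_density w * (w / (1 + w\<^sup>2)) \<le> (\<integral>z. levy_kernel 0 z * indicator {w..} z \<partial>lborel)" if w: "w \<ge> 1"
  proof -
    define F where "F = (\<lambda>z. - 2 * (std_normal_density z * (z / (1 + z\<^sup>2))))"
    define f where "f = (\<lambda>z::real. 2 * std_normal_density z * (1 - 2 / (1 + z\<^sup>2)\<^sup>2))"
    have "ennreal (2 * std_normal_density w * (w / (1 + w\<^sup>2))) = ennreal (0 - F w)" by (simp add: F_def mult.assoc)
    also have "\<dots> = (\<integral>\<^sup>+z. ennreal (f z) * indicator {w..} z \<partial>lborel)"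
    proof (rule nn_integral_FTC_atLeast[symmetric])
      fix x assume x: "w \<le> x"
      have p: "1 + x\<^sup>2 > 0" by (simp add: add_pos_nonneg)
      have "((\<lambda>z. z / (1 + z\<^sup>2)) has_real_derivative (1 * (1 + x\<^sup>2) - x * (2 * x)) / ((1 + x\<^sup>2) * (1 + x\<^sup>2))) (at x)"
      proof (rule DERIV_divide)
        show "((\<lambda>z. 1 + z\<^sup>2) has_real_derivative 2 * x) (at x)" by (auto intro!: derivative_eq_intros)
      qed (use p in auto)
      from DERIV_cmult[OF DERIV_mult[OF der this], of "- 2"]
      have "(F has_real_derivative - 2 * (- (x * std_normal_density x) * (x / (1 + x\<^sup>2)) + (1 * (1 + x\<^sup>2) - x * (2 * x)) / ((1 + x\<^sup>2) * (1 + x\<^sup>2)) * std_normal_density x)) (at x)"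
        unfolding F_def .
      moreover have "- 2 * (- (x * std_normal_density x) * (x / (1 + x\<^sup>2)) + (1 * (1 + x\<^sup>2) - x * (2 * x)) / ((1 + x\<^sup>2) * (1 + x\<^sup>2)) * std_normal_density x) = f x"
      proof -
        have factor: "- 2 * (- (x * N) * X + Y * N) = 2 * N * (x * X - Y)" for N X Y :: real
          by (simp add: algebra_simps)
        define E where "E = 1 + x\<^sup>2"
        have E: "E \<noteq> 0" "x\<^sup>2 = E - 1" using p by (auto simp: E_def)
        have 1: "x * (x / E) = (x\<^sup>2 * E) / (E * E)" using E(1) by (simp add: power2_eq_square)
        have 2: "1 * E - x * (2 * x) = E - 2 * x\<^sup>2" by (simp add: power2_eq_square)
        have 3: "x\<^sup>2 * E - (E - 2 * x\<^sup>2) = E * E - 2" unfolding E(2) by (simp add: algebra_simps)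
        have "x * (x / E) - (1 * E - x * (2 * x)) / (E * E) = (E * E - 2) / (E * E)"
          unfolding 1 2 diff_divide_distrib[symmetric] 3 ..
        also have "\<dots> = 1 - 2 / E\<^sup>2"
          using E(1) by (simp add: diff_divide_distrib power2_eq_square)
        finally have "2 * std_normal_density x * (x * (x / E) - (1 * E - x * (2 * x)) / (E * E)) = 2 * std_normal_density x * (1 - 2 / E\<^sup>2)"
          by (simp only:)
        moreover have "- 2 * (- (x * std_normal_density x) * (x / E) + (1 * E - x * (2 * x)) / (E * E) * std_normal_density x)
          = 2 * std_normal_density x * (x * (x / E) - (1 * E - x * (2 * x)) / (E * E))"
          by (rule factor)
        ultimately show ?thesis unfolding f_def E_def[symmetric] by (simp only:)
      qed
      ultimately show "(F has_real_derivative f x) (at x)" by simp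
      have "1 * 1 \<le> x * x" using x w by (intro mult_mono) auto
      then have "2 * 2 \<le> (1 + x\<^sup>2) * (1 + x\<^sup>2)" by (intro mult_mono) (auto simp: power2_eq_square)
      then have "2 / (1 + x\<^sup>2)\<^sup>2 \<le> 1" using p by (simp add: power2_eq_square divide_le_eq)
      then show "0 \<le> f x" unfolding f_def by simp
    next
      have "(F \<longlongrightarrow> - 2 * 0) at_top" unfolding F_def by (intro tendsto_intros lim1)
      then show "(F \<longlongrightarrow> 0) at_top" by simp
      show "f \<in> borel_measurable borel" unfolding f_def by measurable
    qed
    also have "\<dots> \<le> (\<integral>\<^sup>+z. ennreal (levy_kernel 0 z) * indicator {w..} z \<partial>lborel)"
    proof (intro nn_integral_mono)
      fix z
      show "ennreal (f z) * indicator {w..} z \<le> ennreal (levy_kernel 0 z) * indicator {w..} z"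
      proof (cases "w \<le> z")
        case True
        have "2 * std_normal_density z * (1 - 2 / (1 + z\<^sup>2)\<^sup>2) \<le> 2 * std_normal_density z * 1"
          by (intro mult_left_mono) auto
        then show ?thesis using True w by (auto simp: levy_kernel_def f_def intro!: ennreal_leI)
      qed simp
    qed
    finally show ?thesis unfolding eq[symmetric]
      by (subst (asm) ennreal_le_iff) (auto intro!: integral_nonneg_AE AE_I2 mult_nonneg_nonneg levy_kernel_nonneg)
  qed
qed

text \<open>Interpolates linearly in exp(-t) rather than in t, which makes it a continuous function
  of exp(-t), as the moment argument requires.\<close>

definition cutoff :: "real \<Rightarrow> real \<Rightarrow> real \<Rightarrow> real" where
  "cutoff x1 x2 t = max 0 (min 1 ((exp (- t) - exp (- x2)) / (exp (- x1) - exp (- x2))))"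

lemma cutoff_bounds: "0 \<le> cutoff x1 x2 t" "cutoff x1 x2 t \<le> 1"
  by (auto simp: cutoff_def)

lemma cutoff_eq_0: "x1 < x2 \<Longrightarrow> x2 \<le> t \<Longrightarrow> cutoff x1 x2 t = 0"
  by (auto simp: cutoff_def divide_le_0_iff)

lemma cutoff_eq_1: "x1 < x2 \<Longrightarrow> t \<le> x1 \<Longrightarrow> cutoff x1 x2 t = 1"
  by (auto simp: cutoff_def)

lemma continuous_on_cutoff: "x1 < x2 \<Longrightarrow> continuous_on UNIV (cutoff x1 x2)"
  unfolding cutoff_def by (intro continuous_intros) auto

lemma measurable_cutoff [measurable]: "cutoff x1 x2 \<in> borel_measurable borel"
  unfolding cutoff_def by measurable

definition cutoff_exp :: "real \<Rightarrow> real \<Rightarrow> real \<Rightarrow> real" where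
  "cutoff_exp x1 x2 u = max 0 (min 1 ((u - exp (- x2)) / (exp (- x1) - exp (- x2))))"

lemma continuous_on_cutoff_exp: "x1 < x2 \<Longrightarrow> continuous_on UNIV (cutoff_exp x1 x2)"
  unfolding cutoff_exp_def by (intro continuous_intros) auto

lemma cutoff_eq_cutoff_exp: "cutoff x1 x2 t = cutoff_exp x1 x2 (exp (- t))"
  by (simp add: cutoff_def cutoff_exp_def)

text \<open>Divides out the damping factor. Where the maximum differs from exp(-t) the cutoff is 0,
  and the lower bound exp(-x2) of the denominator keeps the quotient continuous on the whole
  line.\<close>

lemma cutoff_eq_weighted:
  assumes "x1 < x2"
  shows "cutoff x1 x2 t = cutoff_exp x1 x2 (exp (- t)) / max (exp (- t)) (exp (- x2)) * exp (- t)"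
proof (cases "x2 \<le> t")
  case True
  then have "cutoff x1 x2 t = 0" by (rule cutoff_eq_0[OF assms])
  then show ?thesis by (simp add: cutoff_eq_cutoff_exp[symmetric])
next
  case False
  then have "max (exp (- t)) (exp (- x2)) = exp (- t)" by simp
  then show ?thesis by (simp only: cutoff_eq_cutoff_exp) simp
qed

text \<open>The first summand bounds the terms k >= 1 of the stable expansion, the second the effect
  of the terminal factor. Both multiply the exponential of the main term, whose own prefactor is of
  order sqrt x, larger than x.\<close>

definition small_ball_remainder :: "real \<Rightarrow> real \<Rightarrow> real \<Rightarrow> real" where
  "small_ball_remainder \<theta> c x = exp (- (\<theta>\<^sup>2 / (8 * x))) *
    (sqrt 2 * (exp (- (\<theta>\<^sup>2 / x)) / (1 - exp (- (\<theta>\<^sup>2 / x)))) + 16 * c * x / \<theta>)"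

text \<open>Convexity of exp between 0 and u. The gained factor r is what makes the terminal
  correction small.\<close>

lemma exp_mult_minus_one_le:
  fixes u :: real
  assumes "0 \<le> r" "r \<le> 1"
  shows "exp (r * u) - 1 \<le> r * (exp u - 1)"
  using convex_onD[OF exp_convex, of r 0 u] assms by (simp add: algebra_simps)

section \<open>The terminal factor of the density and small ball bounds under the tilted law\<close>

context flat_walk_sequence begin

definition Yend :: "nat \<Rightarrow> 'a \<Rightarrow> real" where
  "Yend j \<omega> = flat_walk.Y (\<zeta> j) (a j) (Suc j) \<omega>"

text \<open>The terminal moment bound at its optimal l = \<theta>/(2x), times the fraction 4c/l that
  c/2 makes of l/8.\<close>

definition correction :: "real \<Rightarrow> real \<Rightarrow> nat \<Rightarrow> real" where
  "correction c x j = (let l = \<theta> / (2 * x) in 4 * c / l * (exp ((l\<^sup>2 + flat_walk.B lo hi L l * (\<sigma> j)\<^sup>2) * x / 2) *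
      (2 * exp (- (l * flat_walk.\<tau> (a j) (\<sigma> j) (Suc j) / 2)))))"

lemma measurable_Yend [measurable]: "Yend j \<in> borel_measurable M"
  unfolding Yend_def using flat_walk.measurable_Y[OF walk, of "Suc j" j] by (simp add: eta_contract_eq)

lemma correction_tendsto:
  assumes x: "x > 0"
  shows "correction c x \<longlonglongrightarrow> 16 * c * x / \<theta> * exp (- (\<theta>\<^sup>2 / (8 * x)))"
proof -
  define l where "l = \<theta> / (2 * x)"
  have "(\<lambda>j. 4 * c / l * (exp ((l\<^sup>2 + flat_walk.B lo hi L l * (\<sigma> j)\<^sup>2) * x / 2) * (2 * exp (- (l * flat_walk.\<tau> (a j) (\<sigma> j) (Suc j) / 2)))))
     \<longlonglongrightarrow> 4 * c / l * (exp ((l\<^sup>2 + 0) * x / 2) * (2 * exp (- (l * \<theta> / 2))))"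
    by (intro tendsto_intros mesh_sq horizon) auto
  moreover have "4 * c / l * (exp ((l\<^sup>2 + 0) * x / 2) * (2 * exp (- (l * \<theta> / 2)))) = 16 * c * x / \<theta> * exp (- (\<theta>\<^sup>2 / (8 * x)))"
  proof -
    have "l\<^sup>2 * x / 2 - l * \<theta> / 2 = - (\<theta>\<^sup>2 / (8 * x))"
      using x by (simp add: l_def field_simps power2_eq_square)
    then have "exp (l\<^sup>2 * x / 2) * exp (- (l * \<theta> / 2)) = exp (- (\<theta>\<^sup>2 / (8 * x)))"
      by (simp add: mult_exp_exp)
    moreover have "4 * c / l * 2 = 16 * c * x / \<theta>" using x \<theta> by (simp add: l_def field_simps)
    moreover have "4 * c / l * (exp ((l\<^sup>2 + 0) * x / 2) * (2 * exp (- (l * \<theta> / 2)))) = (4 * c / l * 2) * (exp (l\<^sup>2 * x / 2) * exp (- (l * \<theta> / 2)))"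
      by simp
    ultimately show ?thesis by (simp only:)
  qed
  moreover have "correction c x = (\<lambda>j. 4 * c / l * (exp ((l\<^sup>2 + flat_walk.B lo hi L l * (\<sigma> j)\<^sup>2) * x / 2) * (2 * exp (- (l * flat_walk.\<tau> (a j) (\<sigma> j) (Suc j) / 2)))))"
    by (rule ext) (simp only: correction_def l_def[symmetric] Let_def)
  ultimately show ?thesis by (simp only:)
qed

text \<open>The hypothesis on c and x says that 4c/l <= 1 for l = \<theta>/(2x). Convexity of exp
  then trades the exponent c/2 for l/8 at the price of this small factor, and the terminal moment
  estimate applies once the mesh is fine.\<close>

lemma terminal_correction:
  assumes x: "x > 0" and c: "0 \<le> c" "4 * c * (2 * x) \<le> \<theta>"
  shows "\<forall>\<^sub>F j in sequentially. integrable M (\<lambda>\<omega>. (exp (c / 2 * (Yend j \<omega>)\<^sup>2) - 1) * indicator {..x} (A j \<omega>)) \<and>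
    expectation (\<lambda>\<omega>. (exp (c / 2 * (Yend j \<omega>)\<^sup>2) - 1) * indicator {..x} (A j \<omega>)) \<le> correction c x j"
proof -
  define l where "l = \<theta> / (2 * x)"
  have l: "l > 0" using x \<theta> by (simp add: l_def)
  have cl: "4 * c / l \<le> 1" "0 \<le> 4 * c / l" using c x \<theta> by (auto simp: l_def field_simps)
  have "\<forall>\<^sub>F j in sequentially. l * hi\<^sup>2 * (\<sigma> j)\<^sup>2 < 1 / 4"
    by (rule order_tendstoD[OF mesh_sq]) simp
  then show ?thesis
  proof eventually_elim
    case (elim j)
    define V where "V = exp ((l\<^sup>2 + flat_walk.B lo hi L l * (\<sigma> j)\<^sup>2) * x / 2) * (2 * exp (- (l * flat_walk.\<tau> (a j) (\<sigma> j) (Suc j) / 2)))"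
    define G where "G = (\<lambda>\<omega>. (exp (c / 2 * (Yend j \<omega>)\<^sup>2) - 1) * indicator {..x} (A j \<omega>))"
    have [measurable]: "G \<in> borel_measurable M" unfolding G_def by measurable
    have G0: "G \<omega> \<ge> 0" for \<omega> unfolding G_def using c by (intro mult_nonneg_nonneg) auto
    have corr: "correction c x j = 4 * c / l * V" by (simp add: correction_def l_def[symmetric] Let_def V_def)
    have V0: "V \<ge> 0" by (simp add: V_def)
    have pt: "G \<omega> \<le> 4 * c / l * (exp (l / 8 * (Yend j \<omega>)\<^sup>2) * indicator {..x} (A j \<omega>))" for \<omega>
    proof (cases "A j \<omega> \<le> x")
      case True
      have "c / 2 * (Yend j \<omega>)\<^sup>2 = 4 * c / l * (l / 8 * (Yend j \<omega>)\<^sup>2)" using l by simp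
      then have "exp (c / 2 * (Yend j \<omega>)\<^sup>2) - 1 \<le> 4 * c / l * (exp (l / 8 * (Yend j \<omega>)\<^sup>2) - 1)"
        using exp_mult_minus_one_le[OF cl(2,1)] by metis
      also have "\<dots> \<le> 4 * c / l * exp (l / 8 * (Yend j \<omega>)\<^sup>2)" using cl by (intro mult_left_mono) auto
      finally show ?thesis using True by (simp add: G_def)
    qed (simp add: G_def)
    have "(\<integral>\<^sup>+\<omega>. ennreal (G \<omega>) \<partial>M) \<le> (\<integral>\<^sup>+\<omega>. ennreal (4 * c / l) * ennreal (exp (l / 8 * (Yend j \<omega>)\<^sup>2) * indicator {..x} (A j \<omega>)) \<partial>M)"
      using pt cl by (intro nn_integral_mono) (simp add: ennreal_mult'[symmetric] ennreal_leI)
    also have "\<dots> = ennreal (4 * c / l) * (\<integral>\<^sup>+\<omega>. ennreal (exp (l / 8 * (Yend j \<omega>)\<^sup>2) * indicator {..x} (A j \<omega>)) \<partial>M)"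
      by (rule nn_integral_cmult) measurable
    also have "\<dots> \<le> ennreal (4 * c / l) * ennreal V"
      using flat_walk.terminal_moment_estimate[OF walk[of j] l] elim
      unfolding V_def Yend_def A_def by (intro mult_left_mono) (auto simp: mult_ac)
    also have "\<dots> = ennreal (correction c x j)" unfolding corr by (rule ennreal_mult[symmetric, OF cl(2) V0])
    finally have le: "(\<integral>\<^sup>+\<omega>. ennreal (G \<omega>) \<partial>M) \<le> ennreal (correction c x j)" .
    have int: "integrable M G"
      using le G0 by (intro integrableI_nonneg) (auto simp: le_less_trans[OF _ ennreal_less_top])
    have "ennreal (expectation G) \<le> ennreal (correction c x j)"
      using le nn_integral_eq_integral[OF int] G0 by simp
    moreover have "0 \<le> correction c x j" unfolding corr by (rule mult_nonneg_nonneg[OF cl(2) V0])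
    ultimately have "expectation G \<le> correction c x j" by (subst (asm) ennreal_le_iff)
    with int show ?case by (simp add: G_def)
  qed
qed

text \<open>Where f does not vanish, A is below x, so the part K A of the log density costs only a
  factor exp(K x) or its inverse. The terminal part is removed additively through \<open>G\<close>,
  whose expectation is bounded by the correction.\<close>

lemma tilted_functional_bounds:
  fixes f :: "real \<Rightarrow> real" and D :: "nat \<Rightarrow> 'a \<Rightarrow> real"
  assumes f: "\<And>t. 0 \<le> f t \<and> f t \<le> 1" "\<And>t. t \<ge> x \<Longrightarrow> f t = 0" and x: "x > 0"
    and fm [measurable]: "f \<in> borel_measurable borel"
    and c: "0 \<le> c" "4 * c * (2 * x) \<le> \<theta>" and K: "K \<ge> 0"
    and Dm [measurable]: "\<And>j. D j \<in> borel_measurable M"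
    and D: "\<And>j \<omega>. \<bar>D j \<omega>\<bar> \<le> K * A j \<omega> + c / 2 * (Yend j \<omega>)\<^sup>2"
    and limD: "(\<lambda>j. expectation (\<lambda>\<omega>. f (A j \<omega>) * exp (D j \<omega>))) \<longlonglongrightarrow> d"
    and int: "\<And>j. integrable M (\<lambda>\<omega>. exp (D j \<omega>))"
    and lim: "(\<lambda>j. expectation (\<lambda>\<omega>. f (A j \<omega>))) \<longlonglongrightarrow> e"
  shows "d \<le> exp (K * x) * (e + 16 * c * x / \<theta> * exp (- (\<theta>\<^sup>2 / (8 * x))))"
    and "exp (- (K * x)) * (e - 16 * c * x / \<theta> * exp (- (\<theta>\<^sup>2 / (8 * x)))) \<le> d"
proof -
  define G where "G = (\<lambda>j \<omega>. (exp (c / 2 * (Yend j \<omega>)\<^sup>2) - 1) * indicator {..x} (A j \<omega>))"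
  have [measurable]: "G j \<in> borel_measurable M" for j unfolding G_def by measurable
  have G0: "G j \<omega> \<ge> 0" for j \<omega> unfolding G_def using c by (intro mult_nonneg_nonneg) auto
  have intf: "integrable M (\<lambda>\<omega>. f (A j \<omega>))" for j
    using f(1) by (intro integrable_const_bound[where B = 1]) auto
  have intfD: "integrable M (\<lambda>\<omega>. f (A j \<omega>) * exp (D j \<omega>))" for j
    using f(1) by (intro Bochner_Integration.integrable_bound[OF int[of j]] AE_I2) (auto simp: abs_mult mult_left_le_one_le)
  have up: "f (A j \<omega>) * exp (D j \<omega>) \<le> exp (K * x) * (f (A j \<omega>) + G j \<omega>)"
    and low: "exp (- (K * x)) * (f (A j \<omega>) - G j \<omega>) \<le> f (A j \<omega>) * exp (D j \<omega>)" for j \<omega>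
  proof -
    let ?u = "c / 2 * (Yend j \<omega>)\<^sup>2" and ?f = "f (A j \<omega>)"
    have u: "?u \<ge> 0" using c by simp
    have "?f * exp (D j \<omega>) \<le> exp (K * x) * (?f + G j \<omega>) \<and> exp (- (K * x)) * (?f - G j \<omega>) \<le> ?f * exp (D j \<omega>)"
    proof (cases "A j \<omega> \<ge> x")
      case True
      then show ?thesis using f(2)[OF True] G0[of j \<omega>] by simp
    next
      case False
      then have G: "G j \<omega> = exp ?u - 1" by (simp add: G_def)
      have KA: "K * A j \<omega> \<le> K * x" using K False by (intro mult_left_mono) auto
      have f01: "0 \<le> ?f" "?f \<le> 1" using f(1) by auto
      have "exp (D j \<omega>) \<le> exp (K * x) * exp ?u" using D[of j \<omega>] KA by (simp add: mult_exp_exp)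
      then have "?f * exp (D j \<omega>) \<le> ?f * (exp (K * x) * exp ?u)" using f01 by (intro mult_left_mono)
      also have "\<dots> = exp (K * x) * (?f + ?f * (exp ?u - 1))" by (simp add: algebra_simps)
      also have "\<dots> \<le> exp (K * x) * (?f + 1 * (exp ?u - 1))"
        using f01 u by (intro mult_left_mono add_left_mono mult_right_mono) auto
      finally have 1: "?f * exp (D j \<omega>) \<le> exp (K * x) * (?f + G j \<omega>)" by (simp add: G)
      have "exp (- (K * x)) * exp (- ?u) \<le> exp (D j \<omega>)" using D[of j \<omega>] KA by (simp add: mult_exp_exp)
      then have 2: "?f * (exp (- (K * x)) * exp (- ?u)) \<le> ?f * exp (D j \<omega>)" using f01 by (intro mult_left_mono)
      \<comment> \<open>The loss 1 - exp(-u) is at most the gain exp u - 1, so the same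
        \<open>G\<close> serves the lower bound.\<close>
      have "1 - exp (- ?u) \<le> ?u" using exp_ge_add_one_self[of "- ?u"] by simp
      also have "\<dots> \<le> exp ?u - 1" using exp_ge_add_one_self[of ?u] by linarith
      finally have "?f * (1 - exp (- ?u)) \<le> 1 * (exp ?u - 1)" using f01 u by (intro mult_mono) auto
      then have "?f - G j \<omega> \<le> ?f * exp (- ?u)" by (simp add: G algebra_simps)
      then have "exp (- (K * x)) * (?f - G j \<omega>) \<le> exp (- (K * x)) * (?f * exp (- ?u))" by (intro mult_left_mono) auto
      then have "exp (- (K * x)) * (?f - G j \<omega>) \<le> ?f * exp (D j \<omega>)"
        by (rule order_trans[OF _ 2[unfolded mult.left_commute[of ?f]]])
      with 1 show ?thesis by simp
    qed
    then show "?f * exp (D j \<omega>) \<le> exp (K * x) * (?f + G j \<omega>)" "exp (- (K * x)) * (?f - G j \<omega>) \<le> ?f * exp (D j \<omega>)" by auto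
  qed
  have L1: "(\<lambda>j. exp (K * x) * (expectation (\<lambda>\<omega>. f (A j \<omega>)) + correction c x j)) \<longlonglongrightarrow> exp (K * x) * (e + 16 * c * x / \<theta> * exp (- (\<theta>\<^sup>2 / (8 * x))))"
    by (intro tendsto_intros lim correction_tendsto x)
  have L2: "(\<lambda>j. exp (- (K * x)) * (expectation (\<lambda>\<omega>. f (A j \<omega>)) - correction c x j)) \<longlonglongrightarrow> exp (- (K * x)) * (e - 16 * c * x / \<theta> * exp (- (\<theta>\<^sup>2 / (8 * x))))"
    by (intro tendsto_intros lim correction_tendsto x)
  have ev: "\<forall>\<^sub>F j in sequentially. integrable M (G j) \<and> expectation (G j) \<le> correction c x j"
    using terminal_correction[OF x c] by (simp add: G_def)
  have "\<forall>\<^sub>F j in sequentially. expectation (\<lambda>\<omega>. f (A j \<omega>) * exp (D j \<omega>)) \<le> exp (K * x) * (expectation (\<lambda>\<omega>. f (A j \<omega>)) + correction c x j)"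
    using ev
  proof eventually_elim
    case (elim j)
    then have "expectation (\<lambda>\<omega>. f (A j \<omega>) * exp (D j \<omega>)) \<le> expectation (\<lambda>\<omega>. exp (K * x) * (f (A j \<omega>) + G j \<omega>))"
      using up intf intfD by (intro integral_mono integrable_mult_right Bochner_Integration.integrable_add) auto
    also have "\<dots> = exp (K * x) * (expectation (\<lambda>\<omega>. f (A j \<omega>)) + expectation (G j))"
      using elim intf by simp
    also have "\<dots> \<le> exp (K * x) * (expectation (\<lambda>\<omega>. f (A j \<omega>)) + correction c x j)"
      using elim by (intro mult_left_mono add_left_mono) auto
    finally show ?case .
  qed
  then show "d \<le> exp (K * x) * (e + 16 * c * x / \<theta> * exp (- (\<theta>\<^sup>2 / (8 * x))))"
    by (rule tendsto_le[OF sequentially_bot L1 limD])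
  have "\<forall>\<^sub>F j in sequentially. exp (- (K * x)) * (expectation (\<lambda>\<omega>. f (A j \<omega>)) - correction c x j) \<le> expectation (\<lambda>\<omega>. f (A j \<omega>) * exp (D j \<omega>))"
    using ev
  proof eventually_elim
    case (elim j)
    have "exp (- (K * x)) * (expectation (\<lambda>\<omega>. f (A j \<omega>)) - correction c x j) \<le> exp (- (K * x)) * (expectation (\<lambda>\<omega>. f (A j \<omega>)) - expectation (G j))"
      using elim by (intro mult_left_mono diff_left_mono) auto
    also have "\<dots> = expectation (\<lambda>\<omega>. exp (- (K * x)) * (f (A j \<omega>) - G j \<omega>))"
      using elim intf by simp
    also have "\<dots> \<le> expectation (\<lambda>\<omega>. f (A j \<omega>) * exp (D j \<omega>))"
      using low intf intfD elim by (intro integral_mono integrable_mult_right Bochner_Integration.integrable_diff) auto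
    finally show ?case .
  qed
  then show "exp (- (K * x)) * (e - 16 * c * x / \<theta> * exp (- (\<theta>\<^sup>2 / (8 * x)))) \<le> d"
    by (rule tendsto_le[OF sequentially_bot limD L2])
qed

text \<open>For k = 0 the event T <= x is z >= \<theta>/(2 sqrt x), so the cutoff lies between the
  indicators of the half-lines from w1 and from w2, where Mills' bounds apply.\<close>

lemma cutoff_functional_bounds:
  fixes D :: "nat \<Rightarrow> 'a \<Rightarrow> real"
  assumes x: "0 < x1" "x1 < x2"
    and c: "0 \<le> c" "4 * c * (2 * x2) \<le> \<theta>" and K: "K \<ge> 0"
    and Dm: "\<And>j. D j \<in> borel_measurable M"
    and D: "\<And>j \<omega>. \<bar>D j \<omega>\<bar> \<le> K * A j \<omega> + c / 2 * (Yend j \<omega>)\<^sup>2"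
    and limD: "(\<lambda>j. expectation (\<lambda>\<omega>. cutoff x1 x2 (A j \<omega>) * exp (D j \<omega>))) \<longlonglongrightarrow> d"
    and int: "\<And>j. integrable M (\<lambda>\<omega>. exp (D j \<omega>))"
  defines "w1 \<equiv> \<theta> / (2 * sqrt x1)" and "w2 \<equiv> \<theta> / (2 * sqrt x2)"
  shows "d \<le> exp (K * x2) * (sqrt 2 * (2 * std_normal_density w2 / w2) + small_ball_remainder \<theta> c x2)"
    and "w1 \<ge> 1 \<Longrightarrow> exp (- (K * x2)) * (sqrt 2 * (2 * std_normal_density w1 * (w1 / (1 + w1\<^sup>2))) - small_ball_remainder \<theta> c x2) \<le> d"
proof -
  have x2: "x2 > 0" using x by simp
  have w: "w1 > 0" "w2 > 0" using x x2 \<theta> by (auto simp: w1_def w2_def)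
  have g: "continuous_on UNIV (\<lambda>u. cutoff_exp x1 x2 u / max u (exp (- x2)))"
    using x by (intro continuous_intros continuous_on_cutoff_exp) (auto simp: max_def)
  have f: "\<And>t. 0 \<le> cutoff x1 x2 t \<and> cutoff x1 x2 t \<le> 1" "\<And>t. t \<ge> x2 \<Longrightarrow> cutoff x1 x2 t = 0"
    using cutoff_bounds cutoff_eq_0[OF x(2)] by auto
  obtain e where e: "(\<lambda>j. expectation (\<lambda>\<omega>. cutoff x1 x2 (A j \<omega>))) \<longlonglongrightarrow> e"
    "\<bar>e - sqrt 2 * (\<integral>z. cutoff x1 x2 ((\<theta> / 2)\<^sup>2 / z\<^sup>2) * levy_kernel 0 z \<partial>lborel)\<bar> \<le> sqrt 2 * exp (- (\<theta>\<^sup>2 / (8 * x2))) * (exp (- (\<theta>\<^sup>2 / x2)) / (1 - exp (- (\<theta>\<^sup>2 / x2))))"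
    by (rule truncated_functional_limit[of "cutoff x1 x2" x2, OF f x2 measurable_cutoff cutoff_eq_weighted[OF x(2)] g])
  define I where "I = (\<integral>z. cutoff x1 x2 ((\<theta> / 2)\<^sup>2 / z\<^sup>2) * levy_kernel 0 z \<partial>lborel)"
  have intI: "integrable lborel (\<lambda>z. cutoff x1 x2 ((\<theta> / 2)\<^sup>2 / z\<^sup>2) * levy_kernel 0 z)"
  proof (rule Bochner_Integration.integrable_bound[OF integrable_levy_kernel_0])
    show "AE z in lborel. norm (cutoff x1 x2 ((\<theta> / 2)\<^sup>2 / z\<^sup>2) * levy_kernel 0 z) \<le> norm (levy_kernel 0 z)"
      using cutoff_bounds by (intro AE_I2) (auto simp: abs_mult levy_kernel_nonneg intro!: mult_left_le_one_le)
  qed simp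
  have sq: "(\<theta> / 2)\<^sup>2 = w1\<^sup>2 * x1" "(\<theta> / 2)\<^sup>2 = w2\<^sup>2 * x2"
    using x x2 by (auto simp: w1_def w2_def power_divide power_mult_distrib)
  have ptu: "cutoff x1 x2 ((\<theta> / 2)\<^sup>2 / z\<^sup>2) * levy_kernel 0 z \<le> levy_kernel 0 z * indicator {w2..} z" for z
  proof (cases "w2 \<le> z")
    case True
    then show ?thesis using cutoff_bounds levy_kernel_nonneg by (simp add: mult_left_le_one_le)
  next
    case False
    show ?thesis
    proof (cases "z > 0")
      case True
      then have "z\<^sup>2 \<le> w2\<^sup>2" using False by (intro power_mono) auto
      then have "x2 * z\<^sup>2 \<le> (\<theta> / 2)\<^sup>2" using x2 by (simp add: sq(2) mult.commute)
      then have "x2 \<le> (\<theta> / 2)\<^sup>2 / z\<^sup>2" using True by (simp add: pos_le_divide_eq)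
      then show ?thesis using cutoff_eq_0[OF x(2)] False by simp
    qed (use False in \<open>simp add: levy_kernel_def\<close>)
  qed
  have ptl: "levy_kernel 0 z * indicator {w1..} z \<le> cutoff x1 x2 ((\<theta> / 2)\<^sup>2 / z\<^sup>2) * levy_kernel 0 z" for z
  proof (cases "w1 \<le> z")
    case True
    then have "w1\<^sup>2 \<le> z\<^sup>2" "z > 0" using w by (auto intro: power_mono)
    then have "(\<theta> / 2)\<^sup>2 \<le> x1 * z\<^sup>2" using x by (simp add: sq(1) mult.commute)
    then have "(\<theta> / 2)\<^sup>2 / z\<^sup>2 \<le> x1" using \<open>z > 0\<close> by (simp add: pos_divide_le_eq)
    then show ?thesis using cutoff_eq_1[OF x(2)] True by simp
  qed (simp add: cutoff_bounds levy_kernel_nonneg)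
  have Iu: "I \<le> 2 * std_normal_density w2 / w2"
    using integral_mono[OF intI integrable_levy_kernel_tail ptu] levy_kernel_tail_upper[OF w(2)] unfolding I_def by linarith
  have Il: "2 * std_normal_density w1 * (w1 / (1 + w1\<^sup>2)) \<le> I" if "w1 \<ge> 1"
    using integral_mono[OF integrable_levy_kernel_tail intI ptl] levy_kernel_tail_lower[OF that] unfolding I_def by linarith
  note tb = tilted_functional_bounds[OF f x2 measurable_cutoff c K Dm D limD int e(1)]
  have rem: "small_ball_remainder \<theta> c x2 = sqrt 2 * exp (- (\<theta>\<^sup>2 / (8 * x2))) * (exp (- (\<theta>\<^sup>2 / x2)) / (1 - exp (- (\<theta>\<^sup>2 / x2)))) + 16 * c * x2 / \<theta> * exp (- (\<theta>\<^sup>2 / (8 * x2)))"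
    by (simp add: small_ball_remainder_def distrib_left mult_ac)
  have "sqrt 2 * I \<le> sqrt 2 * (2 * std_normal_density w2 / w2)" using Iu by (intro mult_left_mono) auto
  then have "e + 16 * c * x2 / \<theta> * exp (- (\<theta>\<^sup>2 / (8 * x2))) \<le> sqrt 2 * (2 * std_normal_density w2 / w2) + small_ball_remainder \<theta> c x2"
    using e(2) unfolding rem I_def[symmetric] by linarith
  then have "exp (K * x2) * (e + 16 * c * x2 / \<theta> * exp (- (\<theta>\<^sup>2 / (8 * x2)))) \<le> exp (K * x2) * (sqrt 2 * (2 * std_normal_density w2 / w2) + small_ball_remainder \<theta> c x2)"
    by (intro mult_left_mono) auto
  with tb(1) show "d \<le> exp (K * x2) * (sqrt 2 * (2 * std_normal_density w2 / w2) + small_ball_remainder \<theta> c x2)"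
    by (rule order_trans)
  assume w1: "w1 \<ge> 1"
  have "sqrt 2 * (2 * std_normal_density w1 * (w1 / (1 + w1\<^sup>2))) \<le> sqrt 2 * I" using Il[OF w1] by (intro mult_left_mono) auto
  then have "sqrt 2 * (2 * std_normal_density w1 * (w1 / (1 + w1\<^sup>2))) - small_ball_remainder \<theta> c x2 \<le> e - 16 * c * x2 / \<theta> * exp (- (\<theta>\<^sup>2 / (8 * x2)))"
    using e(2) unfolding rem I_def[symmetric] by linarith
  then have "exp (- (K * x2)) * (sqrt 2 * (2 * std_normal_density w1 * (w1 / (1 + w1\<^sup>2))) - small_ball_remainder \<theta> c x2) \<le> exp (- (K * x2)) * (e - 16 * c * x2 / \<theta> * exp (- (\<theta>\<^sup>2 / (8 * x2))))"
    by (intro mult_left_mono) auto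
  then show "exp (- (K * x2)) * (sqrt 2 * (2 * std_normal_density w1 * (w1 / (1 + w1\<^sup>2))) - small_ball_remainder \<theta> c x2) \<le> d"
    using tb(2) by (rule order_trans)
qed

end

section \<open>Regularity of the weight\<close>

lemma second_difference_bound:
  fixes f f' f'' :: "real \<Rightarrow> real"
  assumes f: "\<And>t. t \<in> {0..1} \<Longrightarrow> (f has_real_derivative f' t) (at t within {0..1})"
    and f': "\<And>t. t \<in> {0..1} \<Longrightarrow> (f' has_real_derivative f'' t) (at t within {0..1})"
    and K: "\<And>t. t \<in> {0..1} \<Longrightarrow> \<bar>f'' t\<bar> \<le> K"
    and h: "h \<ge> 0" "0 \<le> t - h" "t + h \<le> 1"
  shows "\<bar>f (t + h) - 2 * f t + f (t - h)\<bar> \<le> K * h\<^sup>2"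
proof -
  have lip: "\<bar>f' s - f' u\<bar> \<le> K * \<bar>s - u\<bar>" if "s \<in> {0..1}" "u \<in> {0..1}" for s u
    using field_differentiable_bound[OF convex_real_interval(5)[of 0 1] f', of K s u] K that by auto
  let ?S = "{t - h..t}"
  have "norm ((f (t + h) - f t) - (f (t - h + h) - f (t - h))) \<le> (K * h) * norm (t - (t - h))"
  proof (rule field_differentiable_bound[where S = ?S and f = "\<lambda>s. f (s + h) - f s" and f' = "\<lambda>s. f' (s + h) - f' s"])
    fix s assume s: "s \<in> ?S"
    have 1: "(f has_real_derivative f' (s + h)) (at (s + h) within ((\<lambda>s. s + h) ` ?S))"
      by (rule has_field_derivative_subset[OF f]) (use s h in auto)
    have 2: "((\<lambda>s. s + h) has_real_derivative 1) (at s within ?S)"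
      by (auto intro!: derivative_eq_intros)
    have 3: "(f has_real_derivative f' s) (at s within ?S)"
      by (rule has_field_derivative_subset[OF f]) (use s h in auto)
    show "((\<lambda>s. f (s + h) - f s) has_real_derivative f' (s + h) - f' s) (at s within ?S)"
      using DERIV_diff[OF DERIV_image_chain[OF 1 2] 3] by (simp add: o_def)
    show "norm (f' (s + h) - f' s) \<le> K * h"
      using lip[of "s + h" s] s h by simp
  qed (use h in auto)
  then show ?thesis using h by (simp add: power2_eq_square algebra_simps)
qed

lemma continuous_on_unit_interval_bounded:
  fixes g :: "real \<Rightarrow> real"
  assumes "continuous_on {0..1} g"
  obtains C where "C > 0" "\<And>t. t \<in> {0..1} \<Longrightarrow> \<bar>g t\<bar> \<le> C"
proof -
  have "bounded (g ` {0..1})"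
    by (rule compact_imp_bounded[OF compact_continuous_image[OF assms compact_Icc]])
  then obtain C where "C > 0" "\<forall>x\<in>g ` {0..1}. norm x \<le> C" unfolding bounded_pos by blast
  then show ?thesis using that[of C] by auto
qed

text \<open>The quarter power scales the walk and its reciprocal enters the log density: Lipschitz
  bounds control the clock and the terminal coefficient, the second difference of the reciprocal
  controls the bulk. The bound K on that difference is where the second derivative of \<psi>
  enters.\<close>

lemma quarter_power_regularity:
  fixes \<psi> :: "real \<Rightarrow> real"
  assumes pos: "\<And>t. t \<in> {0..1} \<Longrightarrow> \<psi> t > 0"
    and C2: "twice_continuously_differentiable_on {0..1} \<psi>"
  obtains lo hi L K where "lo > 0" "L \<ge> 0" "K \<ge> 0"
    "\<And>t. t \<in> {0..1} \<Longrightarrow> lo \<le> \<psi> t powr (1/4) \<and> \<psi> t powr (1/4) \<le> hi"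
    "\<And>s t. s \<in> {0..1} \<Longrightarrow> t \<in> {0..1} \<Longrightarrow> \<bar>\<psi> s powr (1/4) - \<psi> t powr (1/4)\<bar> \<le> L * \<bar>s - t\<bar>"
    "\<And>s t. s \<in> {0..1} \<Longrightarrow> t \<in> {0..1} \<Longrightarrow> \<bar>1 / \<psi> s powr (1/4) - 1 / \<psi> t powr (1/4)\<bar> \<le> L * \<bar>s - t\<bar>"
    "\<And>t h. h \<ge> 0 \<Longrightarrow> 0 \<le> t - h \<Longrightarrow> t + h \<le> 1 \<Longrightarrow>
      \<bar>1 / \<psi> (t + h) powr (1/4) - 2 * (1 / \<psi> t powr (1/4)) + 1 / \<psi> (t - h) powr (1/4)\<bar> \<le> K * h\<^sup>2"
proof -
  obtain p q where p: "\<And>t. t \<in> {0..1} \<Longrightarrow> (\<psi> has_real_derivative p t) (at t within {0..1})"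
    and q: "\<And>t. t \<in> {0..1} \<Longrightarrow> (p has_real_derivative q t) (at t within {0..1})" and qc: "continuous_on {0..1} q"
    using C2 unfolding twice_continuously_differentiable_on_def by blast
  have \<psi>c: "continuous_on {0..1} \<psi>" and pc: "continuous_on {0..1} p"
    by (rule DERIV_continuous_on[OF p], assumption) (rule DERIV_continuous_on[OF q])
  have powc: "continuous_on {0..1} (\<lambda>t. \<psi> t powr e)" for e
    by (intro continuous_intros \<psi>c) (use pos in force)
  have D: "((\<lambda>t. \<psi> t powr e) has_real_derivative (e * \<psi> t powr (e - 1) * p t)) (at t within {0..1})" if t: "t \<in> {0..1}" for e t
    by (rule derivative_eq_intros p[OF t] refl | use pos[OF t] in simp)+
  define \<beta> where "\<beta> = (\<lambda>t. \<psi> t powr (- (1/4)))"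
  define \<beta>' where "\<beta>' = (\<lambda>t. - (1/4) * \<psi> t powr (- (1/4) - 1) * p t)"
  define \<beta>'' where "\<beta>'' = (\<lambda>t. - (1/4) * ((- (1/4) - 1) * \<psi> t powr (- (1/4) - 1 - 1) * p t) * p t + (- (1/4) * \<psi> t powr (- (1/4) - 1)) * q t)"
  have \<beta>: "1 / \<psi> t powr (1/4) = \<beta> t" for t
    by (simp add: \<beta>_def powr_minus_divide)
  have d1: "(\<beta> has_real_derivative \<beta>' t) (at t within {0..1})" if "t \<in> {0..1}" for t
    unfolding \<beta>_def \<beta>'_def by (rule D[OF that])
  have d2: "(\<beta>' has_real_derivative \<beta>'' t) (at t within {0..1})" if t: "t \<in> {0..1}" for t
  proof -
    have "(\<beta>' has_real_derivative (- (1/4) * ((- (1/4) - 1) * \<psi> t powr (- (1/4) - 1 - 1) * p t)) * p t + q t * (- (1/4) * \<psi> t powr (- (1/4) - 1))) (at t within {0..1})"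
      unfolding \<beta>'_def by (rule DERIV_mult[OF DERIV_cmult[OF D[OF t]] q[OF t]])
    then show ?thesis by (simp add: \<beta>''_def mult.commute)
  qed
  have "continuous_on {0..1} \<beta>''" unfolding \<beta>''_def by (intro continuous_intros powc pc qc)
  then obtain K where K: "K > 0" "\<And>t. t \<in> {0..1} \<Longrightarrow> \<bar>\<beta>'' t\<bar> \<le> K" by (rule continuous_on_unit_interval_bounded) (rule that; blast)
  have "continuous_on {0..1} \<beta>'" unfolding \<beta>'_def by (intro continuous_intros powc pc)
  then obtain L1 where L1: "L1 > 0" "\<And>t. t \<in> {0..1} \<Longrightarrow> \<bar>\<beta>' t\<bar> \<le> L1" by (rule continuous_on_unit_interval_bounded) (rule that; blast)
  have "continuous_on {0..1} (\<lambda>t. 1/4 * \<psi> t powr (1/4 - 1) * p t)" by (intro continuous_intros powc pc)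
  then obtain L2 where L2: "L2 > 0" "\<And>t. t \<in> {0..1} \<Longrightarrow> \<bar>1/4 * \<psi> t powr (1/4 - 1) * p t\<bar> \<le> L2" by (rule continuous_on_unit_interval_bounded) (rule that; blast)
  obtain hi where hi: "hi > 0" "\<And>t. t \<in> {0..1} \<Longrightarrow> \<bar>\<psi> t powr (1/4)\<bar> \<le> hi" by (rule continuous_on_unit_interval_bounded[OF powc[of "1/4"]]) (rule that; blast)
  have "continuous_on {0..1} \<beta>" unfolding \<beta>_def by (rule powc)
  then obtain m where m: "m > 0" "\<And>t. t \<in> {0..1} \<Longrightarrow> \<bar>\<beta> t\<bar> \<le> m" by (rule continuous_on_unit_interval_bounded) (rule that; blast)
  show ?thesis
  proof (rule that[of "1 / m" "max L1 L2" K hi])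
    show "1 / m > 0" "max L1 L2 \<ge> 0" "K \<ge> 0" using m L1 K by auto
    show "1 / m \<le> \<psi> t powr (1/4) \<and> \<psi> t powr (1/4) \<le> hi" if t: "t \<in> {0..1}" for t
    proof
      have "\<psi> t powr (1/4) > 0" using pos[OF t] by simp
      moreover have "1 / \<psi> t powr (1/4) \<le> m" using m(2)[OF t] unfolding \<beta> by simp
      ultimately show "1 / m \<le> \<psi> t powr (1/4)" using m(1) by (simp add: field_simps)
      show "\<psi> t powr (1/4) \<le> hi" using hi(2)[OF t] by simp
    qed
    have n1: "norm (\<beta>' t) \<le> max L1 L2" if "t \<in> {0..1}" for t
      unfolding real_norm_def by (rule order_trans[OF L1(2)[OF that] max.cobounded1])
    have n2: "norm (1/4 * \<psi> t powr (1/4 - 1) * p t) \<le> max L1 L2" if "t \<in> {0..1}" for t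
      unfolding real_norm_def by (rule order_trans[OF L2(2)[OF that] max.cobounded2])
    have cv: "convex {0..1::real}" by (rule convex_real_interval)
    show "\<bar>\<psi> s powr (1/4) - \<psi> t powr (1/4)\<bar> \<le> max L1 L2 * \<bar>s - t\<bar>" if "s \<in> {0..1}" "t \<in> {0..1}" for s t
    proof -
      have "norm (\<psi> s powr (1/4) - \<psi> t powr (1/4)) \<le> max L1 L2 * norm (s - t)"
        by (rule field_differentiable_bound[OF cv D n2]) (use that in auto)
      then show ?thesis by simp
    qed
    show "\<bar>1 / \<psi> s powr (1/4) - 1 / \<psi> t powr (1/4)\<bar> \<le> max L1 L2 * \<bar>s - t\<bar>" if "s \<in> {0..1}" "t \<in> {0..1}" for s t
    proof -
      have "norm (\<beta> s - \<beta> t) \<le> max L1 L2 * norm (s - t)"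
        by (rule field_differentiable_bound[OF cv d1 n1]) (use that in auto)
      then show ?thesis by (simp add: \<beta>)
    qed
    show "\<bar>1 / \<psi> (t + h) powr (1/4) - 2 * (1 / \<psi> t powr (1/4)) + 1 / \<psi> (t - h) powr (1/4)\<bar> \<le> K * h\<^sup>2"
      if "h \<ge> 0" "0 \<le> t - h" "t + h \<le> 1" for t h
      unfolding \<beta> by (rule second_difference_bound[OF d1 d2 K(2) that])
  qed
qed

text \<open>The factor sqrt pi * \<theta> / (4 * \<epsilon>) is the reciprocal of the prefactor of
  the main term. Relative to it the series tail is exponentially small and the terminal correction
  of order \<epsilon>.\<close>

lemma small_ball_remainder_ratio_tendsto:
  fixes c \<theta> :: real
  assumes \<theta>: "\<theta> > 0"
  shows "((\<lambda>\<epsilon>. (sqrt 2 * (exp (- (\<theta>\<^sup>2 / \<epsilon>\<^sup>2)) / (1 - exp (- (\<theta>\<^sup>2 / \<epsilon>\<^sup>2)))) + 16 * c * \<epsilon>\<^sup>2 / \<theta>)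
    * (sqrt pi * \<theta> / (4 * \<epsilon>))) \<longlongrightarrow> 0) (at_right 0)"
proof -
  define Q where "Q = (\<lambda>\<epsilon>. exp (- (\<theta>\<^sup>2 / \<epsilon>\<^sup>2)) / (1 - exp (- (\<theta>\<^sup>2 / \<epsilon>\<^sup>2))))"
  have 1: "((\<lambda>\<epsilon>. Q \<epsilon> / \<epsilon>) \<longlongrightarrow> 0) (at_right 0)"
    unfolding Q_def using \<theta> by real_asymp
  have "((\<lambda>\<epsilon>. sqrt 2 * (sqrt pi * \<theta> / 4) * (Q \<epsilon> / \<epsilon>) + 16 * c / \<theta> * (sqrt pi * \<theta> / 4) * \<epsilon>) \<longlongrightarrow>
     sqrt 2 * (sqrt pi * \<theta> / 4) * 0 + 16 * c / \<theta> * (sqrt pi * \<theta> / 4) * 0) (at_right 0)"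
    by (intro tendsto_intros 1)
  moreover have "\<forall>\<^sub>F \<epsilon> in at_right 0. sqrt 2 * (sqrt pi * \<theta> / 4) * (Q \<epsilon> / \<epsilon>) + 16 * c / \<theta> * (sqrt pi * \<theta> / 4) * \<epsilon>
    = (sqrt 2 * Q \<epsilon> + 16 * c * \<epsilon>\<^sup>2 / \<theta>) * (sqrt pi * \<theta> / (4 * \<epsilon>))"
    using eventually_at_right_less[of 0]
    by eventually_elim (use \<theta> in \<open>simp add: field_simps power2_eq_square\<close>)
  ultimately have "((\<lambda>\<epsilon>. (sqrt 2 * Q \<epsilon> + 16 * c * \<epsilon>\<^sup>2 / \<theta>) * (sqrt pi * \<theta> / (4 * \<epsilon>))) \<longlongrightarrow> 0) (at_right 0)"
    by (simp add: tendsto_cong)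
  then show ?thesis unfolding Q_def .
qed

section \<open>Small ball probabilities\<close>

lemma
  assumes "standard_brownian_motion_on {0..1} M W"
  shows indep_grid_increments: "prob_space.indep_vars M (\<lambda>_. borel) (grid_increment W (Suc j)) {..<Suc j}"
    and distributed_grid_increment: "k < Suc j \<Longrightarrow> distributed M lborel (grid_increment W (Suc j) k) (normal_density 0 (sqrt (1 / real (Suc j))))"
proof -
  note bm = assms[unfolded standard_brownian_motion_on_def]
  have grid: "real i / real (Suc j) \<in> {0..1}" if "i \<le> Suc j" for i using that by auto
  have "\<forall>(n::nat) (t :: nat \<Rightarrow> real). (\<forall>i\<le>n. t i \<in> {0..1}) \<longrightarrow> (\<forall>i<n. t i < t (Suc i)) \<longrightarrow>
        prob_space.indep_vars M (\<lambda>_. borel) (\<lambda>i \<omega>. W (t (Suc i)) \<omega> - W (t i) \<omega>) {..<n}"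
    using bm by blast
  from this[rule_format, of "Suc j" "\<lambda>i. real i / real (Suc j)"]
  have "prob_space.indep_vars M (\<lambda>_. borel) (\<lambda>i \<omega>. W (real (Suc i) / real (Suc j)) \<omega> - W (real i / real (Suc j)) \<omega>) {..<Suc j}"
    using grid by (simp add: divide_strict_right_mono)
  moreover have "grid_increment W (Suc j) = (\<lambda>i \<omega>. W (real (Suc i) / real (Suc j)) \<omega> - W (real i / real (Suc j)) \<omega>)"
    by (intro ext) (simp only: grid_increment_def)
  ultimately show "prob_space.indep_vars M (\<lambda>_. borel) (grid_increment W (Suc j)) {..<Suc j}" by (simp only:)
  assume k: "k < Suc j"
  have "\<forall>s\<in>{0..1}. \<forall>t\<in>{0..1}. s < t \<longrightarrow>
        distributed M lborel (\<lambda>\<omega>. W t \<omega> - W s \<omega>) (normal_density 0 (sqrt (t - s)))"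
    using bm by blast
  moreover have "real k / real (Suc j) < real (Suc k) / real (Suc j)" by (simp add: divide_strict_right_mono)
  ultimately have "distributed M lborel (\<lambda>\<omega>. W (real (Suc k) / real (Suc j)) \<omega> - W (real k / real (Suc j)) \<omega>)
      (normal_density 0 (sqrt (real (Suc k) / real (Suc j) - real k / real (Suc j))))"
    using grid[of k] grid[of "Suc k"] k by (simp del: of_nat_Suc)
  moreover have "real (Suc k) / real (Suc j) - real k / real (Suc j) = 1 / real (Suc j)"
    by (simp add: diff_divide_distrib[symmetric])
  moreover have "grid_increment W (Suc j) k = (\<lambda>\<omega>. W (real (Suc k) / real (Suc j)) \<omega> - W (real k / real (Suc j)) \<omega>)"
    by (intro ext) (simp only: grid_increment_def)
  ultimately show "distributed M lborel (grid_increment W (Suc j) k) (normal_density 0 (sqrt (1 / real (Suc j))))"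
    by (simp only:)
qed

text \<open>By the Lipschitz bound, products of neighbouring values differ from squares by a
  multiple of the mesh, so the final clock time is a Riemann sum up to a vanishing error.\<close>

lemma horizon_tendsto:
  fixes \<alpha> :: "real \<Rightarrow> real"
  assumes b: "\<And>t. t \<in> {0..1} \<Longrightarrow> \<bar>\<alpha> t\<bar> \<le> hi"
    and lip: "\<And>s t. s \<in> {0..1} \<Longrightarrow> t \<in> {0..1} \<Longrightarrow> \<bar>\<alpha> s - \<alpha> t\<bar> \<le> L * \<bar>s - t\<bar>"
    and \<alpha>: "continuous_on {0..1} \<alpha>" and L: "L \<ge> 0"
  shows "(\<lambda>j. \<Sum>i<Suc j. (sqrt (1 / real (Suc j)))\<^sup>2 * (\<alpha> (real i / real (Suc j)) * \<alpha> (real (Suc i) / real (Suc j))))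
    \<longlonglongrightarrow> (LBINT t:{0..1}. (\<alpha> t)\<^sup>2)"
proof -
  have hi: "hi \<ge> 0" using b[of 0] by simp
  have sq: "(sqrt (1 / real (Suc j)))\<^sup>2 = 1 / real (Suc j)" for j by simp
  have 1: "(\<lambda>j. (\<Sum>i<Suc j. (\<alpha> (real i / real (Suc j)))\<^sup>2) / real (Suc j)) \<longlonglongrightarrow> (LBINT t:{0..1}. (\<alpha> t)\<^sup>2)"
    by (rule riemann_sum_tendsto) (intro continuous_intros \<alpha>)
  have bd: "\<bar>(\<Sum>i<Suc j. 1 / real (Suc j) * (\<alpha> (real i / real (Suc j)) * \<alpha> (real (Suc i) / real (Suc j))))
      - (\<Sum>i<Suc j. (\<alpha> (real i / real (Suc j)))\<^sup>2) / real (Suc j)\<bar> \<le> hi * L / real (Suc j)" for j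
  proof -
    let ?n = "real (Suc j)"
    have e: "1 / ?n * (\<alpha> (real i / ?n) * \<alpha> (real (Suc i) / ?n)) - (\<alpha> (real i / ?n))\<^sup>2 / ?n = 1 / ?n * (\<alpha> (real i / ?n) * (\<alpha> (real (Suc i) / ?n) - \<alpha> (real i / ?n)))" for i
      by (simp add: power2_eq_square right_diff_distrib diff_divide_distrib del: of_nat_Suc)
    have "(\<Sum>i<Suc j. 1 / ?n * (\<alpha> (real i / ?n) * \<alpha> (real (Suc i) / ?n))) - (\<Sum>i<Suc j. (\<alpha> (real i / ?n))\<^sup>2) / ?n
      = (\<Sum>i<Suc j. 1 / ?n * (\<alpha> (real i / ?n) * (\<alpha> (real (Suc i) / ?n) - \<alpha> (real i / ?n))))"
      unfolding sum_divide_distrib sum_subtractf[symmetric] e ..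
    also have "\<bar>\<dots>\<bar> \<le> (\<Sum>i<Suc j. 1 / ?n * (hi * (L * (1 / ?n))))"
    proof (intro order_trans[OF sum_abs] sum_mono)
      fix i assume "i \<in> {..<Suc j}"
      then have g: "real i / ?n \<in> {0..1}" "real (Suc i) / ?n \<in> {0..1}" by auto
      have "\<bar>real (Suc i) / ?n - real i / ?n\<bar> = 1 / ?n" by (simp add: diff_divide_distrib[symmetric])
      then have "\<bar>\<alpha> (real (Suc i) / ?n) - \<alpha> (real i / ?n)\<bar> \<le> L * (1 / ?n)" using lip[OF g(2,1)] by simp
      then have "\<bar>\<alpha> (real i / ?n)\<bar> * \<bar>\<alpha> (real (Suc i) / ?n) - \<alpha> (real i / ?n)\<bar> \<le> hi * (L * (1 / ?n))"
        using b[OF g(1)] hi by (intro mult_mono) auto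
      then have "1 / ?n * (\<bar>\<alpha> (real i / ?n)\<bar> * \<bar>\<alpha> (real (Suc i) / ?n) - \<alpha> (real i / ?n)\<bar>) \<le> 1 / ?n * (hi * (L * (1 / ?n)))"
        by (intro mult_left_mono) auto
      then show "\<bar>1 / ?n * (\<alpha> (real i / ?n) * (\<alpha> (real (Suc i) / ?n) - \<alpha> (real i / ?n)))\<bar> \<le> 1 / ?n * (hi * (L * (1 / ?n)))"
        by (simp only: abs_mult) simp
    qed
    also have "\<dots> = hi * L / ?n" by (simp add: sum_constant)
    finally show ?thesis .
  qed
  have "(\<lambda>j. hi * L / real (Suc j)) \<longlonglongrightarrow> 0" by real_asymp
  then have "(\<lambda>j. (\<Sum>i<Suc j. 1 / real (Suc j) * (\<alpha> (real i / real (Suc j)) * \<alpha> (real (Suc i) / real (Suc j))))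
      - (\<Sum>i<Suc j. (\<alpha> (real i / real (Suc j)))\<^sup>2) / real (Suc j)) \<longlonglongrightarrow> 0"
    by (rule Lim_null_comparison[rotated]) (use bd in \<open>auto simp only: real_norm_def intro!: always_eventually\<close>)
  from tendsto_add[OF this 1] show ?thesis unfolding sq by simp
qed

text \<open>Only expectations of continuous functions pass to the limit, so probabilities are
  trapped by a cutoff between x1 and x2. The factor \<kappa> comes from the substitution and is the
  same for every mesh, as it involves only the end values of the quarter power.\<close>

lemma reflected_norm_distribution_bounds:
  fixes M :: "'a measure" and W :: "real \<Rightarrow> 'a \<Rightarrow> real" and \<psi> :: "real \<Rightarrow> real" and \<theta> :: real
  assumes bm: "standard_brownian_motion_on {0..1} M W"
    and pos: "\<And>t. t \<in> {0..1} \<Longrightarrow> \<psi> t > 0"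
    and C2: "twice_continuously_differentiable_on {0..1} \<psi>"
    and \<theta>: "\<theta> = (LBINT t:{0..1}. sqrt (\<psi> t))"
  defines "X \<equiv> \<lambda>\<omega>. LBINT t:{0..1}. (running_sup W t \<omega> - W t \<omega>)\<^sup>2 * \<psi> t"
    and "\<kappa> \<equiv> sqrt (\<psi> 1 powr (1/4) / \<psi> 0 powr (1/4))"
  obtains K c where "\<theta> > 0" "K \<ge> 0" "c \<ge> 0"
    "\<And>x1 x2. 0 < x1 \<Longrightarrow> x1 < x2 \<Longrightarrow> 4 * c * (2 * x2) \<le> \<theta> \<Longrightarrow>
      \<kappa> * measure M {\<omega> \<in> space M. X \<omega> \<le> x1} \<le> exp (K * x2) *
        (sqrt 2 * (2 * std_normal_density (\<theta> / (2 * sqrt x2)) / (\<theta> / (2 * sqrt x2))) + small_ball_remainder \<theta> c x2)"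
    "\<And>x1 x2. 0 < x1 \<Longrightarrow> x1 < x2 \<Longrightarrow> 4 * c * (2 * x2) \<le> \<theta> \<Longrightarrow> \<theta> / (2 * sqrt x1) \<ge> 1 \<Longrightarrow>
      exp (- (K * x2)) * (sqrt 2 * (2 * std_normal_density (\<theta> / (2 * sqrt x1)) * (\<theta> / (2 * sqrt x1) / (1 + (\<theta> / (2 * sqrt x1))\<^sup>2)))
        - small_ball_remainder \<theta> c x2) \<le> \<kappa> * measure M {\<omega> \<in> space M. X \<omega> \<le> x2}"
proof (rule quarter_power_regularity[OF pos C2], assumption)
  fix lo hi L K :: real
  assume lo: "lo > 0" and L: "L \<ge> 0" and K: "K \<ge> 0"
    and bnd: "\<And>t. t \<in> {0..1} \<Longrightarrow> lo \<le> \<psi> t powr (1/4) \<and> \<psi> t powr (1/4) \<le> hi"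
    and lip: "\<And>s t. s \<in> {0..1} \<Longrightarrow> t \<in> {0..1} \<Longrightarrow> \<bar>\<psi> s powr (1/4) - \<psi> t powr (1/4)\<bar> \<le> L * \<bar>s - t\<bar>"
    and lip': "\<And>s t. s \<in> {0..1} \<Longrightarrow> t \<in> {0..1} \<Longrightarrow> \<bar>1 / \<psi> s powr (1/4) - 1 / \<psi> t powr (1/4)\<bar> \<le> L * \<bar>s - t\<bar>"
    and sd: "\<And>t h. h \<ge> 0 \<Longrightarrow> 0 \<le> t - h \<Longrightarrow> t + h \<le> 1 \<Longrightarrow>
      \<bar>1 / \<psi> (t + h) powr (1/4) - 2 * (1 / \<psi> t powr (1/4)) + 1 / \<psi> (t - h) powr (1/4)\<bar> \<le> K * h\<^sup>2"
  have ps: "prob_space M"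
    and Wc: "\<And>\<omega>. \<omega> \<in> space M \<Longrightarrow> continuous_on {0..1} (\<lambda>t. W t \<omega>)"
    using bm unfolding standard_brownian_motion_on_def by blast+
  interpret prob_space M by (rule ps)
  have \<psi>c: "continuous_on {0..1} \<psi>"
    using C2 unfolding twice_continuously_differentiable_on_def by (blast intro: DERIV_continuous_on)
  define \<alpha> where "\<alpha> = (\<lambda>t. \<psi> t powr (1/4))"
  have \<alpha>c: "continuous_on {0..1} \<alpha>"
    unfolding \<alpha>_def by (intro continuous_intros \<psi>c) (use pos in force)
  \<comment> \<open>The fourth power is the weight seen by the plain walk, the square is the speed
    of the clock of the transformed one.\<close>
  have \<alpha>4: "(\<alpha> t)^4 = \<psi> t" and \<alpha>2: "(\<alpha> t)\<^sup>2 = sqrt (\<psi> t)" if "t \<in> {0..1}" for t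
    using pos[OF that] by (simp_all add: \<alpha>_def powr_power powr_half_sqrt)
  have \<theta>\<alpha>: "\<theta> = (LBINT t:{0..1}. (\<alpha> t)\<^sup>2)"
    unfolding \<theta> by (rule set_lebesgue_integral_cong) (auto simp: \<alpha>2)
  define \<zeta> where "\<zeta> = (\<lambda>j. grid_increment W (Suc j))"
  define a where "a = (\<lambda>j k. \<alpha> (real k / real (Suc j)))"
  define \<sigma> where "\<sigma> = (\<lambda>j. sqrt (1 / real (Suc j)))"
  have \<sigma>2: "(\<sigma> j)\<^sup>2 = 1 / real (Suc j)" and \<sigma>pos: "\<sigma> j > 0" for j by (simp_all add: \<sigma>_def)
  have grid: "real k / real (Suc j) \<in> {0..1}" if "k \<le> Suc j" for j k using that by auto
  have gap: "real (Suc k) / real (Suc j) - real k / real (Suc j) = (\<sigma> j)\<^sup>2" for j k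
    unfolding \<sigma>2 by (simp add: diff_divide_distrib[symmetric])
  have walk: "flat_walk M (\<zeta> j) (a j) (\<sigma> j) lo hi L j" for j
  proof unfold_locales
    show "indep_vars (\<lambda>_. borel) (\<zeta> j) {..<Suc j}"
      unfolding \<zeta>_def by (rule indep_grid_increments[OF bm])
    show "distributed M lborel (\<zeta> j k) (normal_density 0 (\<sigma> j))" if "k < Suc j" for k
      unfolding \<zeta>_def \<sigma>_def by (rule distributed_grid_increment[OF bm that])
    show "lo \<le> a j k \<and> a j k \<le> hi" if "k \<le> Suc j" for k
      unfolding a_def \<alpha>_def by (rule bnd[OF grid[OF that]])
    show "\<bar>a j (Suc k) - a j k\<bar> \<le> L * (\<sigma> j)\<^sup>2" if "k \<le> j" for k
    proof -
      have "\<bar>a j (Suc k) - a j k\<bar> \<le> L * \<bar>real (Suc k) / real (Suc j) - real k / real (Suc j)\<bar>"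
        unfolding a_def \<alpha>_def by (rule lip[OF grid grid]) (use that in auto)
      then show ?thesis unfolding gap by simp
    qed
  qed (use lo L \<sigma>pos in auto)
  have \<theta>pos: "\<theta> > 0"
  proof -
    have "lo\<^sup>2 = (LBINT t:{0..1::real}. lo\<^sup>2)" by (simp add: set_integral_const)
    also have "\<dots> \<le> \<theta>"
      unfolding \<theta>\<alpha>
    proof (rule set_integral_mono)
      show "set_integrable lborel {0..1} (\<lambda>t. (\<alpha> t)\<^sup>2)"
        by (rule borel_integrable_atLeastAtMost') (intro continuous_intros \<alpha>c)
      show "set_integrable lborel {0..1::real} (\<lambda>t. lo\<^sup>2)"
        by (rule borel_integrable_atLeastAtMost') (intro continuous_intros)
      show "lo\<^sup>2 \<le> (\<alpha> t)\<^sup>2" if "t \<in> {0..1}" for t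
        using bnd[OF that] lo by (intro power_mono) (auto simp: \<alpha>_def)
    qed
    finally show ?thesis using lo by (simp add: less_le_trans[of 0 "lo\<^sup>2"])
  qed
  have horizon: "(\<lambda>j. flat_walk.\<tau> (a j) (\<sigma> j) (Suc j)) \<longlonglongrightarrow> \<theta>"
    unfolding flat_walk.\<tau>_def[OF walk] unfolding \<theta>\<alpha> a_def \<sigma>_def
    by (rule horizon_tendsto[where hi = hi and L = L]) (use bnd lip L \<alpha>c lo in \<open>auto simp: \<alpha>_def\<close>)
  interpret F: flat_walk_sequence M \<zeta> a \<sigma> lo hi L \<theta>
  proof (intro flat_walk_sequence.intro flat_walk_sequence_axioms.intro ps walk \<theta>pos horizon)
    show "\<sigma> \<longlonglongrightarrow> 0" unfolding \<sigma>_def by real_asymp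
  qed
  define Z where "Z = (\<lambda>j k \<omega>. reflected_walk (\<lambda>_. 1) (\<lambda>i. \<zeta> j i \<omega>) k)"
  define Y where "Y = (\<lambda>j k \<omega>. reflected_walk (\<lambda>k. sqrt (a j k * a j (Suc k))) (\<lambda>i. \<zeta> j i \<omega>) k)"
  define b where "b = (\<lambda>j k. 1 / a j k)"
  define D where "D = (\<lambda>j \<omega>. ((\<Sum>k<j. b j (Suc k) * (b j (Suc (Suc k)) - 2 * b j (Suc k) + b j k) / (\<sigma> j)\<^sup>2 * (Y j (Suc k) \<omega>)\<^sup>2)
              - b j (Suc j) * (b j (Suc j) - b j j) / (\<sigma> j)\<^sup>2 * (Y j (Suc j) \<omega>)\<^sup>2) / 2)"
  define Xn where "Xn = (\<lambda>j \<omega>. (\<sigma> j)\<^sup>2 * (\<Sum>k<j. (a j (Suc k)) ^ 4 * (Z j (Suc k) \<omega>)\<^sup>2))"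
  have Ym [measurable]: "Y j k \<in> borel_measurable M" and Zm [measurable]: "Z j k \<in> borel_measurable M" if "k \<le> Suc j" for j k
  proof -
    have z: "\<zeta> j i \<in> borel_measurable M" if "i < Suc j" for i
      using flat_walk.ind[OF walk[of j]] that by (auto simp: indep_vars_def)
    show "Y j k \<in> borel_measurable M" "Z j k \<in> borel_measurable M"
      unfolding Y_def Z_def using that by (auto intro!: measurable_reflected_walk z)
  qed
  have Dm: "D j \<in> borel_measurable M" for j
    unfolding D_def by (intro borel_measurable_divide borel_measurable_diff borel_measurable_sum borel_measurable_times borel_measurable_power borel_measurable_const Ym) auto
  have Xnm: "Xn j \<in> borel_measurable M" for j
    unfolding Xn_def by (intro borel_measurable_sum borel_measurable_times borel_measurable_power borel_measurable_const Zm) auto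
  have Xn0: "Xn j \<omega> \<ge> 0" for j \<omega>
    unfolding Xn_def by (intro mult_nonneg_nonneg sum_nonneg) auto
  have FA: "F.A j \<omega> = (\<sigma> j)\<^sup>2 * (\<Sum>k<j. (a j (Suc k))\<^sup>2 * (Y j (Suc k) \<omega>)\<^sup>2)" for j \<omega>
    unfolding F.A_def flat_walk.A_def[OF walk] flat_walk.Y_def[OF walk] Y_def ..
  have FY: "F.Yend j \<omega> = Y j (Suc j) \<omega>" for j \<omega>
    unfolding F.Yend_def flat_walk.Y_def[OF walk] Y_def ..
  have apos: "a j k > 0" if "k \<le> Suc j" for j k
    using flat_walk.a_pos[OF walk that] .
  have ends: "a j (Suc j) = \<alpha> 1" "a j 0 = \<alpha> 0" for j by (simp_all add: a_def)
  have \<kappa>: "\<kappa> = sqrt (\<alpha> 1 / \<alpha> 0)" by (simp add: \<kappa>_def \<alpha>_def)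
  have \<kappa>0: "\<kappa> \<ge> 0" unfolding \<kappa> by (simp add: \<alpha>_def)
  have lap: "(\<integral>\<^sup>+\<omega>. ennreal (exp (D j \<omega> - real m * F.A j \<omega>)) \<partial>M) = ennreal \<kappa> * (\<integral>\<^sup>+\<omega>. ennreal (exp (- real m * Xn j \<omega>)) \<partial>M)" for j m
    unfolding D_def FA Xn_def \<kappa> ends(1)[of j, symmetric] ends(2)[of j, symmetric] Y_def Z_def b_def
    by (rule discrete_liouville_girsanov[OF flat_walk.ind[OF walk] flat_walk.dist[OF walk] \<sigma>pos apos]) auto
  note transfer = transfer_exp_functional[OF F.measurable_A Xnm Dm F.A_nonneg Xn0 \<kappa>0 lap]
  \<comment> \<open>In the bulk, b b'' / \<sigma>^2 is at most K \<sigma>^2 / lo; inserting a^2 /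
    lo^2 >= 1 turns this into a multiple of the summand of A, and the 2 is the halving in
    \<open>D\<close>. The terminal coefficient is at most L / lo, which is the constant c.\<close>
  define K' where "K' = K / (2 * lo ^ 3)"
  define c where "c = L / lo"
  have K': "K' \<ge> 0" and c: "c \<ge> 0" using K L lo by (auto simp: K'_def c_def)
  have bb: "0 < b j k" "b j k \<le> 1 / lo" if "k \<le> Suc j" for j k
    using apos[OF that] bnd[OF grid[OF that]] lo unfolding b_def a_def \<alpha>_def by (auto intro: divide_left_mono)
  have Db: "\<bar>D j \<omega>\<bar> \<le> K' * F.A j \<omega> + c / 2 * (F.Yend j \<omega>)\<^sup>2" for j \<omega>
  proof -
    let ?s = "(\<sigma> j)\<^sup>2"
    have s: "?s > 0" using \<sigma>pos[of j] by simp
    define y where "y = (\<lambda>k. (Y j (Suc k) \<omega>)\<^sup>2)"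
    have y: "y k \<ge> 0" for k by (simp add: y_def)
    have summand: "\<bar>b j (Suc k) * (b j (Suc (Suc k)) - 2 * b j (Suc k) + b j k) / ?s * y k\<bar> \<le> K / lo ^ 3 * (?s * ((a j (Suc k))\<^sup>2 * y k))" if k: "k < j" for k
    proof -
      let ?t = "real (Suc k) / real (Suc j)"
      have t: "?t + ?s = real (Suc (Suc k)) / real (Suc j)" "?t - ?s = real k / real (Suc j)"
        using gap[of "Suc k" j] gap[of k j] by linarith+
      have "\<bar>b j (Suc (Suc k)) - 2 * b j (Suc k) + b j k\<bar> \<le> K * ?s\<^sup>2"
        using sd[of ?s ?t] grid[of k j] grid[of "Suc (Suc k)" j] k s unfolding t b_def a_def \<alpha>_def by auto
      then have "\<bar>b j (Suc k)\<bar> * \<bar>b j (Suc (Suc k)) - 2 * b j (Suc k) + b j k\<bar> \<le> 1 / lo * (K * ?s\<^sup>2)"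
        using bb[of "Suc k" j] k lo by (intro mult_mono) auto
      then have "\<bar>b j (Suc k) * (b j (Suc (Suc k)) - 2 * b j (Suc k) + b j k)\<bar> / ?s \<le> 1 / lo * (K * ?s\<^sup>2) / ?s"
        unfolding abs_mult using s by (intro divide_right_mono) auto
      also have "\<dots> = K / lo * ?s" using s by (simp add: power2_eq_square)
      finally have 1: "\<bar>b j (Suc k) * (b j (Suc (Suc k)) - 2 * b j (Suc k) + b j k) / ?s\<bar> \<le> K / lo * ?s"
        using s by (simp add: abs_divide)
      have "lo\<^sup>2 \<le> (a j (Suc k))\<^sup>2"
        using bnd[OF grid[of "Suc k" j]] k lo unfolding a_def \<alpha>_def by (intro power_mono) auto
      then have 2: "1 \<le> (a j (Suc k))\<^sup>2 / lo\<^sup>2" using lo by (simp add: field_simps)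
      have "\<bar>b j (Suc k) * (b j (Suc (Suc k)) - 2 * b j (Suc k) + b j k) / ?s * y k\<bar> \<le> K / lo * ?s * y k"
        using mult_right_mono[OF 1 y[of k]] y[of k] by (simp add: abs_mult)
      also have "\<dots> \<le> K / lo * ?s * y k * ((a j (Suc k))\<^sup>2 / lo\<^sup>2)"
        using mult_left_mono[OF 2, of "K / lo * ?s * y k"] K lo s y[of k] by simp
      also have "\<dots> = K / lo ^ 3 * (?s * ((a j (Suc k))\<^sup>2 * y k))"
        by (simp add: power3_eq_cube power2_eq_square mult_ac)
      finally show ?thesis .
    qed
    have "\<bar>\<Sum>k<j. b j (Suc k) * (b j (Suc (Suc k)) - 2 * b j (Suc k) + b j k) / ?s * y k\<bar> \<le> (\<Sum>k<j. K / lo ^ 3 * (?s * ((a j (Suc k))\<^sup>2 * y k)))"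
      by (intro order_trans[OF sum_abs] sum_mono summand) auto
    also have "\<dots> = K / lo ^ 3 * F.A j \<omega>" unfolding FA y_def sum_distrib_left ..
    finally have 1: "\<bar>\<Sum>k<j. b j (Suc k) * (b j (Suc (Suc k)) - 2 * b j (Suc k) + b j k) / ?s * y k\<bar> \<le> K / lo ^ 3 * F.A j \<omega>" .
    have "\<bar>b j (Suc j) - b j j\<bar> \<le> L * \<bar>real (Suc j) / real (Suc j) - real j / real (Suc j)\<bar>"
      unfolding b_def a_def \<alpha>_def by (rule lip'[OF grid grid]) auto
    then have "\<bar>b j (Suc j) - b j j\<bar> \<le> L * ?s" unfolding gap by simp
    then have "\<bar>b j (Suc j)\<bar> * \<bar>b j (Suc j) - b j j\<bar> \<le> 1 / lo * (L * ?s)"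
      using bb[of "Suc j" j] lo by (intro mult_mono) auto
    then have "\<bar>b j (Suc j) * (b j (Suc j) - b j j)\<bar> / ?s \<le> 1 / lo * (L * ?s) / ?s"
      unfolding abs_mult using s by (intro divide_right_mono) auto
    then have "\<bar>b j (Suc j) * (b j (Suc j) - b j j) / ?s\<bar> \<le> c"
      using s by (simp add: abs_divide c_def)
    from mult_right_mono[OF this zero_le_power2]
    have 2: "\<bar>b j (Suc j) * (b j (Suc j) - b j j) / ?s * (Y j (Suc j) \<omega>)\<^sup>2\<bar> \<le> c * (Y j (Suc j) \<omega>)\<^sup>2"
      unfolding abs_mult[of _ "(Y j (Suc j) \<omega>)\<^sup>2"] abs_power2 .
    have half_diff_bound: "\<bar>(u - v) / 2\<bar> \<le> (u' + v') / 2" if "\<bar>u\<bar> \<le> u'" "\<bar>v\<bar> \<le> v'" for u v u' v' :: real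
      using that by (simp add: abs_le_iff)
    have "\<bar>D j \<omega>\<bar> \<le> (K / lo ^ 3 * F.A j \<omega> + c * (Y j (Suc j) \<omega>)\<^sup>2) / 2"
      unfolding D_def by (rule half_diff_bound[OF 1[unfolded y_def] 2])
    also have "\<dots> = K' * F.A j \<omega> + c / 2 * (F.Yend j \<omega>)\<^sup>2"
      using lo by (simp add: K'_def FY field_simps)
    finally show ?thesis .
  qed
  have Xlim: "(\<lambda>j. Xn j \<omega>) \<longlonglongrightarrow> X \<omega>" if "\<omega> \<in> space M" for \<omega>
  proof -
    have "Xn j \<omega> = (\<Sum>k<j. \<psi> (real (Suc k) / real (Suc j)) *
      (reflected_walk (\<lambda>_. 1) (\<lambda>i. grid_increment W (Suc j) i \<omega>) (Suc k))\<^sup>2) / real (Suc j)" for j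
    proof -
      have "(\<Sum>k<j. (a j (Suc k)) ^ 4 * (Z j (Suc k) \<omega>)\<^sup>2) = (\<Sum>k<j. \<psi> (real (Suc k) / real (Suc j)) *
        (reflected_walk (\<lambda>_. 1) (\<lambda>i. grid_increment W (Suc j) i \<omega>) (Suc k))\<^sup>2)"
        unfolding a_def Z_def \<zeta>_def by (intro sum.cong refl) (subst \<alpha>4[OF grid], auto)
      then show ?thesis unfolding Xn_def \<sigma>2 by simp
    qed
    then show ?thesis
      using weighted_sum_reflected_walk_tendsto[where W = W and \<omega> = \<omega>, OF Wc[OF that] \<psi>c] by (simp only: X_def)
  qed
  \<comment> \<open>Measurability of the functional of the running supremum is inherited from the
    walks, which converge at every point of the space.\<close>
  have Xm [measurable]: "X \<in> borel_measurable M"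
    by (rule borel_measurable_LIMSEQ_real[OF Xlim Xnm])
  \<comment> \<open>The transfer between the two walks is exact for each j; the limit is then taken
    pathwise on the side of X.\<close>
  have key: "(\<lambda>j. expectation (\<lambda>\<omega>. cutoff x1 x2 (F.A j \<omega>) * exp (D j \<omega>))) \<longlonglongrightarrow> \<kappa> * expectation (\<lambda>\<omega>. cutoff x1 x2 (X \<omega>))"
    if x: "x1 < x2" for x1 x2
  proof -
    have "expectation (\<lambda>\<omega>. cutoff x1 x2 (F.A j \<omega>) * exp (D j \<omega>)) = \<kappa> * expectation (\<lambda>\<omega>. cutoff x1 x2 (Xn j \<omega>))" for j
      unfolding cutoff_eq_cutoff_exp by (rule transfer(2)[OF continuous_on_cutoff_exp[OF x]])
    moreover have "(\<lambda>j. expectation (\<lambda>\<omega>. cutoff x1 x2 (Xn j \<omega>))) \<longlonglongrightarrow> expectation (\<lambda>\<omega>. cutoff x1 x2 (X \<omega>))"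
    proof (rule integral_dominated_convergence[where w = "\<lambda>_. 1"])
      show "AE \<omega> in M. (\<lambda>j. cutoff x1 x2 (Xn j \<omega>)) \<longlonglongrightarrow> cutoff x1 x2 (X \<omega>)"
        using continuous_on_tendsto_compose[OF continuous_on_cutoff[OF x] Xlim] by (intro AE_I2) auto
      show "AE \<omega> in M. norm (cutoff x1 x2 (Xn j \<omega>)) \<le> 1" for j
        using cutoff_bounds by (intro AE_I2) auto
    qed (use Xnm in \<open>auto intro!: measurable_compose[OF _ measurable_cutoff]\<close>)
    ultimately show ?thesis by (simp add: tendsto_mult_left)
  qed
  have int: "integrable M (\<lambda>\<omega>. exp (D j \<omega>))" for j
    by (rule transfer(1)[where g = "\<lambda>_. 0"]) simp
  have intc: "integrable M (\<lambda>\<omega>. cutoff x1 x2 (X \<omega>))" for x1 x2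
    using cutoff_bounds by (intro integrable_const_bound[where B = 1]) auto
  have ind: "expectation (indicator {\<omega> \<in> space M. X \<omega> \<le> x}) = prob {\<omega> \<in> space M. X \<omega> \<le> x}"
    "integrable M (indicator {\<omega> \<in> space M. X \<omega> \<le> x} :: 'a \<Rightarrow> real)" for x
    by (auto simp: integrable_indicator_iff emeasure_eq_measure)
  have le1: "prob {\<omega> \<in> space M. X \<omega> \<le> x1} \<le> expectation (\<lambda>\<omega>. cutoff x1 x2 (X \<omega>))" if "x1 < x2" for x1 x2
    unfolding ind(1)[symmetric]
    by (intro integral_mono ind(2) intc) (use that cutoff_bounds cutoff_eq_1 in \<open>auto split: split_indicator\<close>)
  have le2: "expectation (\<lambda>\<omega>. cutoff x1 x2 (X \<omega>)) \<le> prob {\<omega> \<in> space M. X \<omega> \<le> x2}" if "x1 < x2" for x1 x2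
    unfolding ind(1)[symmetric]
    by (intro integral_mono ind(2) intc) (use that cutoff_bounds cutoff_eq_0 in \<open>auto split: split_indicator\<close>)
  show ?thesis
  proof (rule that[OF \<theta>pos K' c])
    fix x1 x2 :: real assume x: "0 < x1" "x1 < x2" and cx: "4 * c * (2 * x2) \<le> \<theta>"
    note B = F.cutoff_functional_bounds[OF x c cx K' Dm Db key[OF x(2)] int]
    have "\<kappa> * prob {\<omega> \<in> space M. X \<omega> \<le> x1} \<le> \<kappa> * expectation (\<lambda>\<omega>. cutoff x1 x2 (X \<omega>))"
      by (rule mult_left_mono[OF le1[OF x(2)] \<kappa>0])
    then show "\<kappa> * prob {\<omega> \<in> space M. X \<omega> \<le> x1} \<le> exp (K' * x2) *
        (sqrt 2 * (2 * std_normal_density (\<theta> / (2 * sqrt x2)) / (\<theta> / (2 * sqrt x2))) + small_ball_remainder \<theta> c x2)"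
      using B(1) by (rule order_trans)
    assume w: "\<theta> / (2 * sqrt x1) \<ge> 1"
    have "\<kappa> * expectation (\<lambda>\<omega>. cutoff x1 x2 (X \<omega>)) \<le> \<kappa> * prob {\<omega> \<in> space M. X \<omega> \<le> x2}"
      by (rule mult_left_mono[OF le2[OF x(2)] \<kappa>0])
    with B(2)[OF w] show "exp (- (K' * x2)) * (sqrt 2 * (2 * std_normal_density (\<theta> / (2 * sqrt x1)) * (\<theta> / (2 * sqrt x1) / (1 + (\<theta> / (2 * sqrt x1))\<^sup>2)))
        - small_ball_remainder \<theta> c x2) \<le> \<kappa> * prob {\<omega> \<in> space M. X \<omega> \<le> x2}"
      by (rule order_trans)
  qed
qed

theorem proposition8:
  fixes M :: "'a measure"
    and W S :: "real \<Rightarrow> 'a \<Rightarrow> real"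
    and \<psi> :: "real \<Rightarrow> real"
    and \<theta> :: real
  assumes "standard_brownian_motion_on {0..1} M W"
    and "S = running_sup W"
    and "\<And>t. t \<in> {0..1} \<Longrightarrow> \<psi> t > 0"
    and "twice_continuously_differentiable_on {0..1} \<psi>"
    and "\<theta> = (LBINT t:{0..1}. sqrt (\<psi> t))"
  shows "asymp_equiv
      (\<lambda>\<epsilon>. measure M {\<omega> \<in> space M. weighted_L2_norm \<psi> (\<lambda>t. S t \<omega> - W t \<omega>) \<le> \<epsilon>})
      (at_right 0)
      (\<lambda>\<epsilon>. 4 * \<psi> 0 powr (1/8) / (sqrt pi * \<theta> * \<psi> 1 powr (1/8)) * \<epsilon>
            * exp (- (\<theta>\<^sup>2 / 8) * \<epsilon> powr (-2)))"
proof (rule reflected_norm_distribution_bounds[OF assms(1,3,4,5)], assumption)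
  fix K c :: real
  define X where "X = (\<lambda>\<omega>. LBINT t:{0..1}. (running_sup W t \<omega> - W t \<omega>)\<^sup>2 * \<psi> t)"
  define \<kappa> where "\<kappa> = sqrt (\<psi> 1 powr (1/4) / \<psi> 0 powr (1/4))"
  define p where "p = (\<lambda>x. measure M {\<omega> \<in> space M. X \<omega> \<le> x})"
  assume \<theta>: "\<theta> > 0" and K: "K \<ge> 0" and c: "c \<ge> 0"
    and up0: "\<And>x1 x2. 0 < x1 \<Longrightarrow> x1 < x2 \<Longrightarrow> 4 * c * (2 * x2) \<le> \<theta> \<Longrightarrow>
      sqrt (\<psi> 1 powr (1/4) / \<psi> 0 powr (1/4)) *
      measure M {\<omega> \<in> space M. (LBINT t:{0..1}. (running_sup W t \<omega> - W t \<omega>)\<^sup>2 * \<psi> t) \<le> x1} \<le> exp (K * x2) *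
        (sqrt 2 * (2 * std_normal_density (\<theta> / (2 * sqrt x2)) / (\<theta> / (2 * sqrt x2))) + small_ball_remainder \<theta> c x2)"
    and low0: "\<And>x1 x2. 0 < x1 \<Longrightarrow> x1 < x2 \<Longrightarrow> 4 * c * (2 * x2) \<le> \<theta> \<Longrightarrow> \<theta> / (2 * sqrt x1) \<ge> 1 \<Longrightarrow>
      exp (- (K * x2)) * (sqrt 2 * (2 * std_normal_density (\<theta> / (2 * sqrt x1)) * (\<theta> / (2 * sqrt x1) / (1 + (\<theta> / (2 * sqrt x1))\<^sup>2)))
        - small_ball_remainder \<theta> c x2) \<le> sqrt (\<psi> 1 powr (1/4) / \<psi> 0 powr (1/4)) *
      measure M {\<omega> \<in> space M. (LBINT t:{0..1}. (running_sup W t \<omega> - W t \<omega>)\<^sup>2 * \<psi> t) \<le> x2}"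
  define U where "U = (\<lambda>x2. exp (K * x2) *
        (sqrt 2 * (2 * std_normal_density (\<theta> / (2 * sqrt x2)) / (\<theta> / (2 * sqrt x2))) + small_ball_remainder \<theta> c x2))"
  define V where "V = (\<lambda>x1 x2. exp (- (K * x2)) * (sqrt 2 * (2 * std_normal_density (\<theta> / (2 * sqrt x1)) * (\<theta> / (2 * sqrt x1) / (1 + (\<theta> / (2 * sqrt x1))\<^sup>2)))
        - small_ball_remainder \<theta> c x2))"
  have up: "\<kappa> * p x1 \<le> U x2" if "0 < x1" "x1 < x2" "4 * c * (2 * x2) \<le> \<theta>" for x1 x2
    using up0[OF that] unfolding \<kappa>_def p_def X_def U_def .
  have low: "V x1 x2 \<le> \<kappa> * p x2"
    if "0 < x1" "x1 < x2" "4 * c * (2 * x2) \<le> \<theta>" "\<theta> / (2 * sqrt x1) \<ge> 1" for x1 x2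
    using low0[OF that] unfolding \<kappa>_def p_def X_def V_def .
  have \<psi>: "\<psi> 0 > 0" "\<psi> 1 > 0" using assms(3) by auto
  have \<kappa>: "\<kappa> > 0" using \<psi> by (simp add: \<kappa>_def)
  \<comment> \<open>The gap between x1 and x2 is closed inside the explicit bound: x2 decreases to x
    while the probability stays fixed.\<close>
  have up': "\<kappa> * p x \<le> U x" if x: "x > 0" "4 * c * (2 * x) < \<theta>" for x
  proof (rule tendsto_lowerbound)
    have "isCont U x"
      unfolding U_def small_ball_remainder_def std_normal_density_def
      using x \<theta> by (intro continuous_intros) auto
    then show "(U \<longlongrightarrow> U x) (at_right x)"
      unfolding isCont_def by (rule filterlim_at_split[THEN iffD1, THEN conjunct2])
    have "((\<lambda>y. 4 * c * (2 * y)) \<longlongrightarrow> 4 * c * (2 * x)) (at_right x)" by (intro tendsto_intros)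
    then have "\<forall>\<^sub>F y in at_right x. 4 * c * (2 * y) < \<theta>" by (rule order_tendstoD) (rule x)
    then show "\<forall>\<^sub>F y in at_right x. \<kappa> * p x \<le> U y"
      using eventually_at_right_less[of x] by eventually_elim (use x up in auto)
  qed simp
  \<comment> \<open>Now x1 increases to x with x2 = x fixed; smaller x1 only helps the condition on
    \<theta> / (2 * sqrt x1).\<close>
  have low': "V x x \<le> \<kappa> * p x" if x: "x > 0" "4 * c * (2 * x) \<le> \<theta>" "\<theta> / (2 * sqrt x) \<ge> 1" for x
  proof (rule tendsto_upperbound)
    have "isCont (\<lambda>y. V y x) x"
      unfolding V_def std_normal_density_def
      using x \<theta> by (intro continuous_intros) (auto simp: add_nonneg_eq_0_iff)
    then show "((\<lambda>y. V y x) \<longlongrightarrow> V x x) (at_left x)"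
      unfolding isCont_def by (rule filterlim_at_split[THEN iffD1, THEN conjunct1])
    have "\<forall>\<^sub>F y in at_left x. y \<in> {0<..<x}" by (rule eventually_at_leftI[of 0]) (use x in auto)
    then show "\<forall>\<^sub>F y in at_left x. V y x \<le> \<kappa> * p x"
    proof eventually_elim
      case (elim y)
      then have "sqrt y \<le> sqrt x" "0 < sqrt y" by auto
      then have "\<theta> / (2 * sqrt x) \<le> \<theta> / (2 * sqrt y)" using \<theta> by (intro divide_left_mono) auto
      then have "1 \<le> \<theta> / (2 * sqrt y)" using x(3) by (rule order_trans[rotated])
      then show ?case using elim x by (intro low) auto
    qed
  qed simp
  define f where "f = (\<lambda>\<epsilon>. measure M {\<omega> \<in> space M. weighted_L2_norm \<psi> (\<lambda>t. S t \<omega> - W t \<omega>) \<le> \<epsilon>})"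
  define g where "g = (\<lambda>\<epsilon>. 4 * \<psi> 0 powr (1/8) / (sqrt pi * \<theta> * \<psi> 1 powr (1/8)) * \<epsilon>
            * exp (- (\<theta>\<^sup>2 / 8) * \<epsilon> powr (-2)))"
  define R where "R = (\<lambda>\<epsilon>. (sqrt 2 * (exp (- (\<theta>\<^sup>2 / \<epsilon>\<^sup>2)) / (1 - exp (- (\<theta>\<^sup>2 / \<epsilon>\<^sup>2)))) + 16 * c * \<epsilon>\<^sup>2 / \<theta>) * (sqrt pi * \<theta> / (4 * \<epsilon>)))"
  have R: "(R \<longlongrightarrow> 0) (at_right 0)"
    unfolding R_def by (rule small_ball_remainder_ratio_tendsto[OF \<theta>])
  have f_eq: "f \<epsilon> = p (\<epsilon>\<^sup>2)" if "\<epsilon> > 0" for \<epsilon>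
  proof -
    have "sqrt y \<le> \<epsilon> \<longleftrightarrow> y \<le> \<epsilon>\<^sup>2" for y
      using that real_sqrt_le_iff[of y "\<epsilon>\<^sup>2"] by simp
    then show ?thesis unfolding f_def p_def X_def weighted_L2_norm_def assms(2) by simp
  qed
  \<comment> \<open>As \<kappa> = (\<psi>(1)/\<psi>(0))^(1/8), dividing by it produces the eighth
    powers in the claimed prefactor.\<close>
  have main: "4 / (sqrt pi * \<theta>) * \<epsilon> * exp (- (\<theta>\<^sup>2 / (8 * \<epsilon>\<^sup>2))) = \<kappa> * g \<epsilon>" if e: "\<epsilon> > 0" for \<epsilon>
  proof -
    have k: "\<kappa> = \<psi> 1 powr (1/8) / \<psi> 0 powr (1/8)"
      using \<psi> by (simp add: \<kappa>_def real_sqrt_divide powr_half_sqrt[symmetric] powr_powr)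
    have "- (\<theta>\<^sup>2 / 8) * \<epsilon> powr (-2) = - (\<theta>\<^sup>2 / (8 * \<epsilon>\<^sup>2))"
      using e by (simp add: powr_minus_divide powr_numeral)
    then show ?thesis using \<psi> unfolding g_def k by simp
  qed
  have gpos: "g \<epsilon> > 0" if "\<epsilon> > 0" for \<epsilon>
    unfolding g_def using that \<psi> \<theta> by (intro mult_pos_pos divide_pos_pos) auto
  \<comment> \<open>The constant: sqrt 2 from the k = 0 term, 2 from the half-normal density, 2
    \<epsilon>/\<theta> from Mills' ratio and 1/sqrt(2 pi) from the normal density give 4 \<epsilon>
    / (sqrt pi \<theta>).\<close>
  have dens: "sqrt 2 * (2 * std_normal_density (\<theta> / (2 * \<epsilon>)) / (\<theta> / (2 * \<epsilon>))) = \<kappa> * g \<epsilon>" if e: "\<epsilon> > 0" for \<epsilon>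
  proof -
    have "(\<theta> / (2 * \<epsilon>))\<^sup>2 / 2 = \<theta>\<^sup>2 / (8 * \<epsilon>\<^sup>2)" by (simp add: power_divide power_mult_distrib)
    then have "std_normal_density (\<theta> / (2 * \<epsilon>)) = 1 / (sqrt 2 * sqrt pi) * exp (- (\<theta>\<^sup>2 / (8 * \<epsilon>\<^sup>2)))"
      by (simp add: std_normal_density_def real_sqrt_mult)
    then show ?thesis unfolding main[OF e, symmetric] using \<theta> e by (simp add: field_simps)
  qed
  have rem: "small_ball_remainder \<theta> c (\<epsilon>\<^sup>2) = R \<epsilon> * (\<kappa> * g \<epsilon>)" if e: "\<epsilon> > 0" for \<epsilon>
  proof -
    have "sqrt pi * \<theta> / (4 * \<epsilon>) * (4 / (sqrt pi * \<theta>) * \<epsilon> * exp (- (\<theta>\<^sup>2 / (8 * \<epsilon>\<^sup>2)))) = exp (- (\<theta>\<^sup>2 / (8 * \<epsilon>\<^sup>2)))"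
      using \<theta> e by simp
    then show ?thesis
      unfolding small_ball_remainder_def R_def main[OF e, symmetric] by (simp only: mult.assoc mult.commute[of "exp _"])
  qed
  have small: "\<forall>\<^sub>F \<epsilon> in at_right 0. 0 < \<epsilon> \<and> 4 * c * (2 * \<epsilon>\<^sup>2) < \<theta> \<and> \<theta> / (2 * \<epsilon>) \<ge> 1"
  proof -
    have "((\<lambda>\<epsilon>. 4 * c * (2 * \<epsilon>\<^sup>2)) \<longlongrightarrow> 4 * c * (2 * 0\<^sup>2)) (at_right 0)" by (intro tendsto_intros)
    then have 1: "\<forall>\<^sub>F \<epsilon> in at_right 0. 4 * c * (2 * \<epsilon>\<^sup>2) < \<theta>" by (rule order_tendstoD) (use \<theta> in simp)
    have 2: "\<forall>\<^sub>F \<epsilon> in at_right 0. \<epsilon> \<in> {0<..<\<theta> / 2}" by (rule eventually_at_rightI[of 0 "\<theta> / 2"]) (use \<theta> in auto)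
    show ?thesis using 1 2 by eventually_elim (auto simp: field_simps)
  qed
  have "((\<lambda>\<epsilon>. f \<epsilon> / g \<epsilon>) \<longlongrightarrow> 1) (at_right 0)"
  proof (rule tendsto_sandwich[where h = "\<lambda>\<epsilon>. exp (K * \<epsilon>\<^sup>2) * (1 + R \<epsilon>)"
      and f = "\<lambda>\<epsilon>. exp (- (K * \<epsilon>\<^sup>2)) * ((\<theta> / (2 * \<epsilon>))\<^sup>2 / (1 + (\<theta> / (2 * \<epsilon>))\<^sup>2) - R \<epsilon>)"])
    show "((\<lambda>\<epsilon>. exp (K * \<epsilon>\<^sup>2) * (1 + R \<epsilon>)) \<longlongrightarrow> 1) (at_right 0)"
    proof -
      have "((\<lambda>\<epsilon>. exp (K * \<epsilon>\<^sup>2) * (1 + R \<epsilon>)) \<longlongrightarrow> exp (K * 0\<^sup>2) * (1 + 0)) (at_right 0)"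
        by (intro tendsto_intros R)
      then show ?thesis by simp
    qed
    show "((\<lambda>\<epsilon>. exp (- (K * \<epsilon>\<^sup>2)) * ((\<theta> / (2 * \<epsilon>))\<^sup>2 / (1 + (\<theta> / (2 * \<epsilon>))\<^sup>2) - R \<epsilon>)) \<longlongrightarrow> 1) (at_right 0)"
    proof -
      have "((\<lambda>\<epsilon>. (\<theta> / (2 * \<epsilon>))\<^sup>2 / (1 + (\<theta> / (2 * \<epsilon>))\<^sup>2)) \<longlongrightarrow> 1) (at_right 0)"
        using \<theta> by real_asymp
      then have "((\<lambda>\<epsilon>. exp (- (K * \<epsilon>\<^sup>2)) * ((\<theta> / (2 * \<epsilon>))\<^sup>2 / (1 + (\<theta> / (2 * \<epsilon>))\<^sup>2) - R \<epsilon>)) \<longlongrightarrow> exp (- (K * 0\<^sup>2)) * (1 - 0)) (at_right 0)"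
        by (intro tendsto_intros R)
      then show ?thesis by simp
    qed
    show "\<forall>\<^sub>F \<epsilon> in at_right 0. f \<epsilon> / g \<epsilon> \<le> exp (K * \<epsilon>\<^sup>2) * (1 + R \<epsilon>)"
      using small
    proof eventually_elim
      case (elim \<epsilon>)
      then have e: "\<epsilon> > 0" by simp
      have "\<kappa> * f \<epsilon> \<le> U (\<epsilon>\<^sup>2)" using up'[of "\<epsilon>\<^sup>2"] elim by (simp add: f_eq)
      also have "\<dots> = \<kappa> * (exp (K * \<epsilon>\<^sup>2) * (1 + R \<epsilon>) * g \<epsilon>)"
      proof -
        have "sqrt (\<epsilon>\<^sup>2) = \<epsilon>" using e by simp
        then show ?thesis
          unfolding U_def by (simp only: dens[OF e] rem[OF e]) (simp add: algebra_simps)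
      qed
      finally have "f \<epsilon> \<le> exp (K * \<epsilon>\<^sup>2) * (1 + R \<epsilon>) * g \<epsilon>" using \<kappa> by simp
      then show ?case using gpos[OF e] by (simp add: pos_divide_le_eq)
    qed
    show "\<forall>\<^sub>F \<epsilon> in at_right 0. exp (- (K * \<epsilon>\<^sup>2)) * ((\<theta> / (2 * \<epsilon>))\<^sup>2 / (1 + (\<theta> / (2 * \<epsilon>))\<^sup>2) - R \<epsilon>) \<le> f \<epsilon> / g \<epsilon>"
      using small
    proof eventually_elim
      case (elim \<epsilon>)
      then have e: "\<epsilon> > 0" by simp
      define w where "w = \<theta> / (2 * \<epsilon>)"
      have w: "w > 0" using \<theta> e by (simp add: w_def)
      \<comment> \<open>Mills' lower bound is the upper one times w^2/(1 + w^2), which tends to 1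
        since w = \<theta>/(2 \<epsilon>) tends to infinity.\<close>
      have "sqrt 2 * (2 * std_normal_density w * (w / (1 + w\<^sup>2))) = sqrt 2 * (2 * std_normal_density w / w) * (w\<^sup>2 / (1 + w\<^sup>2))"
        using w by (simp add: power2_eq_square)
      also have "\<dots> = w\<^sup>2 / (1 + w\<^sup>2) * (\<kappa> * g \<epsilon>)" using dens[OF e] unfolding w_def by simp
      finally have dl: "sqrt 2 * (2 * std_normal_density w * (w / (1 + w\<^sup>2))) = w\<^sup>2 / (1 + w\<^sup>2) * (\<kappa> * g \<epsilon>)" .
      have "\<kappa> * (exp (- (K * \<epsilon>\<^sup>2)) * (w\<^sup>2 / (1 + w\<^sup>2) - R \<epsilon>) * g \<epsilon>) = exp (- (K * \<epsilon>\<^sup>2)) * (w\<^sup>2 / (1 + w\<^sup>2) * (\<kappa> * g \<epsilon>) - R \<epsilon> * (\<kappa> * g \<epsilon>))"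
        by (simp only: left_diff_distrib right_diff_distrib mult_ac)
      also have "\<dots> = V (\<epsilon>\<^sup>2) (\<epsilon>\<^sup>2)"
      proof -
        have "sqrt (\<epsilon>\<^sup>2) = \<epsilon>" using e by simp
        then show ?thesis unfolding V_def rem[OF e, symmetric] w_def by (simp only: dl[unfolded w_def])
      qed
      also have "\<dots> \<le> \<kappa> * f \<epsilon>" using low'[of "\<epsilon>\<^sup>2"] elim by (simp add: f_eq)
      finally have "exp (- (K * \<epsilon>\<^sup>2)) * (w\<^sup>2 / (1 + w\<^sup>2) - R \<epsilon>) * g \<epsilon> \<le> f \<epsilon>" using \<kappa> by simp
      then show ?case unfolding w_def[symmetric] using gpos[OF e] by (simp only: pos_le_divide_eq)
    qed
  qed
  then show ?thesis unfolding f_def g_def by (rule asymp_equivI')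
qed

end
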